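(* For $0\le k\le n$, the rank of the quantum Russell space $R^q_{n,k}$ as a $\mathbb{Z}[q,q^{-1}]$-module is $$\operatorname{rank}(R^q_{n,k})=\binom{2n}{n+k}-\binom{2n}{n+k+1}=\frac{2k+1}{n+k+1}\binom{2n}{n+k}.$$
   Context: A diagram is a crossingless matching of the points $1,\ldots,2n$ on a line (arcs below the line) with exactly $k$ of its arcs dotted (one dot each). Let $\widetilde R^q_{n,k}$ be the free $\mathbb{Z}[q,q^{-1}]$-module on diagrams, and $R^q_{n,k}$ its quotient by the quantum Type I and II Russell relations. In these, $a<b<c<d$; the diagrams are identical except as indicated; a bar marks a dotted arc; $x_1,\ldots,x_\alpha$ are all undotted arcs $(e,e')$ with $e<a$, $d<e'$, ordered from innermost to outermost, $x_i=(x_{i_1},x_{i_2})$; $n_i$ is the number of dotted arcs $(y_1,y_2)$ with $x_{i_1}<y_1<a$ and $d<y_2<x_{i_2}$. Type I: $[ad,\overline{bc}]=[\overline{ab},cd]+[ab,\overline{cd}]+q^{-1}[\overline{ad},bc]+(1-q^{-2})\sum_{i=1}^\alpha q^{\,i-n_i}[ab,cd,\overline{x_i}]$. Type II: $[\overline{ab},\overline{cd}]=[\overline{ad},\overline{bc}]+(1-q^{-2})\sum_{i=1}^\alpha q^{\,i-1-n_i}[\overline{ad},bc,\overline{x_i}]$. (Here $[\ldots,\overline{x_i}]$ means that $x_i$ is dotted, the other $x_j$ staying undotted.) *)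

theory Defs
  imports
    "HOL-Library.Poly_Mapping"
    "HOL-Library.Extended_Real"
    "HOL-Algebra.Algebraic_Closure_Type"
    "Jordan_Normal_Form.Missing_VectorSpace"
begin

(* Z[q, 1/q], as the monoid ring of the additive monoid of integers over the integers:
   the multiplication of poly_mapping is convolution. *)
type_synonym laurent = "int \<Rightarrow>\<^sub>0 int"

definition q_pow :: "int \<Rightarrow> laurent" where
  "q_pow m = Poly_Mapping.single m 1"

abbreviation laurent_ring :: "laurent ring" where
  "laurent_ring \<equiv> ring_of_type_algebra"

(* The fields mult and one of a module record play no role in the locale module. *)
definition free_module :: "'b set \<Rightarrow> ('r::comm_ring_1, 'b \<Rightarrow>\<^sub>0 'r) module" where
  "free_module B =
     \<lparr>carrier = {f. Poly_Mapping.keys f \<subseteq> B},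
      monoid.mult = (\<lambda>_ _. 0), one = 0,
      ring.zero = 0, add = (+),
      module.smult = (\<lambda>r f. Poly_Mapping.map (\<lambda>c. r * c) f)\<rparr>"

definition quotient_module ::
    "('r, 'b, 'm) module_scheme \<Rightarrow> 'b set \<Rightarrow> ('r, 'b set) module" where
  "quotient_module M N =
     \<lparr>carrier = a_rcosets\<^bsub>M\<^esub> N,
      monoid.mult = (\<lambda>_ _. N), one = N,
      ring.zero = N, add = set_add M,
      module.smult = (\<lambda>r C. \<Union>x\<in>C. N +>\<^bsub>M\<^esub> (r \<odot>\<^bsub>M\<^esub> x))\<rparr>"

(* The rank of a module over an integral domain: the largest size of a linearly independent
   set. A quotient need not be free a priori, so the rank is not defined through bases. *)
definition module_rank ::
    "('r, 'q) ring_scheme \<Rightarrow> ('r, 'b, 'm) module_scheme \<Rightarrow> enat" where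
  "module_rank R M =
     (SUP S\<in>{S. finite S \<and> S \<subseteq> carrier M \<and> \<not> module.lin_dep R M S}. enat (card S))"

(* The arc joining i < j is the pair (i, j); a diagram is the pair of its set of arcs and
   its set of dotted arcs. *)
type_synonym arc = "nat \<times> nat"
type_synonym diagram = "arc set \<times> arc set"

definition crossingless_matching :: "nat \<Rightarrow> arc set \<Rightarrow> bool" where
  "crossingless_matching n A \<longleftrightarrow>
     A \<subseteq> {(i, j). 1 \<le> i \<and> i < j \<and> j \<le> 2 * n} \<and>
     (\<forall>p\<in>{1..2 * n}. \<exists>!x. x \<in> A \<and> (p = fst x \<or> p = snd x)) \<and>
     (\<nexists>a b c d. a < b \<and> b < c \<and> c < d \<and> (a, c) \<in> A \<and> (b, d) \<in> A)"

definition diagrams :: "nat \<Rightarrow> nat \<Rightarrow> diagram set" where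
  "diagrams n k = {(A, D). crossingless_matching n A \<and> D \<subseteq> A \<and> card D = k}"

(* The diagram written [U, D] with D barred: E and F are the arcs and the dotted arcs
   common to all diagrams of a relation. *)
definition dgm :: "arc set \<Rightarrow> arc set \<Rightarrow> arc set \<Rightarrow> arc set \<Rightarrow> diagram" where
  "dgm E F U D = (E \<union> U \<union> D, F \<union> D)"

(* Enclosing arcs are nested, so ordering by right endpoint goes from innermost to outermost. *)
definition undotted_enclosing :: "arc set \<Rightarrow> arc set \<Rightarrow> nat \<Rightarrow> nat \<Rightarrow> arc list" where
  "undotted_enclosing E F a d =
     sorted_key_list_of_set snd {(e, e') \<in> E - F. e < a \<and> d < e'}"

definition dotted_between :: "arc set \<Rightarrow> nat \<Rightarrow> nat \<Rightarrow> arc \<Rightarrow> nat" where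
  "dotted_between F a d x =
     card {(y\<^sub>1, y\<^sub>2) \<in> F. fst x < y\<^sub>1 \<and> y\<^sub>1 < a \<and> d < y\<^sub>2 \<and> y\<^sub>2 < snd x}"

(* A relation is represented by the difference of its two sides. The matching with arcs ad, bc
   can be crossingless while the one with ab, cd is not, so both are required to be. *)
definition type_I :: "nat \<Rightarrow> nat \<Rightarrow> (diagram \<Rightarrow>\<^sub>0 laurent) set" where
  "type_I n k =
     {Poly_Mapping.single (dgm E F {(a, d)} {(b, c)}) 1
        - (Poly_Mapping.single (dgm E F {(c, d)} {(a, b)}) 1
           + Poly_Mapping.single (dgm E F {(a, b)} {(c, d)}) 1
           + Poly_Mapping.single (dgm E F {(b, c)} {(a, d)}) (q_pow (-1))
           + (\<Sum>i = 1..length xs.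
                Poly_Mapping.single (dgm E F {(a, b), (c, d)} {xs ! (i - 1)})
                  ((1 - q_pow (-2))
                     * q_pow (int i - int (dotted_between F a d (xs ! (i - 1)))))))
      | E F a b c d xs.
          a < b \<and> b < c \<and> c < d \<and> F \<subseteq> E
          \<and> dgm E F {(a, d)} {(b, c)} \<in> diagrams n k
          \<and> dgm E F {(c, d)} {(a, b)} \<in> diagrams n k
          \<and> xs = undotted_enclosing E F a d}"

definition type_II :: "nat \<Rightarrow> nat \<Rightarrow> (diagram \<Rightarrow>\<^sub>0 laurent) set" where
  "type_II n k =
     {Poly_Mapping.single (dgm E F {} {(a, b), (c, d)}) 1
        - (Poly_Mapping.single (dgm E F {} {(a, d), (b, c)}) 1
           + (\<Sum>i = 1..length xs.
                Poly_Mapping.single (dgm E F {(b, c)} {(a, d), xs ! (i - 1)})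
                  ((1 - q_pow (-2))
                     * q_pow (int i - 1 - int (dotted_between F a d (xs ! (i - 1)))))))
      | E F a b c d xs.
          a < b \<and> b < c \<and> c < d \<and> F \<subseteq> E
          \<and> dgm E F {} {(a, b), (c, d)} \<in> diagrams n k
          \<and> dgm E F {} {(a, d), (b, c)} \<in> diagrams n k
          \<and> xs = undotted_enclosing E F a d}"

definition russell_free :: "nat \<Rightarrow> nat \<Rightarrow> (laurent, diagram \<Rightarrow>\<^sub>0 laurent) module" where
  "russell_free n k = free_module (diagrams n k)"

definition russell_space :: "nat \<Rightarrow> nat \<Rightarrow> (laurent, (diagram \<Rightarrow>\<^sub>0 laurent) set) module" where
  "russell_space n k =
     quotient_module (russell_free n k)
       (module.span laurent_ring (russell_free n k) (type_I n k \<union> type_II n k))"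

end

theory Submission
  imports Defs
begin

text \<open>
  Let \<open>x\<^sub>1, x\<^sub>2, \<dots>\<close> be operators with \<open>x\<^sub>j x\<^sub>i = q\<^sup>2 x\<^sub>i x\<^sub>j\<close> for \<open>i < j\<close> and \<open>x\<^sub>i\<^sup>2 = 0\<close>. An undotted arc \<open>(l, p)\<close> of a
  diagram is sent to a linear form in \<open>x\<^sub>l\<close>, \<open>x\<^sub>p\<close> and the \<open>x\<^sub>y\<close> for the left ends \<open>y\<close> of dotted arcs
  with \<open>l < y < p\<close>; a diagram is sent to the product of these forms, ordered by right end. (In terms
  of tangles: undotted arcs are quantum cups, dotted arcs are pairs of rays with highest weight labels,
  and of the two rays below an undotted arc the left one passes on one side of it and the right one on
  the other.) After a normalisation by powers of \<open>q\<close> the forms become additive in the interval, and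
  all enclosing arcs enter a relation through commutation rules only; both relations then follow by
  induction over the points to the right of \<open>d\<close>. Hence this map is defined on the Russell space.

  The relations rewrite every diagram into diagrams whose dotted arcs are not enclosed by any arc. The
  images of these are independent, because their leading monomials are given by the set of right ends
  of undotted arcs, which determines the diagram. These sets are exactly the ballot sets, which are
  counted by a difference of two binomial coefficients.
\<close>

section \<open>Ranks of quotients of free modules\<close>

text \<open>Two features let one computation serve every configuration. First, a dotted arc enters
  the product only through its left end, and a dot changes only the factors of undotted arcs over
  it: in such a form the part to the left of the dot is multiplied by q^2. Moving a dot therefore
  concerns the enclosing factors alone. Second, since x_i^2 = 0, segments that meet in a point obey
  the same commutation rule as disjoint ones, so cutting an arc creates no boundary terms. The
  difference of two products then telescopes beyond d: the right end of each enclosing arc deposits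
  one summand, in which its factor is missing and the dot sits at its left end. This is the diagram
  with x_i dotted. Balancing the right ends passed against the normalising powers of q turns the
  coefficient into the one with exponent i - n_i or i - 1 - n_i. The coefficients do not form a
  field and the quotient is not known to be free beforehand, so the upper bound for the rank comes
  from elimination without division.\<close>

definition smul :: "'r::comm_ring_1 \<Rightarrow> ('b \<Rightarrow>\<^sub>0 'r) \<Rightarrow> 'b \<Rightarrow>\<^sub>0 'r" where
  "smul r f = Poly_Mapping.map (\<lambda>c. r * c) f"

lemma lookup_smul [simp]: "Poly_Mapping.lookup (smul r f) b = r * Poly_Mapping.lookup f b"
  by (simp add: smul_def map.rep_eq when_def)

lemma smul_simps [simp]:
  "smul 0 f = 0" "smul 1 f = f" "smul r 0 = 0" "smul r (smul s f) = smul (r * s) f"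
  "smul r (- f) = - smul r f" "smul (- r) f = - smul r f"
  by (rule poly_mapping_eqI; simp add: mult.assoc)+

lemma smul_distribs:
  "smul r (f + g) = smul r f + smul r g" "smul (r + s) f = smul r f + smul s f"
  "smul r (f - g) = smul r f - smul r g" "smul (r - s) f = smul r f - smul s f"
  by (rule poly_mapping_eqI; simp add: lookup_add lookup_minus algebra_simps)+

lemma smul_sum: "smul r (\<Sum>i\<in>I. f i) = (\<Sum>i\<in>I. smul r (f i))"
  by (induction I rule: infinite_finite_induct) (auto simp: smul_distribs)

lemma keys_smul: "Poly_Mapping.keys (smul r f) \<subseteq> Poly_Mapping.keys f"
  by (auto simp: in_keys_iff)

lemma poly_mapping_sum_smul_single:
  "f = (\<Sum>b\<in>Poly_Mapping.keys f. smul (Poly_Mapping.lookup f b) (Poly_Mapping.single b 1))"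
proof (rule poly_mapping_eqI)
  fix k
  have "Poly_Mapping.lookup (\<Sum>b\<in>Poly_Mapping.keys f. smul (Poly_Mapping.lookup f b) (Poly_Mapping.single b 1)) k
      = (\<Sum>b\<in>Poly_Mapping.keys f. if b = k then Poly_Mapping.lookup f b else 0)"
    by (simp add: lookup_sum lookup_single when_def if_distrib cong: if_cong)
  then show "Poly_Mapping.lookup f k = Poly_Mapping.lookup (\<Sum>b\<in>Poly_Mapping.keys f. smul (Poly_Mapping.lookup f b) (Poly_Mapping.single b 1)) k"
    by (simp add: in_keys_iff)
qed

lemma free_module_simps [simp]:
  "carrier (free_module B) = {f. Poly_Mapping.keys f \<subseteq> B}"
  "\<zero>\<^bsub>free_module B\<^esub> = 0" "f \<oplus>\<^bsub>free_module B\<^esub> g = f + g"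
  "r \<odot>\<^bsub>free_module B\<^esub> f = smul r f"
  by (simp_all add: free_module_def smul_def)

lemma type_algebra_simps [simp]:
  "carrier (ring_of_type_algebra :: 'r::comm_ring_1 ring) = UNIV"
  "x \<otimes>\<^bsub>ring_of_type_algebra\<^esub> (y::'r) = x * y" "x \<oplus>\<^bsub>ring_of_type_algebra\<^esub> (y::'r) = x + y"
  "\<zero>\<^bsub>ring_of_type_algebra :: 'r ring\<^esub> = 0" "\<one>\<^bsub>ring_of_type_algebra :: 'r ring\<^esub> = 1"
  by (simp_all add: ring_of_type_algebra_def)

lemma keys_diff_subset: "Poly_Mapping.keys (f - g) \<subseteq> Poly_Mapping.keys f \<union> Poly_Mapping.keys (g :: 'b \<Rightarrow>\<^sub>0 'r::comm_ring_1)"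
  by (auto simp: in_keys_iff lookup_minus)

lemma abelian_group_free_module:
  "abelian_group (free_module B :: ('r::comm_ring_1, 'b \<Rightarrow>\<^sub>0 'r) module)"
proof (rule abelian_groupI)
  fix f g h :: "'b \<Rightarrow>\<^sub>0 'r"
  assume f: "f \<in> carrier (free_module B)" and g: "g \<in> carrier (free_module B)"
  then show "f \<oplus>\<^bsub>free_module B\<^esub> g \<in> carrier (free_module B)"
    using keys_add[of f g] by (simp add: subset_trans[OF keys_add])
  show "f \<oplus>\<^bsub>free_module B\<^esub> g = g \<oplus>\<^bsub>free_module B\<^esub> f" by (simp add: add.commute)
  show "f \<oplus>\<^bsub>free_module B\<^esub> g \<oplus>\<^bsub>free_module B\<^esub> h = f \<oplus>\<^bsub>free_module B\<^esub> (g \<oplus>\<^bsub>free_module B\<^esub> h)"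
    by (simp add: add.assoc)
  show "\<zero>\<^bsub>free_module B\<^esub> \<oplus>\<^bsub>free_module B\<^esub> f = f" by simp
  show "\<exists>y\<in>carrier (free_module B). y \<oplus>\<^bsub>free_module B\<^esub> f = \<zero>\<^bsub>free_module B\<^esub>"
    by (rule bexI[of _ "- f"]) (use f in simp_all)
qed simp

lemma module_free_module:
  fixes B :: "'b set"
  shows "module (ring_of_type_algebra :: 'r::comm_ring_1 ring) (free_module B)"
proof (rule moduleI)
  fix r :: 'r and f :: "'b \<Rightarrow>\<^sub>0 'r"
  assume "f \<in> carrier (free_module B)"
  then show "r \<odot>\<^bsub>free_module B\<^esub> f \<in> carrier (free_module B)"
    using keys_smul[of r f] by simp
qed (simp_all add: cring_from_type_algebra abelian_group_free_module smul_distribs)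

lemma free_module_finsum:
  assumes "finite A" "\<And>i. i \<in> A \<Longrightarrow> Poly_Mapping.keys (f i) \<subseteq> B"
  shows "finsum (free_module B :: ('r::comm_ring_1, 'b \<Rightarrow>\<^sub>0 'r) module) f A = (\<Sum>i\<in>A. f i)"
proof -
  interpret module "ring_of_type_algebra :: 'r ring" "free_module B :: ('r, 'b \<Rightarrow>\<^sub>0 'r) module"
    by (rule module_free_module)
  from assms show ?thesis
  proof (induction A rule: finite_induct)
    case (insert x F)
    then have "finsum (free_module B) f (insert x F) = f x \<oplus>\<^bsub>free_module B\<^esub> finsum (free_module B) f F"
      by (intro M.finsum_insert) auto
    then show ?case using insert by simp
  qed simp
qed

text \<open>Ordinary sums replace \<open>lincomb\<close> and \<open>finsum\<close>, so that closure
  properties of the span become plain algebra without carrier conditions.\<close>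

lemma free_module_span:
  fixes T :: "('b \<Rightarrow>\<^sub>0 'r::comm_ring_1) set"
  assumes "\<And>f. f \<in> T \<Longrightarrow> Poly_Mapping.keys f \<subseteq> B"
  shows "module.span ring_of_type_algebra (free_module B) T
         = {\<Sum>v\<in>A. smul (a v) v | a A. finite A \<and> A \<subseteq> T}"
proof -
  interpret module "ring_of_type_algebra :: 'r ring" "free_module B :: ('r, 'b \<Rightarrow>\<^sub>0 'r) module"
    by (rule module_free_module)
  have *: "lincomb a A = (\<Sum>v\<in>A. smul (a v) v)" if "finite A" "A \<subseteq> T" for a A
  proof -
    have "Poly_Mapping.keys (smul (a i) i) \<subseteq> B" if "i \<in> A" for i
      using order_trans[OF keys_smul assms] that \<open>A \<subseteq> T\<close> by blast
    with that show ?thesis unfolding lincomb_def by (subst free_module_finsum[symmetric]) simp_all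
  qed
  show ?thesis unfolding span_def
  proof (intro Collect_cong iffI)
    fix x assume "\<exists>a A. x = lincomb a A \<and> finite A \<and> A \<subseteq> T \<and> a \<in> A \<rightarrow> carrier ring_of_type_algebra"
    then obtain a A where "x = lincomb a A" "finite A" "A \<subseteq> T" by blast
    then show "\<exists>a A. x = (\<Sum>v\<in>A. smul (a v) v) \<and> finite A \<and> A \<subseteq> T"
      using *[of A a] by (intro exI[of _ a] exI[of _ A]) simp
  next
    fix x assume "\<exists>a A. x = (\<Sum>v\<in>A. smul (a v) v) \<and> finite A \<and> A \<subseteq> T"
    then obtain a A where "x = (\<Sum>v\<in>A. smul (a v) v)" "finite A" "A \<subseteq> T" by blast
    then show "\<exists>a A. x = lincomb a A \<and> finite A \<and> A \<subseteq> T \<and> a \<in> A \<rightarrow> carrier ring_of_type_algebra"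
      using *[of A a] by (intro exI[of _ a] exI[of _ A]) simp
  qed
qed

section \<open>The quotient by the submodule spanned by a set of relators\<close>

locale free_quotient =
  fixes B :: "'b set" and T :: "('b \<Rightarrow>\<^sub>0 'r::idom) set"
  assumes T_keys: "\<And>f. f \<in> T \<Longrightarrow> Poly_Mapping.keys f \<subseteq> B"
begin

definition "N = module.span ring_of_type_algebra (free_module B) T"
definition "Q = quotient_module (free_module B) N"
text \<open>All operations of \<open>Q\<close> are computed on representatives, with
  \<open>cls_eq_iff\<close> as the test for equality.\<close>

definition "cls x = (\<lambda>h. h + x) ` N"

lemma N_eq: "N = {\<Sum>v\<in>A. smul (a v) v | a A. finite A \<and> A \<subseteq> T}"
  unfolding N_def by (rule free_module_span) (rule T_keys)

lemma N_zero: "0 \<in> N" unfolding N_eq by (rule CollectI, rule exI[of _ "\<lambda>_. 0"], rule exI[of _ "{}"]) simp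

lemma N_base: "x \<in> T \<Longrightarrow> x \<in> N"
  unfolding N_eq by (rule CollectI, rule exI[of _ "\<lambda>_. 1"], rule exI[of _ "{x}"]) simp

lemma N_smul: "x \<in> N \<Longrightarrow> smul r x \<in> N"
proof -
  assume "x \<in> N"
  then obtain a A where *: "x = (\<Sum>v\<in>A. smul (a v) v)" "finite A" "A \<subseteq> T" by (auto simp: N_eq)
  then have "smul r x = (\<Sum>v\<in>A. smul (r * a v) v)" by (simp add: smul_sum)
  with * show ?thesis unfolding N_eq
    by (intro CollectI exI[of _ "\<lambda>v. r * a v"] exI[of _ A]) auto
qed

lemma N_add: assumes "x \<in> N" "y \<in> N" shows "x + y \<in> N"
proof -
  obtain a A where 1: "x = (\<Sum>v\<in>A. smul (a v) v)" "finite A" "A \<subseteq> T" using assms by (auto simp: N_eq)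
  obtain b C where 2: "y = (\<Sum>v\<in>C. smul (b v) v)" "finite C" "C \<subseteq> T" using assms by (auto simp: N_eq)
  have "x = (\<Sum>v\<in>A \<union> C. smul (if v \<in> A then a v else 0) v)"
    unfolding 1 using 1 2 by (intro sum.mono_neutral_cong_left) auto
  moreover have "y = (\<Sum>v\<in>A \<union> C. smul (if v \<in> C then b v else 0) v)"
    unfolding 2 using 1 2 by (intro sum.mono_neutral_cong_left) auto
  ultimately have "x + y = (\<Sum>v\<in>A \<union> C. smul ((if v \<in> A then a v else 0) + (if v \<in> C then b v else 0)) v)"
    by (simp add: smul_distribs sum.distrib)
  with 1 2 show ?thesis unfolding N_eq
    by (intro CollectI exI[of _ "\<lambda>v. (if v \<in> A then a v else 0) + (if v \<in> C then b v else 0)"] exI[of _ "A \<union> C"]) auto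
qed

lemma N_diff: "x \<in> N \<Longrightarrow> y \<in> N \<Longrightarrow> x - y \<in> N"
  using N_add[of x "smul (-1) y"] N_smul[of y "-1"] by simp

lemma cls_eq_iff: "cls x = cls y \<longleftrightarrow> x - y \<in> N"
proof
  assume "cls x = cls y"
  moreover have "x \<in> cls x" using N_zero by (auto simp: cls_def intro: image_eqI[of _ _ 0])
  ultimately show "x - y \<in> N" by (auto simp: cls_def)
next
  assume xy: "x - y \<in> N"
  have "h + x \<in> cls y" if "h \<in> N" for h
    unfolding cls_def using N_add[OF that xy] by (intro image_eqI[of _ _ "h + (x - y)"]) auto
  moreover have "h + y \<in> cls x" if "h \<in> N" for h
    unfolding cls_def using N_diff[OF that xy] by (intro image_eqI[of _ _ "h - (x - y)"]) auto
  ultimately show "cls x = cls y" by (auto simp: cls_def)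
qed

lemma cls_self: "x \<in> cls x"
  using N_zero by (auto simp: cls_def intro: image_eqI[of _ _ 0])

lemma cls_zero: "cls 0 = N" by (auto simp: cls_def)

lemma r_coset_eq: "N +>\<^bsub>free_module B\<^esub> x = cls x"
  by (auto simp: a_r_coset_def r_coset_def cls_def free_module_def)

lemma Q_carrier: "carrier Q = cls ` {x. Poly_Mapping.keys x \<subseteq> B}"
  unfolding Q_def quotient_module_def
  by (auto simp: A_RCOSETS_def RCOSETS_def r_coset_def cls_def free_module_def)

lemma Q_zero: "\<zero>\<^bsub>Q\<^esub> = cls 0" by (simp add: Q_def quotient_module_def cls_zero)

lemma Q_add: "cls x \<oplus>\<^bsub>Q\<^esub> cls y = cls (x + y)"
proof -
  have "cls x \<oplus>\<^bsub>Q\<^esub> cls y = (\<Union>u\<in>N. \<Union>w\<in>N. {u + x + (w + y)})"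
    by (auto simp: Q_def quotient_module_def set_add_def set_mult_def cls_def free_module_def)
  also have "\<dots> = cls (x + y)"
  proof (intro equalityI subsetI)
    fix z assume "z \<in> (\<Union>u\<in>N. \<Union>w\<in>N. {u + x + (w + y)})"
    then obtain u w where "u \<in> N" "w \<in> N" "z = u + x + (w + y)" by auto
    then show "z \<in> cls (x + y)"
      using N_add[of u w] by (auto simp: cls_def add_ac intro!: image_eqI[of _ _ "u + w"])
  next
    fix z assume "z \<in> cls (x + y)"
    then obtain u where "u \<in> N" "z = u + x + (0 + y)" by (auto simp: cls_def add_ac)
    then show "z \<in> (\<Union>u\<in>N. \<Union>w\<in>N. {u + x + (w + y)})" using N_zero by blast
  qed
  finally show ?thesis .
qed

lemma Q_smult: "r \<odot>\<^bsub>Q\<^esub> cls x = cls (smul r x)"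
proof -
  have "cls (smul r y) = cls (smul r x)" if "y \<in> cls x" for y
  proof -
    have "y - x \<in> N" using that by (auto simp: cls_def)
    then show ?thesis unfolding cls_eq_iff using N_smul[of "y - x" r] by (simp add: smul_distribs)
  qed
  then have "(\<Union>y\<in>cls x. cls (smul r y)) = (\<Union>y\<in>cls x. cls (smul r x))" by (rule SUP_cong[OF refl])
  also have "\<dots> = cls (smul r x)" using cls_self[of x] by blast
  finally show ?thesis by (simp add: Q_def quotient_module_def r_coset_eq)
qed

lemma Q_cases:
  assumes "C \<in> carrier Q"
  obtains x where "C = cls x" "Poly_Mapping.keys x \<subseteq> B"
  using assms unfolding Q_carrier by blast

lemma cls_in_Q: "Poly_Mapping.keys x \<subseteq> B \<Longrightarrow> cls x \<in> carrier Q"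
  unfolding Q_carrier by blast

lemma abelian_group_Q: "abelian_group Q"
proof (rule abelian_groupI)
  fix C assume "C \<in> carrier Q"
  then obtain x where x: "C = cls x" "Poly_Mapping.keys x \<subseteq> B" by (rule Q_cases)
  show "\<exists>y\<in>carrier Q. y \<oplus>\<^bsub>Q\<^esub> C = \<zero>\<^bsub>Q\<^esub>"
    by (rule bexI[of _ "cls (- x)"]) (simp_all add: x Q_add Q_zero cls_in_Q)
  show "\<zero>\<^bsub>Q\<^esub> \<oplus>\<^bsub>Q\<^esub> C = C" by (simp only: x Q_add Q_zero add_0_left)
next
  fix C D assume "C \<in> carrier Q" "D \<in> carrier Q"
  then obtain x y where x: "C = cls x" "Poly_Mapping.keys x \<subseteq> B"
    and y: "D = cls y" "Poly_Mapping.keys y \<subseteq> B" by (elim Q_cases)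
  show "C \<oplus>\<^bsub>Q\<^esub> D \<in> carrier Q"
    unfolding x y Q_add by (rule cls_in_Q) (use x y keys_add[of x y] in blast)
  show "C \<oplus>\<^bsub>Q\<^esub> D = D \<oplus>\<^bsub>Q\<^esub> C" by (simp only: x y Q_add add.commute)
  fix E' assume "E' \<in> carrier Q"
  then obtain z where z: "E' = cls z" by (rule Q_cases)
  show "C \<oplus>\<^bsub>Q\<^esub> D \<oplus>\<^bsub>Q\<^esub> E' = C \<oplus>\<^bsub>Q\<^esub> (D \<oplus>\<^bsub>Q\<^esub> E')" by (simp only: x y z Q_add add.assoc)
next
  show "\<zero>\<^bsub>Q\<^esub> \<in> carrier Q" by (simp add: Q_zero cls_in_Q)
qed

lemma module_Q: "module ring_of_type_algebra Q"
proof (rule moduleI)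
  show "cring (ring_of_type_algebra :: 'r ring)" by (rule cring_from_type_algebra)
  show "abelian_group Q" by (rule abelian_group_Q)
next
  fix r s :: 'r and C assume "C \<in> carrier Q"
  then obtain x where x: "C = cls x" "Poly_Mapping.keys x \<subseteq> B" by (rule Q_cases)
  show "r \<odot>\<^bsub>Q\<^esub> C \<in> carrier Q"
    unfolding x Q_smult by (rule cls_in_Q) (use x keys_smul[of r x] in blast)
  show "(r \<oplus>\<^bsub>ring_of_type_algebra\<^esub> s) \<odot>\<^bsub>Q\<^esub> C = r \<odot>\<^bsub>Q\<^esub> C \<oplus>\<^bsub>Q\<^esub> s \<odot>\<^bsub>Q\<^esub> C"
    by (simp only: x Q_smult Q_add type_algebra_simps smul_distribs)
  show "(r \<otimes>\<^bsub>ring_of_type_algebra\<^esub> s) \<odot>\<^bsub>Q\<^esub> C = r \<odot>\<^bsub>Q\<^esub> (s \<odot>\<^bsub>Q\<^esub> C)"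
    by (simp only: x Q_smult type_algebra_simps smul_simps)
  show "\<one>\<^bsub>ring_of_type_algebra\<^esub> \<odot>\<^bsub>Q\<^esub> C = C"
    by (simp only: x Q_smult type_algebra_simps smul_simps)
  fix D assume "D \<in> carrier Q"
  then obtain y where y: "D = cls y" by (rule Q_cases)
  show "r \<odot>\<^bsub>Q\<^esub> (C \<oplus>\<^bsub>Q\<^esub> D) = r \<odot>\<^bsub>Q\<^esub> C \<oplus>\<^bsub>Q\<^esub> r \<odot>\<^bsub>Q\<^esub> D"
    by (simp only: x y Q_smult Q_add smul_distribs)
qed

text \<open>\<open>f\<close> selects representatives, so relations in the quotient are studied
  through combinations in the free module.\<close>

lemma Q_lincomb:
  assumes "finite S" "\<And>s. s \<in> S \<Longrightarrow> Poly_Mapping.keys (f s) \<subseteq> B \<and> s = cls (f s)"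
  shows "module.lincomb Q a S = cls (\<Sum>s\<in>S. smul (a s) (f s))"
proof -
  interpret module "ring_of_type_algebra :: 'r ring" Q by (rule module_Q)
  show ?thesis using assms
  proof (induction S rule: finite_induct)
    case empty
    then show ?case by (simp add: lincomb_def Q_zero)
  next
    case (insert s S)
    have "insert s S \<subseteq> carrier Q"
    proof
      fix C assume "C \<in> insert s S"
      from insert.prems[OF this] show "C \<in> carrier Q" using cls_in_Q by metis
    qed
    then have "finsum Q (\<lambda>v. a v \<odot>\<^bsub>Q\<^esub> v) (insert s S) = a s \<odot>\<^bsub>Q\<^esub> s \<oplus>\<^bsub>Q\<^esub> finsum Q (\<lambda>v. a v \<odot>\<^bsub>Q\<^esub> v) S"
      using insert.hyps by (intro M.finsum_insert) (auto intro!: smult_closed)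
    then have *: "lincomb a (insert s S) = a s \<odot>\<^bsub>Q\<^esub> s \<oplus>\<^bsub>Q\<^esub> lincomb a S" by (simp add: lincomb_def)
    have "s = cls (f s)" using insert.prems by auto
    then have "a s \<odot>\<^bsub>Q\<^esub> s = cls (smul (a s) (f s))" by (metis Q_smult)
    then show ?case using insert * by (simp add: Q_add)
  qed
qed

end

text \<open>Gaussian elimination without division: the equation at \<open>b0\<close> removes the
  unknown \<open>s0\<close>, and rows are multiplied by the pivot. In an integral domain this keeps
  a nonzero solution nonzero.\<close>

lemma homogeneous_system_nontrivial:
  fixes c :: "'s \<Rightarrow> 'b \<Rightarrow> 'r::idom"
  assumes "finite B" "finite S" "card B < card S"
  shows "\<exists>a. (\<exists>s\<in>S. a s \<noteq> 0) \<and> (\<forall>b\<in>B. (\<Sum>s\<in>S. a s * c s b) = 0)"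
  using assms
proof (induction B arbitrary: S c rule: finite_induct)
  case empty
  then have "S \<noteq> {}" by auto
  then show ?case by (intro exI[of _ "\<lambda>_. 1"]) auto
next
  case (insert b0 B)
  show ?case
  proof (cases "\<forall>s\<in>S. c s b0 = 0")
    case True
    have "card B < card S" using insert by auto
    from insert.IH[OF insert.prems(1) this, of c] show ?thesis using True by auto
  next
    case False
    then obtain s0 where s0: "s0 \<in> S" "c s0 b0 \<noteq> 0" by auto
    define S' where "S' = S - {s0}"
    have S: "S = insert s0 S'" "s0 \<notin> S'" "finite S'" using s0 insert.prems by (auto simp: S'_def)
    have "card B < card S'" using insert S by auto
    \<comment> \<open>The coefficients of the reduced system are the 2 by 2 minors that contain the
      pivot \<open>c s0 b0\<close>.\<close>
    from insert.IH[OF S(3) this, of "\<lambda>s b. c s0 b0 * c s b - c s b0 * c s0 b"]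
    obtain a where a: "\<exists>s\<in>S'. a s \<noteq> 0"
      "\<And>b. b \<in> B \<Longrightarrow> (\<Sum>s\<in>S'. a s * (c s0 b0 * c s b - c s b0 * c s0 b)) = 0" by blast
    \<comment> \<open>The solution is scaled by the pivot; its value at \<open>s0\<close> is then
      forced by the equation at \<open>b0\<close>.\<close>
    define a' where "a' s = (if s = s0 then - (\<Sum>s\<in>S'. a s * c s b0) else c s0 b0 * a s)" for s
    have *: "(\<Sum>s\<in>S. a' s * c s b) = (\<Sum>s\<in>S'. a s * (c s0 b0 * c s b - c s b0 * c s0 b))" for b
    proof -
      have "(\<Sum>s\<in>S. a' s * c s b) = a' s0 * c s0 b + (\<Sum>s\<in>S'. a' s * c s b)"
        using S by simp
      also have "(\<Sum>s\<in>S'. a' s * c s b) = (\<Sum>s\<in>S'. c s0 b0 * a s * c s b)"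
        by (rule sum.cong) (use S in \<open>auto simp: a'_def\<close>)
      finally have "(\<Sum>s\<in>S. a' s * c s b) = - (\<Sum>s\<in>S'. a s * c s b0) * c s0 b + (\<Sum>s\<in>S'. c s0 b0 * a s * c s b)"
        by (simp add: a'_def)
      then show ?thesis
        by (simp add: sum_distrib_left sum_distrib_right right_diff_distrib sum_subtractf mult_ac)
    qed
    have "(\<Sum>s\<in>S. a' s * c s b) = 0" if "b \<in> insert b0 B" for b
      unfolding * using that a by (auto simp: mult.commute)
    moreover have "\<exists>s\<in>S. a' s \<noteq> 0"
      using a(1) S s0 by (auto simp: a'_def) 
    ultimately show ?thesis by blast
  qed
qed

definition linear_ext :: "('b \<Rightarrow> 's \<Rightarrow> 'r::comm_ring_1) \<Rightarrow> ('b \<Rightarrow>\<^sub>0 'r) \<Rightarrow> 's \<Rightarrow> 'r" where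
  "linear_ext \<phi> f s = (\<Sum>b\<in>Poly_Mapping.keys f. Poly_Mapping.lookup f b * \<phi> b s)"

lemma linear_ext_eq:
  assumes "finite A" "Poly_Mapping.keys f \<subseteq> A"
  shows "linear_ext \<phi> f s = (\<Sum>b\<in>A. Poly_Mapping.lookup f b * \<phi> b s)"
  unfolding linear_ext_def using assms by (intro sum.mono_neutral_left) (auto simp: in_keys_iff)

lemma linear_ext_zero [simp]: "linear_ext \<phi> 0 s = 0" by (simp add: linear_ext_def)

lemma linear_ext_single [simp]: "linear_ext \<phi> (Poly_Mapping.single b c) s = c * \<phi> b s" by (simp add: linear_ext_def)

lemma linear_ext_add: "linear_ext \<phi> (f + g) s = linear_ext \<phi> f s + linear_ext \<phi> g s"
proof -
  let ?A = "Poly_Mapping.keys f \<union> Poly_Mapping.keys g"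
  have "linear_ext \<phi> (f + g) s = (\<Sum>b\<in>?A. Poly_Mapping.lookup (f + g) b * \<phi> b s)"
    by (rule linear_ext_eq[OF _ keys_add]) simp
  moreover have "linear_ext \<phi> f s = (\<Sum>b\<in>?A. Poly_Mapping.lookup f b * \<phi> b s)" by (rule linear_ext_eq) auto
  moreover have "linear_ext \<phi> g s = (\<Sum>b\<in>?A. Poly_Mapping.lookup g b * \<phi> b s)" by (rule linear_ext_eq) auto
  ultimately show ?thesis by (simp add: lookup_add distrib_right sum.distrib)
qed

lemma linear_ext_smul: "linear_ext \<phi> (smul r f) s = r * linear_ext \<phi> f s"
  by (subst linear_ext_eq[OF _ keys_smul]) (simp_all add: linear_ext_def sum_distrib_left mult.assoc)

lemma linear_ext_diff: "linear_ext \<phi> (f - g) s = linear_ext \<phi> f s - linear_ext \<phi> g s"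
  using linear_ext_add[of \<phi> "f - g" g s] by simp

lemma linear_ext_sum: "linear_ext \<phi> (\<Sum>i\<in>I. f i) s = (\<Sum>i\<in>I. linear_ext \<phi> (f i) s)"
  by (induction I rule: infinite_finite_induct) (simp_all add: linear_ext_add)

context free_quotient begin

text \<open>More classes than elements of \<open>G\<close> means more unknowns than equations, so
  some nontrivial combination of the representatives vanishes already in the free module.\<close>

lemma upper_bound_card_independent:
  assumes "finite G" "G \<subseteq> B"
    and spans: "\<And>f. Poly_Mapping.keys f \<subseteq> B \<Longrightarrow> \<exists>g. Poly_Mapping.keys g \<subseteq> G \<and> f - g \<in> N"
    and S: "finite S" "S \<subseteq> carrier Q" "\<not> module.lin_dep ring_of_type_algebra Q S"
  shows "card S \<le> card G"
proof (rule ccontr)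
  assume less: "\<not> card S \<le> card G"
  have "\<exists>g. Poly_Mapping.keys g \<subseteq> G \<and> s = cls g" if "s \<in> S" for s
  proof -
    have "s \<in> carrier Q" using S that by blast
    then obtain f where f: "s = cls f" "Poly_Mapping.keys f \<subseteq> B" by (rule Q_cases)
    from spans[OF f(2)] show ?thesis unfolding f(1) cls_eq_iff .
  qed
  then obtain g where g: "\<And>s. s \<in> S \<Longrightarrow> Poly_Mapping.keys (g s) \<subseteq> G" "\<And>s. s \<in> S \<Longrightarrow> s = cls (g s)"
    by metis
  have "card G < card S" using less by simp
  from homogeneous_system_nontrivial[OF \<open>finite G\<close> S(1) this, of "\<lambda>s. Poly_Mapping.lookup (g s)"]
  obtain a s0 where a: "s0 \<in> S" "a s0 \<noteq> 0"
    "\<And>b. b \<in> G \<Longrightarrow> (\<Sum>s\<in>S. a s * Poly_Mapping.lookup (g s) b) = 0" by blast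
  have "Poly_Mapping.lookup (\<Sum>s\<in>S. smul (a s) (g s)) b = 0" for b
  proof (cases "b \<in> G")
    case True
    then show ?thesis using a(3) by (simp add: lookup_sum)
  next
    case False
    then have "Poly_Mapping.lookup (g s) b = 0" if "s \<in> S" for s
      using g(1)[OF that] by (meson in_keys_iff subsetD)
    then show ?thesis by (simp add: lookup_sum)
  qed
  then have "(\<Sum>s\<in>S. smul (a s) (g s)) = 0" by (intro poly_mapping_eqI) simp
  moreover have "module.lincomb Q a S = cls (\<Sum>s\<in>S. smul (a s) (g s))"
    using g \<open>G \<subseteq> B\<close> by (intro Q_lincomb[OF S(1)]) blast
  ultimately have "module.lincomb Q a S = \<zero>\<^bsub>Q\<^esub>" by (simp only: Q_zero)
  then have "module.lin_dep ring_of_type_algebra Q S"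
    by (intro module.lin_dep_crit[OF module_Q S(1) order_refl _ a(1)]) (simp_all add: a(2))
  with S show False by simp
qed

text \<open>The rank counts sets of classes, hence injectivity is needed besides independence; two
  elements with equal classes would give the forbidden relation with coefficients 1 and -1.\<close>

lemma independent_of_no_relation:
  assumes "finite G" "G \<subseteq> B"
    and zero: "\<And>c x. (\<Sum>x\<in>G. smul (c x) (Poly_Mapping.single x 1)) \<in> N \<Longrightarrow> x \<in> G \<Longrightarrow> c x = 0"
  defines "b \<equiv> \<lambda>x. cls (Poly_Mapping.single x 1)"
  shows "inj_on b G" "\<not> module.lin_dep ring_of_type_algebra Q (b ` G)"
proof -
  show inj: "inj_on b G"
  proof (rule inj_onI, rule ccontr)
    fix x y assume xy: "x \<in> G" "y \<in> G" "b x = b y" "x \<noteq> y"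
    define c where "c z = (if z = x then (1::'r) else if z = y then -1 else 0)" for z
    have "(\<Sum>z\<in>G. smul (c z) (Poly_Mapping.single z 1)) = (\<Sum>z\<in>{x, y}. smul (c z) (Poly_Mapping.single z 1))"
      using xy \<open>finite G\<close> by (intro sum.mono_neutral_right) (auto simp: c_def)
    also have "\<dots> = Poly_Mapping.single x 1 - Poly_Mapping.single y 1"
      using xy(4) by (simp add: c_def)
    also have "\<dots> \<in> N" using xy(3) by (simp add: b_def cls_eq_iff)
    finally have "c x = 0" using zero[of c x] xy by blast
    then show False by (simp add: c_def)
  qed
  have fin: "finite (b ` G)" using assms by simp
  have sub: "b ` G \<subseteq> carrier Q"
  proof
    fix C assume "C \<in> b ` G"
    then obtain x where "x \<in> G" "C = cls (Poly_Mapping.single x 1)" by (auto simp: b_def)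
    then show "C \<in> carrier Q" using \<open>G \<subseteq> B\<close> by (auto intro!: cls_in_Q)
  qed
  show "\<not> module.lin_dep ring_of_type_algebra Q (b ` G)"
  proof (rule module.finite_lin_indpt2[OF module_Q fin sub])
    fix a assume a: "module.lincomb Q a (b ` G) = \<zero>\<^bsub>Q\<^esub>"
    define r where "r = (\<lambda>s. Poly_Mapping.single (the_inv_into G b s) (1::'r))"
    have r: "r (b x) = Poly_Mapping.single x 1" if "x \<in> G" for x
      using that inj by (simp add: r_def the_inv_into_f_f)
    have "module.lincomb Q a (b ` G) = cls (\<Sum>s\<in>b ` G. smul (a s) (r s))"
    proof (rule Q_lincomb[OF fin])
      fix s assume "s \<in> b ` G"
      then obtain x where "x \<in> G" "s = b x" by blast
      then show "Poly_Mapping.keys (r s) \<subseteq> B \<and> s = cls (r s)"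
        using r[of x] \<open>G \<subseteq> B\<close> by (auto simp: b_def)
    qed
    also have "(\<Sum>s\<in>b ` G. smul (a s) (r s)) = (\<Sum>x\<in>G. smul (a (b x)) (r (b x)))"
      using inj by (simp add: sum.reindex)
    also have "\<dots> = (\<Sum>x\<in>G. smul (a (b x)) (Poly_Mapping.single x 1))"
      by (rule sum.cong) (simp_all add: r)
    finally have "(\<Sum>x\<in>G. smul (a (b x)) (Poly_Mapping.single x 1)) - 0 \<in> N"
      unfolding a Q_zero by (simp only: cls_eq_iff[symmetric])
    then have "\<And>x. x \<in> G \<Longrightarrow> a (b x) = 0" using zero[of "\<lambda>x. a (b x)"] by simp
    then show "\<forall>v\<in>b ` G. a v = \<zero>\<^bsub>ring_of_type_algebra\<^esub>" by simp
  qed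
qed

lemma N_sum: "(\<And>i. i \<in> I \<Longrightarrow> f i \<in> N) \<Longrightarrow> (\<Sum>i\<in>I. f i) \<in> N"
  by (induction I rule: infinite_finite_induct) (simp_all add: N_zero N_add)

text \<open>Rewriting modulo \<open>N\<close> may be done one basis element at a time, because
  \<open>N\<close> is closed under linear combinations.\<close>

lemma congruent_combination:
  assumes "\<And>b. b \<in> Poly_Mapping.keys f \<Longrightarrow> \<exists>g. Poly_Mapping.keys g \<subseteq> G \<and> Poly_Mapping.single b 1 - g \<in> N"
  shows "\<exists>g. Poly_Mapping.keys g \<subseteq> G \<and> f - g \<in> N"
proof -
  obtain g where g: "\<And>b. b \<in> Poly_Mapping.keys f \<Longrightarrow> Poly_Mapping.keys (g b) \<subseteq> G"
    "\<And>b. b \<in> Poly_Mapping.keys f \<Longrightarrow> Poly_Mapping.single b 1 - g b \<in> N"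
    using assms by metis
  define h where "h = (\<Sum>b\<in>Poly_Mapping.keys f. smul (Poly_Mapping.lookup f b) (g b))"
  have "Poly_Mapping.keys h \<subseteq> (\<Union>b\<in>Poly_Mapping.keys f. Poly_Mapping.keys (smul (Poly_Mapping.lookup f b) (g b)))"
    unfolding h_def by (rule keys_sum)
  also have "\<dots> \<subseteq> G" by (rule UN_least) (rule order_trans[OF keys_smul g(1)])
  finally have "Poly_Mapping.keys h \<subseteq> G" .
  moreover have "f - h = (\<Sum>b\<in>Poly_Mapping.keys f. smul (Poly_Mapping.lookup f b) (Poly_Mapping.single b 1 - g b))"
    unfolding h_def smul_distribs sum_subtractf
    using poly_mapping_sum_smul_single[of f] by (simp only:)
  moreover have "\<dots> \<in> N" by (intro N_sum N_smul g(2))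
  ultimately show ?thesis by auto
qed

text \<open>Spanning by \<open>G\<close> bounds the rank from above. The functionals
  \<open>linear_ext \<phi>\<close> vanish on \<open>N\<close>, so they detect any relation among the
  classes of \<open>G\<close>, which bounds it from below.\<close>

lemma module_rank_quotient:
  assumes "finite G" "G \<subseteq> B"
    and spans: "\<And>b. b \<in> B \<Longrightarrow> \<exists>g. Poly_Mapping.keys g \<subseteq> G \<and> Poly_Mapping.single b 1 - g \<in> N"
    and kills: "\<And>f s. f \<in> T \<Longrightarrow> linear_ext \<phi> f s = 0"
    and indep: "\<And>c. (\<And>s. (\<Sum>b\<in>G. c b * \<phi> b s) = 0) \<Longrightarrow> \<forall>b\<in>G. c b = 0"
  shows "module_rank ring_of_type_algebra Q = enat (card G)"
proof -
  have spans': "\<exists>g. Poly_Mapping.keys g \<subseteq> G \<and> f - g \<in> N" if "Poly_Mapping.keys f \<subseteq> B" for f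
  proof (rule congruent_combination)
    fix b assume "b \<in> Poly_Mapping.keys f"
    with that have "b \<in> B" by (rule subsetD)
    then show "\<exists>g. Poly_Mapping.keys g \<subseteq> G \<and> Poly_Mapping.single b 1 - g \<in> N" by (rule spans)
  qed
  have linear_ext_N: "linear_ext \<phi> f s = 0" if "f \<in> N" for f s
  proof -
    from that obtain a A where "f = (\<Sum>v\<in>A. smul (a v) v)" "A \<subseteq> T" unfolding N_eq by blast
    then show ?thesis using kills by (auto simp: linear_ext_sum linear_ext_smul intro!: sum.neutral)
  qed
  have zero: "c x = 0" if "(\<Sum>x\<in>G. smul (c x) (Poly_Mapping.single x 1)) \<in> N" "x \<in> G" for c x
  proof -
    have "(\<Sum>x\<in>G. c x * \<phi> x s) = 0" for s
      using linear_ext_N[OF that(1), of s] by (simp only: linear_ext_sum linear_ext_smul linear_ext_single mult_1_left)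
    from indep[OF this] that(2) show ?thesis by blast
  qed
  define b where "b = (\<lambda>x. cls (Poly_Mapping.single x (1::'r)))"
  have b: "inj_on b G" "\<not> module.lin_dep ring_of_type_algebra Q (b ` G)"
    unfolding b_def by (rule independent_of_no_relation; (fact assms(1,2) | erule (1) zero))+
  have "finite (b ` G)" "card (b ` G) = card G" using assms(1) b(1) by (simp_all add: card_image)
  moreover have "b ` G \<subseteq> carrier Q"
    using assms(2) by (auto simp: b_def intro!: cls_in_Q)
  ultimately show ?thesis unfolding module_rank_def
    using upper_bound_card_independent[OF assms(1,2) spans'] b(2)
    by (intro antisym SUP_least SUP_upper2[of "b ` G"]) simp_all
qed

end

section \<open>Linear operators with q-commuting generators\<close>

text \<open>Operators instead of words modulo relations: the ring laws are inherited from
  composition, the commutation rules become computations, and coefficients are obtained by applying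
  an operator to a vector. Infinite index sets also occur as arguments of the vectors, so finiteness
  reappears in \<open>leads\<close>.\<close>

typedef (overloaded) 'r qop = "{f :: (nat set \<Rightarrow> 'r::comm_ring_1) \<Rightarrow> nat set \<Rightarrow> 'r.
    (\<forall>u v. f (\<lambda>S. u S + v S) = (\<lambda>S. f u S + f v S)) \<and> (\<forall>c u. f (\<lambda>S. c * u S) = (\<lambda>S. c * f u S))}"
  morphisms apply_op Abs_qop
  by (rule exI[of _ id]) auto

setup_lifting type_definition_qop

instantiation qop :: (comm_ring_1) ring_1
begin

lift_definition zero_qop :: "'a qop" is "\<lambda>u S. 0" by simp
lift_definition one_qop :: "'a qop" is "\<lambda>u. u" by simp
lift_definition plus_qop :: "'a qop \<Rightarrow> 'a qop \<Rightarrow> 'a qop" is "\<lambda>f g u S. f u S + g u S"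
  by (simp add: algebra_simps)
lift_definition minus_qop :: "'a qop \<Rightarrow> 'a qop \<Rightarrow> 'a qop" is "\<lambda>f g u S. f u S - g u S"
  by (simp add: algebra_simps)
lift_definition uminus_qop :: "'a qop \<Rightarrow> 'a qop" is "\<lambda>f u S. - f u S"
  by simp
lift_definition times_qop :: "'a qop \<Rightarrow> 'a qop \<Rightarrow> 'a qop" is "\<lambda>f g u. f (g u)"
  by simp

instance
proof
  show "(0::'a qop) \<noteq> 1"
  proof transfer
    show "(\<lambda>(u :: nat set \<Rightarrow> 'a) S. 0) \<noteq> (\<lambda>u. u)"
    proof
      assume "(\<lambda>(u :: nat set \<Rightarrow> 'a) S. 0) = (\<lambda>u. u)"
      then have "(\<lambda>S :: nat set. 0 :: 'a) = (\<lambda>_. 1)" by (rule fun_cong)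
      then show False by (simp add: fun_eq_iff)
    qed
  qed
qed (transfer; simp add: fun_eq_iff algebra_simps; fail)+

end

lift_definition scale :: "'r::comm_ring_1 \<Rightarrow> 'r qop \<Rightarrow> 'r qop" (infixr "\<cdot>" 75) is "\<lambda>c f u S. c * f u S"
  by (simp add: algebra_simps)

lemma scale_scale [simp]: "c \<cdot> d \<cdot> U = (c * d) \<cdot> U"
  by transfer (simp add: mult.assoc)
lemma scale_one [simp]: "1 \<cdot> U = U" by transfer simp
lemma scale_zero [simp]: "c \<cdot> 0 = 0" "0 \<cdot> U = 0" by (transfer; simp)+
lemma scale_mult [simp]: "(c \<cdot> U) * V = c \<cdot> (U * V)" "U * (c \<cdot> V) = c \<cdot> (U * V)"
  by (transfer; simp)+
lemma scale_distribs:
  "c \<cdot> (U + V) = c \<cdot> U + c \<cdot> V" "(c + d) \<cdot> U = c \<cdot> U + d \<cdot> U"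
  "c \<cdot> (U - V) = c \<cdot> U - c \<cdot> V" "(c - d) \<cdot> U = c \<cdot> U - d \<cdot> U"
  by (transfer; simp add: algebra_simps)+
lemmas scale_diff = scale_distribs(3)
lemma scale_minus [simp]: "c \<cdot> (- U) = - (c \<cdot> U)" "(- c) \<cdot> U = - (c \<cdot> U)"
  by (transfer; simp)+
lemma scale_sum: "c \<cdot> (\<Sum>i\<in>I. f i) = (\<Sum>i\<in>I. c \<cdot> f i)"
  by (induction I rule: infinite_finite_induct) (auto simp: scale_distribs)

text \<open>A creation operator of a q-deformed exterior algebra: it adds \<open>i\<close> and pays
  a factor \<open>t\<close> for each smaller element. For \<open>t = -1\<close> these are the usual
  fermionic creation operators.\<close>

lift_definition gen :: "'r::comm_ring_1 \<Rightarrow> nat \<Rightarrow> 'r qop" is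
  "\<lambda>t i u S. if i \<in> S then t ^ card {s\<in>S. s < i} * u (S - {i}) else 0"
  by (auto simp: fun_eq_iff algebra_simps)

lemma gen_square: "gen t i * gen t i = 0"
  by transfer (auto simp: fun_eq_iff)

text \<open>Removing \<open>i\<close> lowers the number of elements below \<open>j\<close> by one,
  while removing \<open>j\<close> does not change the number below \<open>i\<close>; this asymmetry
  is the factor \<open>t\<close>.\<close>

lemma gen_commute:
  assumes "i < j"
  shows "gen t j * gen t i = t \<cdot> (gen t i * gen t j)"
proof -
  have 1: "{s \<in> S. s \<noteq> j \<and> s < i} = {s \<in> S. s < i}" for S using assms by auto
  have 2: "card {s \<in> S. s < j} = Suc (card {s \<in> S - {i}. s < j})" if "i \<in> S" for S
  proof -
    have "{s \<in> S. s < j} = insert i {s \<in> S - {i}. s < j}" using that assms by auto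
    then show ?thesis by simp
  qed
  have 3: "S - {i} - {j} = S - {j} - {i}" for S by auto
  have "i \<noteq> j" using assms by simp
  show ?thesis
  proof (transfer fixing: t i j, intro ext)
    fix u S
    show "(if j \<in> S then t ^ card {s \<in> S. s < j} *
             (if i \<in> S - {j} then t ^ card {s \<in> S - {j}. s < i} * u (S - {j} - {i}) else 0) else 0)
        = t * (if i \<in> S then t ^ card {s \<in> S. s < i} *
             (if j \<in> S - {i} then t ^ card {s \<in> S - {i}. s < j} * u (S - {i} - {j}) else 0) else 0)"
      using \<open>i \<noteq> j\<close> 2[of S] by (cases "i \<in> S"; cases "j \<in> S") (simp_all add: 1 3 mult_ac)
  qed
qed

text \<open>The span is generated inductively, so that commutation rules reduce to generators by
  rule induction.\<close>

inductive_set lin :: "'r::comm_ring_1 \<Rightarrow> nat set \<Rightarrow> 'r qop set" for t I where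
  lin_zero: "0 \<in> lin t I"
| lin_gen: "i \<in> I \<Longrightarrow> gen t i \<in> lin t I"
| lin_add: "U \<in> lin t I \<Longrightarrow> V \<in> lin t I \<Longrightarrow> U + V \<in> lin t I"
| lin_scale: "U \<in> lin t I \<Longrightarrow> c \<cdot> U \<in> lin t I"

lemma lin_diff: "U \<in> lin t I \<Longrightarrow> V \<in> lin t I \<Longrightarrow> U - V \<in> lin t I"
  using lin_add[of U t I "(-1) \<cdot> V"] lin_scale[of V t I "-1"] by simp

lemma lin_sum: "(\<And>i. i \<in> J \<Longrightarrow> f i \<in> lin t I) \<Longrightarrow> (\<Sum>i\<in>J. f i) \<in> lin t I"
  by (induction J rule: infinite_finite_induct) (auto intro: lin_zero lin_add)

text \<open>A common index of \<open>I\<close> and \<open>J\<close> is allowed: both products of a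
  generator with itself are 0. This is what makes adjacent segments commute like disjoint
  ones.\<close>

lemma lin_commute:
  assumes "U \<in> lin t I" "V \<in> lin t J" "\<And>i j. i \<in> I \<Longrightarrow> j \<in> J \<Longrightarrow> i \<le> j"
  shows "V * U = t \<cdot> (U * V)"
  using assms(1)
proof (induction rule: lin.induct)
  case (lin_gen i)
  from assms(2) show ?case
  proof (induction rule: lin.induct)
    case (lin_gen j)
    then show ?case using assms(3)[of i j] \<open>i \<in> I\<close> gen_commute[of i j t] gen_square[of t i] by (cases "i = j") auto
  qed (auto simp: algebra_simps scale_distribs mult.commute)
qed (auto simp: algebra_simps scale_distribs mult.commute)

section \<open>Ordered products and telescoping over enclosing arcs\<close>

definition prodl :: "(nat \<Rightarrow> 'a::monoid_mult) \<Rightarrow> nat \<Rightarrow> nat \<Rightarrow> 'a" where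
  "prodl f d m = prod_list (map f [d..<m])"

lemma prodl_Suc: "d \<le> m \<Longrightarrow> prodl f d (Suc m) = prodl f d m * f m"
  by (simp add: prodl_def)

lemma prodl_same [simp]: "prodl f d d = 1"
  by (simp add: prodl_def)

lemma prodl_split: "d \<le> k \<Longrightarrow> k \<le> m \<Longrightarrow> prodl f d m = prodl f d k * prodl f k m"
  using upt_add_eq_append[of d k "m - k"] by (simp add: prodl_def)

lemma prodl_cong: "(\<And>p. d \<le> p \<Longrightarrow> p < m \<Longrightarrow> f p = g p) \<Longrightarrow> prodl f d m = prodl g d m"
  unfolding prodl_def by (metis (no_types, lifting) atLeastLessThan_iff map_cong set_upt)

text \<open>An abstract form of the situation to the right of d. \<open>E\<close> holds the right
  ends of enclosing arcs, \<open>W\<close> those of arcs that begin after d; the form of an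
  enclosing arc is cut at a dot into \<open>L p\<close> on the left and \<open>R p\<close> on the
  right. In \<open>LL\<close> the difference \<open>L p - L i\<close> is the stretch between the
  left ends of two nested arcs, which lies to the left of \<open>L i\<close>.\<close>

locale outer_arcs =
  fixes t t' :: "'r::comm_ring_1" and \<kappa> :: "nat \<Rightarrow> 'r" and R L Z :: "nat \<Rightarrow> 'r qop"
    and E W :: "nat set"
  assumes tt': "t * t' = 1"
    and EW: "E \<inter> W = {}"
    and RL: "i \<in> E \<Longrightarrow> p \<in> E \<Longrightarrow> i < p \<Longrightarrow> R p * L i = t \<cdot> (L i * R p)"
    and ZL: "i \<in> E \<Longrightarrow> p \<in> W \<Longrightarrow> i < p \<Longrightarrow> Z p * L i = t \<cdot> (L i * Z p)"
    and LL: "i \<in> E \<Longrightarrow> p \<in> E \<Longrightarrow> i < p \<Longrightarrow> (L p - L i) * L i = t' \<cdot> (L i * (L p - L i))"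
begin

lemma tt_cancel: "t * (t' * c) = c"
  using tt' by (simp add: mult.assoc[symmetric])

definition rest where "rest p = (if p \<in> W then Z p else 1)"
text \<open>Four versions of the factor at \<open>p\<close>. In \<open>fP\<close> the dot sits at
  the cut, in \<open>fQ\<close> no moved dot lies under the arc, \<open>fE\<close> is what remains
  after a segment has been pulled leftwards through the factor, and in \<open>fX i\<close> the dot
  sits at the left end of the arc ending in \<open>i\<close>, which has lost its own factor.\<close>

definition fP where "fP p = (if p \<in> E then \<kappa> p \<cdot> (R p + L p) else rest p)"
definition fQ where "fQ p = (if p \<in> E then \<kappa> p \<cdot> (R p + t' \<cdot> L p) else rest p)"
definition fE where "fE p = (if p \<in> E then \<kappa> p \<cdot> (t \<cdot> R p + t' \<cdot> L p) else if p \<in> W then t \<cdot> Z p else 1)"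
definition fX where "fX i p = (if p \<in> E then
    if p < i then \<kappa> p \<cdot> (R p + t' \<cdot> L p) else if p = i then 1
    else \<kappa> p \<cdot> (R p + L p - (1 - t') \<cdot> L i) else rest p)"
definition num where "num d p = card {r \<in> E \<union> W. d \<le> r \<and> r < p}"

lemma num_same [simp]: "num d d = 0"
  unfolding num_def by (rule card_eq_0_iff[THEN iffD2]) auto

lemma num_Suc: "d \<le> m \<Longrightarrow> num d (Suc m) = num d m + (if m \<in> E \<union> W then 1 else 0)"
proof -
  assume "d \<le> m"
  then have "{r \<in> E \<union> W. d \<le> r \<and> r < Suc m} = (if m \<in> E \<union> W then insert m {r \<in> E \<union> W. d \<le> r \<and> r < m}
      else {r \<in> E \<union> W. d \<le> r \<and> r < m})"
    by (auto simp: less_Suc_eq)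
  then show ?thesis unfolding num_def by auto
qed

lemma fX_diag: "prodl (fX m) d m = prodl fQ d m"
  by (rule prodl_cong) (simp add: fX_def fQ_def)

text \<open>\<open>LL\<close> gives the rule for \<open>L m * L i\<close>; its correction term, a
  multiple of \<open>L i * L i\<close>, is what distinguishes \<open>fX i m\<close> from
  \<open>fP m\<close>.\<close>

lemma E_step: "m \<in> E \<Longrightarrow> i \<in> E \<Longrightarrow> i < m \<Longrightarrow> L i * fE m = fX i m * L i"
proof -
  assume *: "m \<in> E" "i \<in> E" "i < m"
  have "L m * L i = t' \<cdot> (L i * L m) + L i * L i - t' \<cdot> (L i * L i)"
    using LL[OF *(2,1,3)] by (simp add: algebra_simps scale_distribs)
  then have "L i * (t \<cdot> R m + t' \<cdot> L m) = (R m + L m - (1 - t') \<cdot> L i) * L i"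
    using * by (simp add: algebra_simps scale_distribs RL)
  with * show ?thesis by (simp add: fE_def fX_def)
qed

text \<open>An enclosing factor \<open>fE m\<close> is \<open>t \<cdot> fQ m\<close> minus a
  multiple of \<open>L m\<close>. The second part ends the run of factors \<open>fQ\<close> at
  \<open>m\<close>, and \<open>L m\<close> then travels to the far right, turning each later factor
  into one of \<open>fX m\<close>.\<close>

lemma expand_E:
  assumes "d \<le> m"
  shows "P * prodl fE d m = t ^ num d m \<cdot> (P * prodl fQ d m)
    - (\<Sum>i\<in>E \<inter> {d..<m}. ((1 - t') * \<kappa> i * t ^ num d i) \<cdot> (P * prodl (fX i) d m * L i))"
  using assms
proof (induction m rule: dec_induct)
  case (step m)
  let ?c = "\<lambda>i. (1 - t') * \<kappa> i * t ^ num d i"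
  have S: "(\<Sum>i\<in>E \<inter> {d..<m}. ?c i \<cdot> (P * prodl (fX i) d m * L i)) * fE m
      = (\<Sum>i\<in>E \<inter> {d..<m}. ?c i \<cdot> (P * prodl (fX i) d (Suc m) * L i))"
    unfolding sum_distrib_right
  proof (rule sum.cong)
    fix i assume i: "i \<in> E \<inter> {d..<m}"
    have "L i * fE m = fX i m * L i"
    proof (cases "m \<in> E")
      case True
      then show ?thesis using i E_step by auto
    next
      case False
      then show ?thesis using i ZL[of i m] by (auto simp: fE_def fX_def rest_def)
    qed
    then show "?c i \<cdot> (P * prodl (fX i) d m * L i) * fE m = ?c i \<cdot> (P * prodl (fX i) d (Suc m) * L i)"
      using step.hyps by (simp add: prodl_Suc mult.assoc)
  qed simp
  have split: "(\<Sum>i\<in>E \<inter> {d..<Suc m}. f i) = (\<Sum>i\<in>E \<inter> {d..<m}. f i) + (if m \<in> E then f m else 0)"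
    for f :: "nat \<Rightarrow> 'r qop"
  proof -
    have "E \<inter> {d..<Suc m} = (if m \<in> E then insert m (E \<inter> {d..<m}) else E \<inter> {d..<m})"
      using step.hyps by (auto simp: less_Suc_eq)
    then show ?thesis by (simp add: add.commute)
  qed
  have Q: "t ^ num d m \<cdot> (P * prodl fQ d m) * fE m = t ^ num d (Suc m) \<cdot> (P * prodl fQ d (Suc m))
      - (if m \<in> E then ?c m \<cdot> (P * prodl (fX m) d (Suc m) * L m) else 0)"
  proof (cases "m \<in> E")
    case True
    have "fE m = t \<cdot> fQ m - ((1 - t') * \<kappa> m) \<cdot> L m"
      using True by (simp add: tt_cancel fE_def fQ_def scale_distribs algebra_simps)
    moreover have "fX m m = 1" using True by (simp add: fX_def)
    ultimately have "t ^ num d m \<cdot> (P * prodl fQ d m) * fE m = t ^ num d m \<cdot> (P * prodl fQ d m) * (t \<cdot> fQ m)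
        - t ^ num d m \<cdot> (P * prodl fQ d m) * (((1 - t') * \<kappa> m) \<cdot> L m)" by (simp only: right_diff_distrib)
    also have "t ^ num d m \<cdot> (P * prodl fQ d m) * (t \<cdot> fQ m) = t ^ num d (Suc m) \<cdot> (P * prodl fQ d (Suc m))"
      using True step.hyps by (simp add: num_Suc prodl_Suc mult.assoc mult.commute[of t])
    also have "t ^ num d m \<cdot> (P * prodl fQ d m) * (((1 - t') * \<kappa> m) \<cdot> L m) = ?c m \<cdot> (P * prodl (fX m) d (Suc m) * L m)"
      using True step.hyps \<open>fX m m = 1\<close> by (simp add: prodl_Suc fX_diag mult.assoc mult.commute[of "t ^ num d m"])
    finally show ?thesis using True by simp
  next
    case False
    then show ?thesis using step.hyps
      by (simp add: num_Suc prodl_Suc fE_def fQ_def rest_def mult.assoc mult.commute[of t])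
  qed
  have "P * prodl fE d (Suc m) = (P * prodl fE d m) * fE m"
    using step.hyps by (simp add: prodl_Suc mult.assoc)
  also have "\<dots> = t ^ num d m \<cdot> (P * prodl fQ d m) * fE m
      - (\<Sum>i\<in>E \<inter> {d..<m}. ?c i \<cdot> (P * prodl (fX i) d m * L i)) * fE m"
    unfolding step.IH by (rule left_diff_distrib)
  finally show ?case unfolding S Q split by (simp only: diff_diff_eq add.commute)
qed simp

text \<open>\<open>D\<close> gains one term at each enclosing right end. Writing
  \<open>fX i m\<close> as \<open>fP m\<close> minus a multiple of \<open>L i\<close> produces
  exactly the correction terms of \<open>expand_E\<close>, so they cancel and a sum without any
  trailing \<open>L i\<close> remains.\<close>

lemma expand_difference:
  assumes "d \<le> m" "D d = 0"
    and D: "\<And>p. d \<le> p \<Longrightarrow> D (Suc p) = D p * fP p + (if p \<in> E then ((t - 1) * \<kappa> p) \<cdot> (P * prodl fE d p) else 0)"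
  shows "D m = (\<Sum>i\<in>E \<inter> {d..<m}. ((t - 1) * \<kappa> i * t ^ num d i) \<cdot> (P * prodl (fX i) d m))"
  using assms(1)
proof (induction m rule: dec_induct)
  case base
  then show ?case using assms(2) by simp
next
  case (step m)
  let ?c = "\<lambda>i. (t - 1) * \<kappa> i * t ^ num d i"
  show ?case
  proof (cases "m \<in> E")
    case False
    then have "E \<inter> {d..<Suc m} = E \<inter> {d..<m}" by (auto simp: less_Suc_eq)
    moreover have "D (Suc m) = (\<Sum>i\<in>E \<inter> {d..<m}. ?c i \<cdot> (P * prodl (fX i) d m)) * fP m"
      using D[OF step.hyps(1)] False by (simp add: step.IH)
    moreover have "fX i m = fP m" for i using False by (simp add: fX_def fP_def)
    ultimately show ?thesis using step.hyps(1)
      by (simp add: sum_distrib_right prodl_Suc mult.assoc)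
  next
    case True
    then have "E \<inter> {d..<Suc m} = insert m (E \<inter> {d..<m})" using step.hyps by (auto simp: less_Suc_eq)
    then have "(\<Sum>i\<in>E \<inter> {d..<Suc m}. ?c i \<cdot> (P * prodl (fX i) d (Suc m)))
        = ?c m \<cdot> (P * prodl fQ d m) + (\<Sum>i\<in>E \<inter> {d..<m}. ?c i \<cdot> (P * prodl (fX i) d (Suc m)))"
      using True step.hyps by (simp add: prodl_Suc fX_diag) (simp add: fX_def)
    also have "(\<Sum>i\<in>E \<inter> {d..<m}. ?c i \<cdot> (P * prodl (fX i) d (Suc m)))
        = (\<Sum>i\<in>E \<inter> {d..<m}. ?c i \<cdot> (P * prodl (fX i) d m)) * fP m
        - ((t - 1) * \<kappa> m) \<cdot> (\<Sum>i\<in>E \<inter> {d..<m}. ((1 - t') * \<kappa> i * t ^ num d i) \<cdot> (P * prodl (fX i) d m * L i))"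
      unfolding sum_distrib_right scale_sum sum_subtractf[symmetric]
    proof (rule sum.cong)
      fix i assume i: "i \<in> E \<inter> {d..<m}"
      have "fX i m = fP m - (\<kappa> m * (1 - t')) \<cdot> L i"
        using True i by (simp add: fX_def fP_def scale_distribs algebra_simps)
      then have "P * prodl (fX i) d (Suc m) = P * prodl (fX i) d m * fP m - (\<kappa> m * (1 - t')) \<cdot> (P * prodl (fX i) d m * L i)"
        using step.hyps(1) by (simp add: prodl_Suc right_diff_distrib mult.assoc)
      moreover have "?c i * (\<kappa> m * (1 - t')) = ((t - 1) * \<kappa> m) * ((1 - t') * \<kappa> i * t ^ num d i)"
        by (simp only: mult_ac)
      ultimately show "?c i \<cdot> (P * prodl (fX i) d (Suc m)) = ?c i \<cdot> (P * prodl (fX i) d m) * fP m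
          - ((t - 1) * \<kappa> m) \<cdot> ((1 - t') * \<kappa> i * t ^ num d i) \<cdot> (P * prodl (fX i) d m * L i)"
        by (simp only: scale_diff scale_scale scale_mult)
    qed simp
    finally have sum: "(\<Sum>i\<in>E \<inter> {d..<Suc m}. ?c i \<cdot> (P * prodl (fX i) d (Suc m)))
        = ?c m \<cdot> (P * prodl fQ d m) + (D m * fP m
        - ((t - 1) * \<kappa> m) \<cdot> (\<Sum>i\<in>E \<inter> {d..<m}. ((1 - t') * \<kappa> i * t ^ num d i) \<cdot> (P * prodl (fX i) d m * L i)))"
      unfolding step.IH[symmetric] .
    have "D (Suc m) = D m * fP m + ((t - 1) * \<kappa> m) \<cdot> (P * prodl fE d m)"
      using D[OF step.hyps(1)] True by (simp only: if_True)
    then show ?thesis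
      unfolding sum expand_E[OF step.hyps(1), of P] scale_diff scale_scale by simp
  qed
qed

lemma prodl_intertwine:
  assumes "\<And>p. f p * U = U * g p"
  shows "prodl f d m * U = U * prodl g d m"
proof (cases "d \<le> m")
  case True
  then show ?thesis
  proof (induction m rule: dec_induct)
    case (step m)
    then show ?case by (simp add: prodl_Suc mult.assoc assms) (simp add: mult.assoc[symmetric])
  qed simp
qed (simp add: prodl_def)

text \<open>\<open>y\<close> is the stretch over which the dot moves, and moving the dot scales it
  by \<open>t\<close>. So \<open>f1 p - fP p\<close> is a multiple of \<open>y\<close> by
  \<open>t - 1\<close>; pulling this \<open>y\<close> to the front turns the preceding factors
  \<open>f1\<close> into \<open>fE\<close>.\<close>

lemma typeII_difference:
  fixes y :: "'r qop" and \<rho> :: "nat \<Rightarrow> 'r qop"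
  assumes R: "\<And>p. R p = \<rho> p + y"
    and y: "\<And>p. p \<in> E \<Longrightarrow> \<rho> p * y = t \<cdot> (y * \<rho> p)" "\<And>p. p \<in> E \<Longrightarrow> L p * y = t' \<cdot> (y * L p)"
      "\<And>p. p \<in> W \<Longrightarrow> Z p * y = t \<cdot> (y * Z p)"
    and f1: "\<And>p. f1 p = (if p \<in> E then \<kappa> p \<cdot> (\<rho> p + t \<cdot> y + L p) else rest p)"
    and "d \<le> m"
  shows "prodl f1 d m - prodl fP d m
    = (\<Sum>i\<in>E \<inter> {d..<m}. ((t - 1) * \<kappa> i * t ^ num d i) \<cdot> (y * prodl (fX i) d m))"
proof (rule expand_difference[OF \<open>d \<le> m\<close>])
  fix p assume p: "d \<le> p"
  have "f1 p * y = y * fE p" for p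
    using EW by (auto simp: f1 fE_def R rest_def y algebra_simps scale_distribs)
  then have *: "prodl f1 d p * y = y * prodl fE d p" by (rule prodl_intertwine)
  show "prodl f1 d (Suc p) - prodl fP d (Suc p) = (prodl f1 d p - prodl fP d p) * fP p
      + (if p \<in> E then ((t - 1) * \<kappa> p) \<cdot> (y * prodl fE d p) else 0)"
    unfolding *[symmetric] using p
    by (simp add: prodl_Suc f1 fP_def R algebra_simps scale_distribs)
qed simp

text \<open>\<open>u\<close>, \<open>y\<close>, \<open>z\<close> are the stretches from a to b, b to
  c and c to d; \<open>fP\<close>, \<open>f1\<close>, \<open>f3\<close> belong to a dot at a, b, c.
  The left-hand side is 0 at \<open>d\<close>, and it grows only through the terms by which
  \<open>f1\<close> and \<open>f3\<close> differ from \<open>fP\<close>.\<close>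

lemma typeI_difference:
  fixes u y z :: "'r qop" and \<rho> :: "nat \<Rightarrow> 'r qop"
  assumes R: "\<And>p. R p = \<rho> p + u + y + z"
    and uyz: "z * u = t \<cdot> (u * z)" "z * y = t \<cdot> (y * z)" "y * u = t \<cdot> (u * y)"
    and u: "\<And>p. p \<in> E \<Longrightarrow> \<rho> p * u = t \<cdot> (u * \<rho> p)" "\<And>p. p \<in> E \<Longrightarrow> L p * u = t' \<cdot> (u * L p)"
      "\<And>p. p \<in> W \<Longrightarrow> Z p * u = t \<cdot> (u * Z p)"
    and y: "\<And>p. p \<in> E \<Longrightarrow> \<rho> p * y = t \<cdot> (y * \<rho> p)" "\<And>p. p \<in> E \<Longrightarrow> L p * y = t' \<cdot> (y * L p)"
      "\<And>p. p \<in> W \<Longrightarrow> Z p * y = t \<cdot> (y * Z p)"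
    and f1: "\<And>p. f1 p = (if p \<in> E then \<kappa> p \<cdot> (\<rho> p + t \<cdot> u + y + z + L p) else rest p)"
    and f3: "\<And>p. f3 p = (if p \<in> E then \<kappa> p \<cdot> (\<rho> p + t \<cdot> u + t \<cdot> y + z + L p) else rest p)"
    and "d \<le> m"
  shows "(t \<cdot> u + y + z) * prodl f1 d m - z * prodl fP d m - t \<cdot> u * prodl f3 d m - y * prodl fP d m
    = (\<Sum>i\<in>E \<inter> {d..<m}. ((t - 1) * \<kappa> i * t ^ num d i) \<cdot> (t \<cdot> (u * z) * prodl (fX i) d m))"
proof (rule expand_difference[OF \<open>d \<le> m\<close>])
  fix p assume p: "d \<le> p"
  have "f1 p * u = u * fE p" for p
    using EW by (auto simp: f1 fE_def R rest_def u uyz algebra_simps scale_distribs)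
  then have 1: "prodl f1 d p * u = u * prodl fE d p" by (rule prodl_intertwine)
  have "f3 p * (u + y) = (u + y) * fE p" for p
    using EW by (auto simp: f3 fE_def R rest_def u y uyz algebra_simps scale_distribs)
  then have 3: "prodl f3 d p * (u + y) = (u + y) * prodl fE d p" by (rule prodl_intertwine)
  \<comment> \<open>The squares and, by commutation, the products of \<open>u\<close> and
    \<open>y\<close> cancel; what survives is the product belonging to the two arcs ab and
    cd.\<close>
  have "t \<cdot> (u * z) = (t \<cdot> u + y + z) * u - t \<cdot> u * (u + y)"
    by (simp add: uyz algebra_simps scale_distribs)
  then have E: "t \<cdot> (u * z) * prodl fE d p = (t \<cdot> u + y + z) * prodl f1 d p * u - t \<cdot> u * prodl f3 d p * (u + y)"
    by (simp only: left_diff_distrib mult.assoc 1 3)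
  define w where "w = (t - 1) * \<kappa> p"
  have f1P: "f1 p = fP p + (if p \<in> E then w \<cdot> u else 0)"
    by (simp add: w_def f1 fP_def R algebra_simps scale_distribs)
  have f3P: "f3 p = fP p + (if p \<in> E then w \<cdot> (u + y) else 0)"
    by (simp add: w_def f3 fP_def R algebra_simps scale_distribs)
  show "(t \<cdot> u + y + z) * prodl f1 d (Suc p) - z * prodl fP d (Suc p) - t \<cdot> u * prodl f3 d (Suc p) - y * prodl fP d (Suc p)
      = ((t \<cdot> u + y + z) * prodl f1 d p - z * prodl fP d p - t \<cdot> u * prodl f3 d p - y * prodl fP d p) * fP p
      + (if p \<in> E then ((t - 1) * \<kappa> p) \<cdot> (t \<cdot> (u * z) * prodl fE d p) else 0)"
    unfolding E w_def[symmetric] using p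
    by (simp add: prodl_Suc f1P f3P distrib_left left_diff_distrib scale_diff scale_distribs(1) mult.assoc mult.commute[of w])
qed (simp add: algebra_simps)

end

section \<open>The product attached to a diagram\<close>

lemma q_pow_0 [simp]: "q_pow 0 = 1" by (simp add: q_pow_def)
lemma q_pow_add: "q_pow (a + b) = q_pow a * q_pow b"
  by (simp add: q_pow_def mult_single)
lemma q_pow_mult: "q_pow a * q_pow b = q_pow (a + b)" "q_pow a * (q_pow b * c) = q_pow (a + b) * c"
  by (simp_all add: q_pow_add mult.assoc)
lemma q_pow_power: "q_pow a ^ k = q_pow (int k * a)"
  by (induction k) (simp_all add: q_pow_mult algebra_simps)

text \<open>The height of a lattice path that steps down at the points of \<open>K\<close> and up at
  all others; it governs the normalising powers of q.\<close>

definition potential :: "nat set \<Rightarrow> nat \<Rightarrow> int" where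
  "potential K p = int p - 2 * int (card (K \<inter> {..p}))"

definition xi :: "nat set \<Rightarrow> nat \<Rightarrow> laurent qop" where
  "xi K p = q_pow (potential K p) \<cdot> gen (q_pow 2) p"

text \<open>The linear form of an arc up to the scalar \<open>kap\<close>. The two ends have
  opposite signs so that cuts telescope, and the weight of the dots is the one for which
  \<open>seg_insert\<close> holds.\<close>

definition seg :: "nat set \<Rightarrow> nat \<Rightarrow> nat \<Rightarrow> laurent qop" where
  "seg K l p = q_pow (-1) \<cdot> (xi K p - xi K l) + (q_pow 1 - q_pow (-1)) \<cdot> (\<Sum>y\<in>K \<inter> {l<..<p}. xi K y)"

text \<open>Chosen so that \<open>gen (q_pow 2) p\<close> has coefficient 1 in the factor of an arc
  ending at \<open>p\<close>.\<close>

definition kap :: "nat set \<Rightarrow> nat \<Rightarrow> laurent" where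
  "kap K p = q_pow (1 - potential K p)"

definition fac :: "nat set \<Rightarrow> (nat \<times> nat) set \<Rightarrow> nat \<Rightarrow> laurent qop" where
  "fac K U p = (if \<exists>l. (l, p) \<in> U then kap K p \<cdot> seg K (THE l. (l, p) \<in> U) p else 1)"

lemma potential_insert:
  "s \<notin> K \<Longrightarrow> potential (insert s K) p = potential K p - (if s \<le> p then 2 else 0)"
  by (simp add: potential_def Int_insert_left)

lemma kap_insert: "s \<notin> K \<Longrightarrow> kap (insert s K) p = (if s \<le> p then q_pow 2 else 1) * kap K p"
  by (simp add: kap_def potential_insert q_pow_mult algebra_simps)

lemma xi_insert:
  "s \<notin> K \<Longrightarrow> xi (insert s K) p = (if s \<le> p then q_pow (-2) \<cdot> xi K p else xi K p)"
  by (simp add: xi_def potential_insert q_pow_mult algebra_simps)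

text \<open>The end terms at \<open>m\<close> cancel, and as \<open>m\<close> lies outside
  \<open>K\<close> the cut removes no summand of the inner sum.\<close>

lemma seg_add:
  assumes "l < m" "m < p" "m \<notin> K"
  shows "seg K l p = seg K l m + seg K m p"
proof -
  have "K \<inter> {l<..<p} = K \<inter> {l<..<m} \<union> K \<inter> {m<..<p}" using assms by (auto simp: not_less) (metis le_neq_implies_less)
  then have "(\<Sum>y\<in>K \<inter> {l<..<p}. xi K y) = (\<Sum>y\<in>K \<inter> {l<..<m}. xi K y) + (\<Sum>y\<in>K \<inter> {m<..<p}. xi K y)"
    by (simp only:) (rule sum.union_disjoint, auto)
  then show ?thesis by (simp add: seg_def scale_distribs algebra_simps)
qed

text \<open>The correction terms at \<open>s\<close> cancel because \<open>q^(-1) * q^(-2) + (q - q^(-1)) * q^(-2) = q^(-1)\<close>.\<close>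
lemma seg_insert:
  assumes "s \<notin> K" "l < p" "s \<noteq> l" "s \<noteq> p"
  shows "seg (insert s K) l p = (if s < l then q_pow (-2) \<cdot> seg K l p
    else if s < p then seg K l s + q_pow (-2) \<cdot> seg K s p else seg K l p)"
proof -
  consider "s < l" | "l < s" "s < p" | "p < s" using assms by linarith
  then show ?thesis
  proof cases
    case 1
    then have "insert s K \<inter> {l<..<p} = K \<inter> {l<..<p}" by auto
    moreover have "(\<Sum>y\<in>K \<inter> {l<..<p}. xi (insert s K) y) = q_pow (-2) \<cdot> (\<Sum>y\<in>K \<inter> {l<..<p}. xi K y)"
      unfolding scale_sum using 1 assms(1) by (intro sum.cong) (auto simp: xi_insert)
    ultimately show ?thesis using 1 assms
      by (simp add: seg_def xi_insert scale_distribs algebra_simps)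
  next
    case 2
    let ?S = "\<lambda>l p. \<Sum>y\<in>K \<inter> {l<..<p}. xi K y"
    have "insert s K \<inter> {l<..<p} = insert s (K \<inter> {l<..<s} \<union> K \<inter> {s<..<p})"
      using 2 by auto
    then have "(\<Sum>y\<in>insert s K \<inter> {l<..<p}. xi (insert s K) y)
        = xi (insert s K) s + (\<Sum>y\<in>K \<inter> {l<..<s} \<union> K \<inter> {s<..<p}. xi (insert s K) y)"
      using assms(1) by simp
    also have "(\<Sum>y\<in>K \<inter> {l<..<s} \<union> K \<inter> {s<..<p}. xi (insert s K) y)
        = (\<Sum>y\<in>K \<inter> {l<..<s}. xi (insert s K) y) + (\<Sum>y\<in>K \<inter> {s<..<p}. xi (insert s K) y)"
      by (rule sum.union_disjoint) auto
    also have "(\<Sum>y\<in>K \<inter> {l<..<s}. xi (insert s K) y) = ?S l s"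
      using assms(1) by (intro sum.cong) (auto simp: xi_insert)
    also have "(\<Sum>y\<in>K \<inter> {s<..<p}. xi (insert s K) y) = q_pow (-2) \<cdot> ?S s p"
      unfolding scale_sum using assms(1) by (intro sum.cong) (auto simp: xi_insert)
    finally have S: "(\<Sum>y\<in>insert s K \<inter> {l<..<p}. xi (insert s K) y)
        = q_pow (-2) \<cdot> xi K s + ?S l s + q_pow (-2) \<cdot> ?S s p"
      using assms(1) by (simp add: xi_insert algebra_simps)
    show ?thesis using 2 assms(1) unfolding seg_def S
      by (simp add: xi_insert scale_distribs left_diff_distrib q_pow_mult algebra_simps)
  next
    case 3
    then have "insert s K \<inter> {l<..<p} = K \<inter> {l<..<p}" by auto
    moreover have "(\<Sum>y\<in>K \<inter> {l<..<p}. xi (insert s K) y) = (\<Sum>y\<in>K \<inter> {l<..<p}. xi K y)"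
      using 3 assms(1) by (intro sum.cong) (auto simp: xi_insert)
    ultimately show ?thesis using 3 assms by (simp add: seg_def xi_insert)
  qed
qed

lemma seg_lin: "l < p \<Longrightarrow> l \<in> I \<Longrightarrow> p \<in> I \<Longrightarrow> {l<..<p} \<subseteq> I \<Longrightarrow> seg K l p \<in> lin (q_pow 2) I"
  unfolding seg_def xi_def by (intro lin_add lin_diff lin_scale lin_sum lin_gen) auto

text \<open>The case \<open>m = m'\<close> is the one that arises when a single arc is cut.\<close>

lemma seg_commute:
  assumes "l < m" "m \<le> m'" "m' < p"
  shows "seg K m' p * seg K l m = q_pow 2 \<cdot> (seg K l m * seg K m' p)"
  by (rule lin_commute[of _ _ "{l..m}" _ "{m'..p}"]) (use assms in \<open>auto intro!: seg_lin\<close>)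

definition unique_right :: "(nat \<times> nat) set \<Rightarrow> bool" where
  "unique_right U \<longleftrightarrow> (\<forall>l l' p. (l, p) \<in> U \<longrightarrow> (l', p) \<in> U \<longrightarrow> l = l')"

lemma unique_right_the: "unique_right U \<Longrightarrow> (l, p) \<in> U \<Longrightarrow> (THE l. (l, p) \<in> U) = l"
  by (rule the_equality) (auto simp: unique_right_def)

lemma unique_right_Diff: "unique_right U \<Longrightarrow> unique_right (U - A)"
  unfolding unique_right_def by blast

lemma unique_right_insert:
  "unique_right U \<Longrightarrow> (\<And>l. (l, p) \<notin> U) \<Longrightarrow> unique_right (insert (l', p) U)"
  unfolding unique_right_def by blast

lemma fac_none: "(\<And>l. (l, p) \<notin> U) \<Longrightarrow> fac K U p = 1"
  by (simp add: fac_def)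

lemma fac_arc: "unique_right U \<Longrightarrow> (l, p) \<in> U \<Longrightarrow> fac K U p = kap K p \<cdot> seg K l p"
  unfolding fac_def by (subst unique_right_the[of U l]) auto

text \<open>To the right of a new dot \<open>seg\<close> loses q^2 and \<open>kap\<close> gains it.
  Hence only an arc over the dot notices it, and there the part to the left of the dot is the one
  that is scaled.\<close>

lemma fac_insert:
  assumes "unique_right U" "(l, p) \<in> U" "l < p" "s \<notin> K" "s \<noteq> l" "s \<noteq> p"
  shows "fac (insert s K) U p = (if l < s \<and> s < p then kap K p \<cdot> (q_pow 2 \<cdot> seg K l s + seg K s p)
    else kap K p \<cdot> seg K l p)"
  using assms
  by (auto simp: fac_arc seg_insert kap_insert scale_distribs q_pow_mult mult.commute[of _ "kap K p"] mult.assoc)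

section \<open>Moving forms through products, and both relations as operator identities\<close>

lemma lin_prodl_move:
  assumes "U \<in> lin (q_pow 2) {..s}" "s < k"
    and "\<And>p. s < p \<Longrightarrow> p < k \<Longrightarrow> p \<in> A \<Longrightarrow> f p \<in> lin (q_pow 2) {s..}"
    and "\<And>p. s < p \<Longrightarrow> p < k \<Longrightarrow> p \<notin> A \<Longrightarrow> f p = 1"
  shows "U * prodl f (Suc s) k = q_pow (- 2 * int (card (A \<inter> {s<..<k}))) \<cdot> (prodl f (Suc s) k * U)"
  using Suc_leI[OF assms(2)] assms(3,4)
proof (induction k rule: dec_induct)
  case base
  have "A \<inter> {s<..<Suc s} = {}" by auto
  then show ?case by simp
next
  case (step k)
  let ?e = "\<lambda>k. - 2 * int (card (A \<inter> {s<..<k}))"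
  have IH: "U * prodl f (Suc s) k = q_pow (?e k) \<cdot> (prodl f (Suc s) k * U)"
    using step.IH step.prems by simp
  have "s < k" using step.hyps by simp
  have *: "q_pow (?e k) \<cdot> (U * f k) = q_pow (?e (Suc k)) \<cdot> (f k * U)"
  proof (cases "k \<in> A")
    case True
    have "A \<inter> {s<..<Suc k} = insert k (A \<inter> {s<..<k})" using True \<open>s < k\<close> by auto
    then have "card (A \<inter> {s<..<Suc k}) = Suc (card (A \<inter> {s<..<k}))" by simp
    moreover have "f k * U = q_pow 2 \<cdot> (U * f k)"
      using assms(1) step.prems(1)[of k] True \<open>s < k\<close> by (intro lin_commute) auto
    ultimately show ?thesis by (simp add: q_pow_mult)
  next
    case False
    have "A \<inter> {s<..<Suc k} = A \<inter> {s<..<k}" using False \<open>s < k\<close> by (auto simp: less_Suc_eq)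
    then show ?thesis using step.prems(2)[of k] False \<open>s < k\<close> by simp
  qed
  have "U * prodl f (Suc s) (Suc k) = prodl f (Suc s) k * (q_pow (?e k) \<cdot> (U * f k))"
    using step.hyps by (simp add: prodl_Suc mult.assoc[symmetric] IH)
  then show ?case using step.hyps unfolding * by (simp add: prodl_Suc mult.assoc)
qed

text \<open>\<open>K\<close> and \<open>U\<close> describe what the diagrams of one relation share:
  left ends of dotted arcs and undotted arcs. No arc leaves the gaps between b and c or between c
  and d, and \<open>count_bc\<close> and \<open>count_cd\<close> record this numerically: in a gap
  the two ends of a dotted arc cancel in the height, an undotted arc raises it by 2, and the final 1
  is the step to the closing point.\<close>

locale arc_system =
  fixes K :: "nat set" and U :: "(nat \<times> nat) set" and a b c d m :: nat
  assumes order: "1 \<le> a" "a < b" "b < c" "c < d" "d < m"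
    and K: "b \<notin> K" "c \<notin> K" "d \<notin> K"
    and arcs: "(l, p) \<in> U \<Longrightarrow> l < p" "(l, p) \<in> U \<Longrightarrow> l \<notin> K" "(l, p) \<in> U \<Longrightarrow> p \<notin> K"
      "(l, p) \<in> U \<Longrightarrow> l \<notin> {a, b, c, d}" "(l, p) \<in> U \<Longrightarrow> p \<notin> {a, b, c, d}"
    and disjoint: "(l, p) \<in> U \<Longrightarrow> (l', p') \<in> U \<Longrightarrow> l \<noteq> p'"
      "(l, p) \<in> U \<Longrightarrow> (l, p') \<in> U \<Longrightarrow> p = p'" "(l, p) \<in> U \<Longrightarrow> (l', p) \<in> U \<Longrightarrow> l = l'"
    and noncrossing: "(l, p) \<in> U \<Longrightarrow> (l', p') \<in> U \<Longrightarrow> l < l' \<Longrightarrow> l' < p \<Longrightarrow> p' < p"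
    and regions: "(l, p) \<in> U \<Longrightarrow> p < a \<or> a < l \<and> p < b \<or> b < l \<and> p < c \<or> c < l \<and> p < d \<or> d < l \<or> l < a \<and> d < p"
    and count_bc: "potential K c - potential K b = 2 * int (card (snd ` U \<inter> {b<..<c})) + 1"
    and count_cd: "potential K d - potential K c = 2 * int (card (snd ` U \<inter> {c<..<d})) + 1"
begin

text \<open>Enclosing arcs, like the arcs beyond d, are indexed by right ends because the product
  runs over right ends.\<close>

definition enc where "enc = {p. \<exists>l. (l, p) \<in> U \<and> l < a \<and> d < p}"
definition dis where "dis = {p. \<exists>l. (l, p) \<in> U \<and> d < l}"
definition lf where "lf p = (THE l. (l, p) \<in> U)"

lemma unique: "unique_right U"
  unfolding unique_right_def using disjoint(3) by blast

lemma lf: "(l, p) \<in> U \<Longrightarrow> lf p = l"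
  unfolding lf_def by (rule unique_right_the[OF unique])

lemma enc_lf: assumes "p \<in> enc" shows "(lf p, p) \<in> U" "lf p < a" "d < p" "lf p \<notin> K"
proof -
  from assms obtain l where l: "(l, p) \<in> U" "l < a" "d < p" unfolding enc_def by blast
  with lf[OF l(1)] arcs(2)[OF l(1)] show "(lf p, p) \<in> U" "lf p < a" "d < p" "lf p \<notin> K" by simp_all
qed

lemma dis_lf: assumes "p \<in> dis" shows "(lf p, p) \<in> U" "d < lf p" "lf p < p"
proof -
  from assms obtain l where l: "(l, p) \<in> U" "d < l" unfolding dis_def by blast
  with lf[OF l(1)] arcs(1)[OF l(1)] show "(lf p, p) \<in> U" "d < lf p" "lf p < p" by simp_all
qed

lemma enc_dis: "enc \<inter> dis = {}"
proof -
  have False if "p \<in> enc" "p \<in> dis" for p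
    using enc_lf(2)[OF that(1)] dis_lf(2)[OF that(2)] order by linarith
  then show ?thesis by blast
qed

lemma enc_nested: "p \<in> enc \<Longrightarrow> p' \<in> enc \<Longrightarrow> p < p' \<Longrightarrow> lf p' < lf p"
proof (rule ccontr)
  assume *: "p \<in> enc" "p' \<in> enc" "p < p'" "\<not> lf p' < lf p"
  note e = enc_lf[OF *(1)] enc_lf[OF *(2)]
  have "lf p' \<noteq> lf p" using disjoint(2)[of "lf p" p p'] e *(3) by auto
  then show False using noncrossing[OF e(1) e(5)] *(3,4) e order by linarith
qed

lemma right_end_cases:
  assumes "d < p"
  obtains "p \<in> enc" "p \<notin> dis" | "p \<in> dis" "p \<notin> enc" | "p \<notin> enc" "p \<notin> dis" "\<And>l. (l, p) \<notin> U"
proof (cases "\<exists>l. (l, p) \<in> U")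
  case True
  then obtain l where l: "(l, p) \<in> U" by blast
  from regions[OF l] have "d < l \<or> l < a" using assms order by linarith
  then have "p \<in> dis \<or> p \<in> enc" using l assms by (auto simp: enc_def dis_def)
  with enc_dis that show ?thesis by blast
next
  case False
  then show ?thesis using that(3) by (auto simp: enc_def dis_def)
qed

definition g where "g p = (if p \<in> snd ` U then kap K p \<cdot> seg K (lf p) p else 1)"

text \<open>A dot at such a position lies under no arc ending before \<open>d\<close>, so the
  factors \<open>g\<close> there are common to all diagrams of the relation.\<close>

definition good where
  "good s \<longleftrightarrow> s \<notin> K \<and> s < d \<and> (\<forall>l p. (l, p) \<in> U \<longrightarrow> p < d \<longrightarrow> l \<noteq> s \<and> p \<noteq> s \<and> \<not> (l < s \<and> s < p))"

lemma good_vertex: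
  assumes "s \<in> {a, b, c}" "s \<notin> K" shows "good s"
proof -
  have "s < d" using assms(1) order by auto
  moreover have "l \<noteq> s \<and> p \<noteq> s \<and> \<not> (l < s \<and> s < p)" if "(l, p) \<in> U" "p < d" for l p
  proof -
    have "l \<noteq> s" "p \<noteq> s" using arcs(4,5)[OF that(1)] assms(1) by auto
    moreover have "\<not> (l < s \<and> s < p)"
      using regions[OF that(1)] assms(1) order that(2) by (elim insertE emptyE disjE) linarith+
    ultimately show ?thesis by blast
  qed
  ultimately show ?thesis using assms(2) by (simp add: good_def)
qed

lemma good_lf:
  assumes "i \<in> enc" shows "good (lf i)"
proof -
  note e = enc_lf[OF assms]
  have "l \<noteq> lf i \<and> p \<noteq> lf i \<and> \<not> (l < lf i \<and> lf i < p)" if "(l, p) \<in> U" "p < d" for l p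
    using disjoint(1)[OF e(1) that(1)] disjoint(2)[of "lf i" i p] noncrossing[OF that(1) e(1)] e(1,3) that by auto
  then show ?thesis using e order by (simp add: good_def)
qed

lemma fac_inner:
  assumes "good s" "unique_right U'" "p < d" "\<And>l. (l, p) \<in> U' \<longleftrightarrow> (l, p) \<in> U"
  shows "fac (insert s K) U' p = g p"
proof (cases "p \<in> snd ` U")
  case True
  then obtain l where l: "(l, p) \<in> U" by auto
  then have "(l, p) \<in> U'" using assms(4) by blast
  moreover have "s \<notin> K" "s \<noteq> l" "s \<noteq> p" "\<not> (l < s \<and> s < p)"
    using assms(1,3) l unfolding good_def by auto
  ultimately have "fac (insert s K) U' p = kap K p \<cdot> seg K l p"
    using fac_insert[OF assms(2), of l p s K] arcs(1)[OF l] by auto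
  then show ?thesis using True by (simp add: g_def lf[OF l])
next
  case False
  then have "(l, p) \<notin> U'" for l using assms(4) by force
  then show ?thesis using False by (simp add: fac_none g_def)
qed

definition Zf where "Zf p = kap K p \<cdot> seg K (lf p) p"

lemma fac_dis:
  assumes "p \<in> dis" "s < d" "s \<notin> K" "unique_right U'" "(lf p, p) \<in> U'"
  shows "fac (insert s K) U' p = Zf p"
  using assms dis_lf[OF assms(1)] by (subst fac_insert[of _ "lf p"]) (auto simp: Zf_def)

lemma fac_enc:
  assumes "p \<in> enc" "s < d" "s \<notin> K" "unique_right U'" "(lf p, p) \<in> U'" "s \<noteq> lf p"
  shows "fac (insert s K) U' p = kap K p \<cdot> (if lf p < s then q_pow 2 \<cdot> seg K (lf p) s + seg K s p else seg K (lf p) p)"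
  using assms enc_lf[OF assms(1)] order by (subst fac_insert[of _ "lf p"]) auto

lemma prodl_split5:
  assumes f: "\<And>p. 1 \<le> p \<Longrightarrow> p < d \<Longrightarrow> p \<notin> {a, b, c} \<Longrightarrow> f p = g p"
  shows "prodl f 1 m = prodl g 1 a * f a * prodl g (Suc a) b * f b * prodl g (Suc b) c * f c
      * prodl g (Suc c) d * f d * prodl f (Suc d) m"
proof -
  have "prodl f 1 m = prodl f 1 (Suc d) * prodl f (Suc d) m" using order by (intro prodl_split) auto
  also have "prodl f 1 (Suc d) = prodl f 1 (Suc c) * prodl f (Suc c) d * f d"
    using order prodl_split[of 1 "Suc c" d f] by (simp add: prodl_Suc)
  also have "prodl f 1 (Suc c) = prodl f 1 (Suc b) * prodl f (Suc b) c * f c"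
    using order prodl_split[of 1 "Suc b" c f] by (simp add: prodl_Suc)
  also have "prodl f 1 (Suc b) = prodl f 1 (Suc a) * prodl f (Suc a) b * f b"
    using order prodl_split[of 1 "Suc a" b f] by (simp add: prodl_Suc)
  also have "prodl f 1 (Suc a) = prodl f 1 a * f a" using order by (simp add: prodl_Suc)
  also have "prodl f 1 a = prodl g 1 a" using order f by (intro prodl_cong) auto
  also have "prodl f (Suc a) b = prodl g (Suc a) b" using order f by (intro prodl_cong) auto
  also have "prodl f (Suc b) c = prodl g (Suc b) c" using order f by (intro prodl_cong) auto
  also have "prodl f (Suc c) d = prodl g (Suc c) d" using order f by (intro prodl_cong) auto
  finally show ?thesis by (simp add: mult.assoc)
qed

lemma g_lin:
  assumes "p \<in> snd ` U" "s < p" "s \<in> {b, c}" "p < d"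
  shows "g p \<in> lin (q_pow 2) {s..}"
proof -
  from assms obtain l where l: "(l, p) \<in> U" by auto
  have "s < l" using regions[OF l] assms order arcs(5)[OF l] by auto
  then show ?thesis using assms arcs(1)[OF l] unfolding g_def lf[OF l]
    by (auto intro!: lin_scale seg_lin)
qed

text \<open>Passing the gap costs q^(-2) for each right end in it. This is balanced by the change of
  \<open>kap\<close> from \<open>c\<close> to \<open>d\<close>, up to the single q that comes from
  the 1 in \<open>count_cd\<close>. In this way all diagrams of a relation obtain the same left
  part.\<close>

lemma move_c:
  assumes "V \<in> lin (q_pow 2) {..c}"
  shows "kap K c \<cdot> (V * prodl g (Suc c) d) = (q_pow 1 * kap K d) \<cdot> (prodl g (Suc c) d * V)"
proof -
  have "V * prodl g (Suc c) d = q_pow (- 2 * int (card (snd ` U \<inter> {c<..<d}))) \<cdot> (prodl g (Suc c) d * V)"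
    using assms order by (intro lin_prodl_move) (auto intro!: g_lin, auto simp: g_def)
  moreover have "1 - potential K c + - 2 * int (card (snd ` U \<inter> {c<..<d})) = 1 + (1 - potential K d)"
    using count_cd by simp
  ultimately show ?thesis by (simp only: kap_def q_pow_mult scale_scale)
qed

lemma move_c_left:
  assumes "V \<in> lin (q_pow 2) {..c}"
  shows "kap K c \<cdot> (V * (prodl g (Suc c) d * V')) = (q_pow 1 * kap K d) \<cdot> (prodl g (Suc c) d * (V * V'))"
  using arg_cong[OF move_c[OF assms], of "\<lambda>x. x * V'"] by (simp only: scale_mult mult.assoc)

lemma move_b:
  assumes "V \<in> lin (q_pow 2) {..b}"
  shows "kap K b \<cdot> (V * prodl g (Suc b) c) = (q_pow 1 * kap K c) \<cdot> (prodl g (Suc b) c * V)"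
proof -
  have "V * prodl g (Suc b) c = q_pow (- 2 * int (card (snd ` U \<inter> {b<..<c}))) \<cdot> (prodl g (Suc b) c * V)"
    using assms order by (intro lin_prodl_move) (auto intro!: g_lin, auto simp: g_def)
  moreover have "1 - potential K b + - 2 * int (card (snd ` U \<inter> {b<..<c})) = 1 + (1 - potential K c)"
    using count_bc by simp
  ultimately show ?thesis by (simp only: kap_def q_pow_mult scale_scale)
qed

lemma q_pow_inverse: "q_pow 2 * q_pow (-2) = 1"
  by (simp add: q_pow_mult)

lemma outer_arcs_enclosing:
  assumes "s \<in> {a, b}" "s \<notin> K" and R: "\<And>p. p \<in> enc \<Longrightarrow> R p \<in> lin (q_pow 2) {s..}"
  shows "outer_arcs (q_pow 2) (q_pow (-2)) R (\<lambda>p. q_pow 2 \<cdot> seg K (lf p) s) Zf enc dis"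
proof
  show "q_pow 2 * q_pow (-2) = 1" by (rule q_pow_inverse)
  show "enc \<inter> dis = {}" by (rule enc_dis)
next
  fix i p assume i: "i \<in> enc" and p: "p \<in> enc" and "i < p"
  note ei = enc_lf[OF i] and ep = enc_lf[OF p]
  have s: "a \<le> s" "s < d" using assms(1) order by auto
  have li: "seg K (lf i) s \<in> lin (q_pow 2) {..s}" using ei s by (intro seg_lin) auto
  have "R p * seg K (lf i) s = q_pow 2 \<cdot> (seg K (lf i) s * R p)"
    by (rule lin_commute[OF li R[OF p]]) auto
  then show "R p * (q_pow 2 \<cdot> seg K (lf i) s) = q_pow 2 \<cdot> (q_pow 2 \<cdot> seg K (lf i) s * R p)" by simp
  have "lf p < lf i" by (rule enc_nested) fact+
  moreover have "lf i < s" using ei s by simp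
  ultimately have "seg K (lf p) s = seg K (lf p) (lf i) + seg K (lf i) s"
    and "seg K (lf i) s * seg K (lf p) (lf i) = q_pow 2 \<cdot> (seg K (lf p) (lf i) * seg K (lf i) s)"
    using ei by (auto intro: seg_add seg_commute)
  then show "(q_pow 2 \<cdot> seg K (lf p) s - q_pow 2 \<cdot> seg K (lf i) s) * (q_pow 2 \<cdot> seg K (lf i) s)
      = q_pow (-2) \<cdot> (q_pow 2 \<cdot> seg K (lf i) s * (q_pow 2 \<cdot> seg K (lf p) s - q_pow 2 \<cdot> seg K (lf i) s))"
    by (simp add: scale_distribs q_pow_mult)
next
  fix i p assume i: "i \<in> enc" and p: "p \<in> dis"
  have "seg K (lf p) p * seg K (lf i) s = q_pow 2 \<cdot> (seg K (lf i) s * seg K (lf p) p)"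
    using enc_lf[OF i] dis_lf[OF p] assms(1) order by (intro seg_commute) auto
  then show "Zf p * (q_pow 2 \<cdot> seg K (lf i) s) = q_pow 2 \<cdot> (q_pow 2 \<cdot> seg K (lf i) s * Zf p)"
    by (simp add: Zf_def mult.commute)
qed

text \<open>The power of q left over when \<open>kap K i\<close> is traded for
  \<open>kap K d\<close>; in a matching it equals the position of the arc in the list, minus 1,
  minus its n_i.\<close>

definition enc_exp :: "nat \<Rightarrow> int" where
  "enc_exp i = 2 * int (card {r \<in> enc \<union> dis. r < i}) - (potential K i - 1 - potential K d)"

lemma enc_coefficient:
  assumes "i \<in> enc"
  shows "(q_pow 2 - 1) * kap K i * q_pow 2 ^ card {r \<in> enc \<union> dis. Suc d \<le> r \<and> r < i}
    = (1 - q_pow (-2)) * q_pow (enc_exp i + 1) * kap K d"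
proof -
  have *: "r > d" if "r \<in> enc \<union> dis" for r
    using that enc_lf(3)[of r] dis_lf(2,3)[of r] by auto
  have "{r \<in> enc \<union> dis. Suc d \<le> r \<and> r < i} = {r \<in> enc \<union> dis. r < i}"
    using * by (auto simp: Suc_le_eq)
  then show ?thesis
    by (simp add: kap_def enc_exp_def q_pow_power q_pow_mult left_diff_distrib right_diff_distrib) (simp add: algebra_simps)
qed

text \<open>For Type II the point \<open>a\<close> is put into \<open>K\<close>, and the two main
  diagrams then differ only by a dot at \<open>c\<close> or at \<open>b\<close>. Their factors
  before \<open>d\<close> agree, and \<open>typeII_difference\<close> treats the others; the segment
  \<open>y\<close> in the sum is the form of the new undotted arc bc.\<close>

lemma typeII_relation:
  "prodl (fac (insert c K) U) 1 m = prodl (fac (insert b K) U) 1 m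
    + (\<Sum>i\<in>enc \<inter> {..<m}. ((1 - q_pow (-2)) * q_pow (enc_exp i)) \<cdot> prodl (fac (insert (lf i) K) (insert (b, c) (U - {(lf i, i)}))) 1 m)"
proof -
  define y where "y = seg K b c"
  define \<rho> where "\<rho> p = (if p \<in> enc then seg K c p else 0)" for p
  define R where "R p = \<rho> p + y" for p
  define L where "L p = q_pow 2 \<cdot> seg K (lf p) b" for p
  have bc: "b < c" "c < d" "a < b" using order by auto
  have R_lin: "R p \<in> lin (q_pow 2) {b..}" if "p \<in> enc" for p
    unfolding R_def \<rho>_def y_def using that enc_lf[OF that] bc by (auto intro!: lin_add seg_lin)
  interpret O: outer_arcs "q_pow 2" "q_pow (-2)" "kap K" R L Zf enc dis
    unfolding L_def by (rule outer_arcs_enclosing[OF _ K(1) R_lin]) auto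
  have seg3: "seg K (lf p) p = seg K (lf p) b + y + seg K c p" if "p \<in> enc" for p
  proof -
    note e = enc_lf[OF that]
    have "seg K (lf p) p = seg K (lf p) b + seg K b p" using e bc K by (intro seg_add) auto
    moreover have "seg K b p = seg K b c + seg K c p" using e bc K by (intro seg_add) auto
    ultimately show ?thesis by (simp add: y_def add.assoc)
  qed
  have none: "fac K' U p = 1" if "p \<in> {a, b, c, d}" for K' p
    using that arcs(5) by (intro fac_none) blast
  let ?G = "prodl g 1 a * prodl g (Suc a) b * prodl g (Suc b) c * prodl g (Suc c) d"
  have split: "prodl (fac (insert s K) U) 1 m = ?G * prodl (fac (insert s K) U) (Suc d) m"
    if "s \<in> {b, c}" for s
    using that K by (subst prodl_split5) (auto simp: none intro!: fac_inner good_vertex unique)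
  have D2: "prodl (fac (insert b K) U) (Suc d) m = prodl O.fP (Suc d) m"
  proof (rule prodl_cong)
    fix p assume "Suc d \<le> p" "p < m"
    then have "d < p" by simp
    then show "fac (insert b K) U p = O.fP p"
    proof (cases rule: right_end_cases)
      case 1
      note e = enc_lf[OF 1(1)]
      have "seg K b p = y + seg K c p" using e bc K unfolding y_def by (intro seg_add) auto
      then show ?thesis using 1 e bc K
        by (subst fac_enc) (auto simp: unique O.fP_def L_def R_def \<rho>_def algebra_simps)
    next
      case 2
      then show ?thesis using dis_lf[OF 2(1)] bc K
        by (subst fac_dis) (auto simp: unique O.fP_def O.rest_def)
    next
      case 3
      then show ?thesis by (simp add: fac_none O.fP_def O.rest_def)
    qed
  qed
  define f1 where "f1 p = (if p \<in> enc then kap K p \<cdot> (\<rho> p + q_pow 2 \<cdot> y + L p) else O.rest p)" for p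
  have D1: "prodl (fac (insert c K) U) (Suc d) m = prodl f1 (Suc d) m"
  proof (rule prodl_cong)
    fix p assume "Suc d \<le> p" "p < m"
    then have "d < p" by simp
    then show "fac (insert c K) U p = f1 p"
    proof (cases rule: right_end_cases)
      case 1
      note e = enc_lf[OF 1(1)]
      have "seg K (lf p) c = seg K (lf p) b + y" using e bc K unfolding y_def by (intro seg_add) auto
      then show ?thesis using 1 e bc K
        by (subst fac_enc) (auto simp: unique f1_def L_def \<rho>_def scale_distribs algebra_simps)
    next
      case 2
      then show ?thesis using dis_lf[OF 2(1)] bc K
        by (subst fac_dis) (auto simp: unique f1_def O.rest_def)
    next
      case 3
      then show ?thesis by (simp add: fac_none f1_def O.rest_def)
    qed
  qed
  have Vy: "kap K c \<cdot> (y * (prodl g (Suc c) d * V)) = (q_pow 1 * kap K d) \<cdot> (prodl g (Suc c) d * (y * V))" for V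
    unfolding y_def using bc by (intro move_c_left seg_lin) auto
  \<comment> \<open>The factor at \<open>i\<close> disappears, the arc \<open>(b, c)\<close>
    supplies \<open>y\<close>, and \<open>Vy\<close> pushes it over the gap to the factors beyond
    \<open>d\<close>.\<close>
  have Xi: "prodl (fac (insert (lf i) K) (insert (b, c) (U - {(lf i, i)}))) 1 m
      = (q_pow 1 * kap K d) \<cdot> (?G * (y * prodl (O.fX i) (Suc d) m))" if i: "i \<in> enc" for i
  proof -
    note ei = enc_lf[OF i]
    let ?U = "insert (b, c) (U - {(lf i, i)})" and ?f = "fac (insert (lf i) K) (insert (b, c) (U - {(lf i, i)}))"
    have uq: "unique_right ?U"
      using unique arcs(5) by (intro unique_right_insert unique_right_Diff) blast+
    have "?f p = g p" if "p < d" "p \<notin> {a, b, c}" for p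
      using that ei order by (intro fac_inner good_lf[OF i] uq) auto
    then have "prodl ?f 1 m = prodl g 1 a * ?f a * prodl g (Suc a) b * ?f b * prodl g (Suc b) c * ?f c
      * prodl g (Suc c) d * ?f d * prodl ?f (Suc d) m" by (intro prodl_split5)
    moreover have "?f a = 1" "?f b = 1" "?f d = 1"
      using bc arcs(5) by (auto intro!: fac_none)
    moreover have "?f c = kap K c \<cdot> y"
      using fac_insert[OF uq, of b c "lf i" K] ei bc by (auto simp: y_def)
    moreover have "prodl ?f (Suc d) m = prodl (O.fX i) (Suc d) m"
    proof (rule prodl_cong)
      fix p assume "Suc d \<le> p" "p < m"
      then have "d < p" by simp
      then show "?f p = O.fX i p"
      proof (cases rule: right_end_cases)
        case 1
        note e = enc_lf[OF 1(1)]
        consider "p < i" | "p = i" | "i < p" by linarith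
        then show ?thesis
        proof cases
          case 1
          have l: "lf i < lf p" by (rule enc_nested) (fact | use \<open>p \<in> enc\<close> in simp)+
          have "?f p = kap K p \<cdot> seg K (lf p) p"
            using l e ei order \<open>p \<in> enc\<close> 1 uq by (subst fac_enc) auto
          then show ?thesis using 1 \<open>p \<in> enc\<close>
            by (simp add: O.fX_def seg3 R_def \<rho>_def L_def q_pow_mult algebra_simps)
        next
          case 2
          have "(l, p) \<notin> ?U" for l
          proof
            assume "(l, p) \<in> ?U"
            then have "(l, i) \<in> U" "l \<noteq> lf i" using 2 ei(3) order by auto
            then show False using disjoint(3)[OF _ ei(1)] by blast
          qed
          then have "?f p = 1" by (rule fac_none)
          then show ?thesis using 2 i by (simp add: O.fX_def)
        next
          case 3
          have l: "lf p < lf i" by (rule enc_nested) (fact | use \<open>p \<in> enc\<close> in simp)+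
          \<comment> \<open>The dot now sits at \<open>lf i\<close>, to the left of
            \<open>b\<close>, so only the stretch from \<open>lf p\<close> to \<open>lf i\<close>
            keeps the factor q^2.\<close>
          have "?f p = kap K p \<cdot> (q_pow 2 \<cdot> seg K (lf p) (lf i) + seg K (lf i) p)"
            using l e ei order \<open>p \<in> enc\<close> 3 uq by (subst fac_enc) auto
          moreover have "seg K (lf p) b = seg K (lf p) (lf i) + seg K (lf i) b"
            using l ei bc by (intro seg_add) auto
          moreover have "seg K (lf i) p = seg K (lf i) b + seg K b p" using ei e bc K by (intro seg_add) auto
          moreover have "seg K b p = y + seg K c p" using e bc K unfolding y_def by (intro seg_add) auto
          ultimately show ?thesis using 3 \<open>p \<in> enc\<close>
            by (simp add: O.fX_def R_def \<rho>_def L_def q_pow_mult scale_distribs left_diff_distrib algebra_simps)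
        qed
      next
        case 2
        then show ?thesis using dis_lf[OF 2(1)] ei order uq
          by (subst fac_dis) (auto simp: O.fX_def O.rest_def)
      next
        case 3
        have "?f p = 1" using 3 \<open>d < p\<close> order by (intro fac_none) auto
        then show ?thesis using 3 by (simp add: O.fX_def O.rest_def)
      qed
    qed
    ultimately have "prodl ?f 1 m = prodl g 1 a * (prodl g (Suc a) b * (prodl g (Suc b) c
        * (kap K c \<cdot> (y * (prodl g (Suc c) d * prodl (O.fX i) (Suc d) m)))))"
      by (simp add: mult.assoc)
    then show ?thesis unfolding Vy by (simp add: mult.assoc)
  qed
  have "prodl f1 (Suc d) m - prodl O.fP (Suc d) m
    = (\<Sum>i\<in>enc \<inter> {Suc d..<m}. ((q_pow 2 - 1) * kap K i * q_pow 2 ^ O.num (Suc d) i) \<cdot> (y * prodl (O.fX i) (Suc d) m))"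
  proof (rule O.typeII_difference[where \<rho> = \<rho>])
    fix p assume p: "p \<in> enc"
    note e = enc_lf[OF p]
    show "\<rho> p * y = q_pow 2 \<cdot> (y * \<rho> p)"
      using p e bc by (auto simp: \<rho>_def y_def intro!: seg_commute)
    have "y * seg K (lf p) b = q_pow 2 \<cdot> (seg K (lf p) b * y)"
      unfolding y_def using e bc by (intro seg_commute) auto
    then show "L p * y = q_pow (-2) \<cdot> (y * L p)" by (simp add: L_def q_pow_mult)
  next
    fix p assume p: "p \<in> dis"
    have "seg K (lf p) p * y = q_pow 2 \<cdot> (y * seg K (lf p) p)"
      unfolding y_def using dis_lf[OF p] bc by (intro seg_commute) auto
    then show "Zf p * y = q_pow 2 \<cdot> (y * Zf p)" by (simp add: Zf_def mult.commute)
  qed (use order in \<open>auto simp: R_def f1_def\<close>)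
  also have "enc \<inter> {Suc d..<m} = enc \<inter> {..<m}" using enc_lf(3) by (auto simp: Suc_le_eq)
  finally have "?G * prodl f1 (Suc d) m = ?G * prodl O.fP (Suc d) m
    + (\<Sum>i\<in>enc \<inter> {..<m}. ((q_pow 2 - 1) * kap K i * q_pow 2 ^ O.num (Suc d) i) \<cdot> (?G * (y * prodl (O.fX i) (Suc d) m)))"
    by (simp add: algebra_simps sum_distrib_left)
  also have "(\<Sum>i\<in>enc \<inter> {..<m}. ((q_pow 2 - 1) * kap K i * q_pow 2 ^ O.num (Suc d) i) \<cdot> (?G * (y * prodl (O.fX i) (Suc d) m)))
    = (\<Sum>i\<in>enc \<inter> {..<m}. ((1 - q_pow (-2)) * q_pow (enc_exp i)) \<cdot> prodl (fac (insert (lf i) K) (insert (b, c) (U - {(lf i, i)}))) 1 m)"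
  proof (rule sum.cong)
    fix i assume i: "i \<in> enc \<inter> {..<m}"
    have "(q_pow 2 - 1) * kap K i * q_pow 2 ^ O.num (Suc d) i = ((1 - q_pow (-2)) * q_pow (enc_exp i)) * (q_pow 1 * kap K d)"
      using enc_coefficient[of i] i unfolding O.num_def by (simp add: q_pow_add mult_ac)
    then show "((q_pow 2 - 1) * kap K i * q_pow 2 ^ O.num (Suc d) i) \<cdot> (?G * (y * prodl (O.fX i) (Suc d) m))
      = ((1 - q_pow (-2)) * q_pow (enc_exp i)) \<cdot> prodl (fac (insert (lf i) K) (insert (b, c) (U - {(lf i, i)}))) 1 m"
      using Xi[of i] i by simp
  qed simp
  finally show ?thesis using split[of b] split[of c] by (simp only: D1 D2 insert_iff simp_thms)
qed

text \<open>Every product takes the shape of \<open>kap K d\<close> times the common left part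
  \<open>?G\<close> times a rest. The form of ab passes two gaps and gains q^2, that of bc passes
  one and gains q; this q is what the coefficient q^(-1) in Type I removes.\<close>

lemma typeI_relation:
  assumes aK: "a \<notin> K"
  shows "prodl (fac (insert b K) (insert (a, d) U)) 1 m
    = prodl (fac (insert a K) (insert (c, d) U)) 1 m + prodl (fac (insert c K) (insert (a, b) U)) 1 m
    + q_pow (-1) \<cdot> prodl (fac (insert a K) (insert (b, c) U)) 1 m
    + (\<Sum>i\<in>enc \<inter> {..<m}. ((1 - q_pow (-2)) * q_pow (enc_exp i + 1))
        \<cdot> prodl (fac (insert (lf i) K) (insert (a, b) (insert (c, d) (U - {(lf i, i)})))) 1 m)"
proof -
  define u where "u = seg K a b"
  define y where "y = seg K b c"
  define z where "z = seg K c d"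
  define \<rho> where "\<rho> p = (if p \<in> enc then seg K d p else 0)" for p
  define R where "R p = \<rho> p + u + y + z" for p
  define L where "L p = q_pow 2 \<cdot> seg K (lf p) a" for p
  have bc: "b < c" "c < d" "a < b" using order by auto
  have R_lin: "R p \<in> lin (q_pow 2) {a..}" if "p \<in> enc" for p
    unfolding R_def \<rho>_def u_def y_def z_def using that enc_lf[OF that] bc by (auto intro!: lin_add seg_lin)
  interpret O: outer_arcs "q_pow 2" "q_pow (-2)" "kap K" R L Zf enc dis
    unfolding L_def by (rule outer_arcs_enclosing[OF _ aK R_lin]) auto
  have seg_a: "seg K (lf p) p = seg K (lf p) a + seg K a p" if "p \<in> enc" for p
    using enc_lf[OF that] bc aK by (intro seg_add) auto
  have seg_b: "seg K a p = u + seg K b p" if "p \<in> enc" for p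
    unfolding u_def using enc_lf[OF that] bc K by (intro seg_add) auto
  have seg_c: "seg K b p = y + seg K c p" if "p \<in> enc" for p
    unfolding y_def using enc_lf[OF that] bc K by (intro seg_add) auto
  have seg_d: "seg K c p = z + seg K d p" if "p \<in> enc" for p
    unfolding z_def using enc_lf[OF that] bc K by (intro seg_add) auto
  have none: "fac K' U' p = 1" if "p \<in> {a, b, c, d}" "\<And>l p. (l, p) \<in> U' \<Longrightarrow> (l, p) \<in> U \<or> p = p0" "p \<noteq> p0" for K' U' p p0
    using that arcs(5) by (intro fac_none) blast
  have no: "(l, a) \<notin> U" "(l, b) \<notin> U" "(l, c) \<notin> U" "(l, d) \<notin> U" for l
    using arcs(5) by blast+
  have uq: "unique_right (insert (l, p) U)" if "p \<in> {a, b, c, d}" for l p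
    using that no by (intro unique_right_insert unique) auto
  let ?G = "prodl g 1 a * prodl g (Suc a) b * prodl g (Suc b) c * prodl g (Suc c) d"
  define f1 where "f1 p = (if p \<in> enc then kap K p \<cdot> (\<rho> p + q_pow 2 \<cdot> u + y + z + L p) else O.rest p)" for p
  define f3 where "f3 p = (if p \<in> enc then kap K p \<cdot> (\<rho> p + q_pow 2 \<cdot> u + q_pow 2 \<cdot> y + z + L p) else O.rest p)" for p
  have outer: "fac (insert s K) U' p = (if p \<in> enc then kap K p \<cdot> (q_pow 2 \<cdot> seg K (lf p) s + seg K s p) else O.rest p)"
    if "s \<in> {a, b, c}" "unique_right U'" "\<And>l. (l, p) \<in> U' \<longleftrightarrow> (l, p) \<in> U" "d < p" for s U' p
    using \<open>d < p\<close>
  proof (cases rule: right_end_cases)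
    case 1
    note e = enc_lf[OF 1(1)]
    have "s < d" "s \<notin> K" "s \<noteq> lf p" "lf p < s" using that(1) e bc aK K by auto
    then show ?thesis using 1 fac_enc[OF 1(1), of s U'] that e by simp
  next
    case 2
    have "s < d" "s \<notin> K" using that(1) bc aK K by auto
    then show ?thesis using 2 fac_dis[OF 2(1), of s U'] that dis_lf[OF 2(1)] by (simp add: O.rest_def)
  next
    case 3
    then show ?thesis using that by (simp add: fac_none O.rest_def)
  qed
  have inner: "prodl (fac (insert s K) U') 1 m = prodl g 1 a * fac (insert s K) U' a * prodl g (Suc a) b * fac (insert s K) U' b
      * prodl g (Suc b) c * fac (insert s K) U' c * prodl g (Suc c) d * fac (insert s K) U' d * prodl (fac (insert s K) U') (Suc d) m"
    if "good s" "unique_right U'" "\<And>l p. p < d \<Longrightarrow> p \<notin> {a, b, c} \<Longrightarrow> (l, p) \<in> U' \<longleftrightarrow> (l, p) \<in> U" for s U'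
    using that by (intro prodl_split5 fac_inner) auto
  have good: "good a" "good b" "good c" using good_vertex aK K by auto

  have D1: "prodl (fac (insert b K) (insert (a, d) U)) 1 m = kap K d \<cdot> (?G * ((q_pow 2 \<cdot> u + y + z) * prodl f1 (Suc d) m))"
  proof -
    let ?U = "insert (a, d) U"
    have uq': "unique_right ?U" by (rule uq) simp
    have "prodl (fac (insert b K) ?U) (Suc d) m = prodl f1 (Suc d) m"
    proof (rule prodl_cong)
      fix p assume "Suc d \<le> p"
      then have "fac (insert b K) ?U p = (if p \<in> enc then kap K p \<cdot> (q_pow 2 \<cdot> seg K (lf p) b + seg K b p) else O.rest p)"
        by (intro outer uq') auto
      moreover have "seg K (lf p) b = seg K (lf p) a + u" if "p \<in> enc"
        unfolding u_def using enc_lf[OF that] bc aK by (intro seg_add) auto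
      ultimately show "fac (insert b K) ?U p = f1 p"
        by (simp add: f1_def L_def \<rho>_def seg_c seg_d scale_distribs algebra_simps)
    qed
    moreover have "fac (insert b K) ?U a = 1" "fac (insert b K) ?U b = 1" "fac (insert b K) ?U c = 1"
      using bc no by (auto intro!: fac_none)
    \<comment> \<open>The dot at \<open>b\<close> lies under the arc ad and scales only the stretch
      \<open>u\<close> to its left.\<close>
    moreover have "fac (insert b K) ?U d = kap K d \<cdot> (q_pow 2 \<cdot> u + y + z)"
    proof -
      have "seg K b d = y + z" unfolding y_def z_def using bc K by (intro seg_add) auto
      then show ?thesis using fac_insert[OF uq', of a d b K] K bc by (simp add: u_def add.assoc)
    qed
    moreover have "prodl (fac (insert b K) ?U) 1 m = prodl g 1 a * fac (insert b K) ?U a * prodl g (Suc a) b * fac (insert b K) ?U b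
      * prodl g (Suc b) c * fac (insert b K) ?U c * prodl g (Suc c) d * fac (insert b K) ?U d * prodl (fac (insert b K) ?U) (Suc d) m"
      by (intro inner good uq') auto
    ultimately show ?thesis by (simp add: mult.assoc)
  qed
  have P: "prodl (fac (insert a K) (insert (l, p0) U)) (Suc d) m = prodl O.fP (Suc d) m"
    if "p0 \<in> {c, d}" for l p0
  proof (rule prodl_cong)
    fix p assume "Suc d \<le> p"
    then have "fac (insert a K) (insert (l, p0) U) p = (if p \<in> enc then kap K p \<cdot> (q_pow 2 \<cdot> seg K (lf p) a + seg K a p) else O.rest p)"
      using that bc uq by (intro outer) auto
    then show "fac (insert a K) (insert (l, p0) U) p = O.fP p"
      by (simp add: O.fP_def R_def L_def \<rho>_def seg_b seg_c seg_d algebra_simps)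
  qed
  have D2: "prodl (fac (insert a K) (insert (c, d) U)) 1 m = kap K d \<cdot> (?G * (z * prodl O.fP (Suc d) m))"
  proof -
    let ?U = "insert (c, d) U"
    have uq': "unique_right ?U" by (rule uq) simp
    have "fac (insert a K) ?U a = 1" "fac (insert a K) ?U b = 1" "fac (insert a K) ?U c = 1"
      using bc no by (auto intro!: fac_none)
    moreover have "fac (insert a K) ?U d = kap K d \<cdot> z"
      using fac_insert[OF uq', of c d a K] aK bc by (simp add: z_def)
    moreover have "prodl (fac (insert a K) ?U) 1 m = prodl g 1 a * fac (insert a K) ?U a * prodl g (Suc a) b * fac (insert a K) ?U b
      * prodl g (Suc b) c * fac (insert a K) ?U c * prodl g (Suc c) d * fac (insert a K) ?U d * prodl (fac (insert a K) ?U) (Suc d) m"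
      by (intro inner good uq') auto
    ultimately show ?thesis by (simp add: mult.assoc P)
  qed
  have Vu: "kap K b \<cdot> (u * (prodl g (Suc b) c * (prodl g (Suc c) d * V))) = (q_pow 2 * kap K d) \<cdot> (prodl g (Suc b) c * (prodl g (Suc c) d * (u * V)))" for V
  proof -
    have 1: "kap K b \<cdot> (u * prodl g (Suc b) c) = (q_pow 1 * kap K c) \<cdot> (prodl g (Suc b) c * u)"
      unfolding u_def using bc by (intro move_b seg_lin) auto
    have 2: "kap K c \<cdot> (u * prodl g (Suc c) d) = (q_pow 1 * kap K d) \<cdot> (prodl g (Suc c) d * u)"
      unfolding u_def using bc by (intro move_c seg_lin) auto
    have "kap K b \<cdot> (u * (prodl g (Suc b) c * (prodl g (Suc c) d * V)))
        = (kap K b \<cdot> (u * prodl g (Suc b) c)) * (prodl g (Suc c) d * V)" by (simp add: mult.assoc)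
    also have "\<dots> = q_pow 1 \<cdot> (prodl g (Suc b) c * ((kap K c \<cdot> (u * prodl g (Suc c) d)) * V))"
      unfolding 1 by (simp add: mult.assoc)
    also have "\<dots> = (q_pow 2 * kap K d) \<cdot> (prodl g (Suc b) c * (prodl g (Suc c) d * (u * V)))"
      unfolding 2 by (simp add: mult.assoc q_pow_mult)
    finally show ?thesis .
  qed
  have D3: "prodl (fac (insert c K) (insert (a, b) U)) 1 m = kap K d \<cdot> (?G * ((q_pow 2 \<cdot> u) * prodl f3 (Suc d) m))"
  proof -
    let ?U = "insert (a, b) U"
    have uq': "unique_right ?U" by (rule uq) simp
    have "prodl (fac (insert c K) ?U) (Suc d) m = prodl f3 (Suc d) m"
    proof (rule prodl_cong)
      fix p assume "Suc d \<le> p"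
      then have "fac (insert c K) ?U p = (if p \<in> enc then kap K p \<cdot> (q_pow 2 \<cdot> seg K (lf p) c + seg K c p) else O.rest p)"
        using bc by (intro outer uq') auto
      moreover have "seg K (lf p) c = seg K (lf p) a + u + y" if "p \<in> enc"
      proof -
        have "seg K (lf p) c = seg K (lf p) a + seg K a c" using enc_lf[OF that] bc aK by (intro seg_add) auto
        moreover have "seg K a c = u + y" unfolding u_def y_def using bc K by (intro seg_add) auto
        ultimately show ?thesis by (simp add: add.assoc)
      qed
      ultimately show "fac (insert c K) ?U p = f3 p"
        by (simp add: f3_def L_def \<rho>_def seg_d scale_distribs algebra_simps)
    qed
    moreover have "fac (insert c K) ?U a = 1" "fac (insert c K) ?U c = 1" "fac (insert c K) ?U d = 1"
      using bc no by (auto intro!: fac_none)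
    moreover have "fac (insert c K) ?U b = kap K b \<cdot> u"
      using fac_insert[OF uq', of a b c K] K bc by (simp add: u_def)
    moreover have "prodl (fac (insert c K) ?U) 1 m = prodl g 1 a * fac (insert c K) ?U a * prodl g (Suc a) b * fac (insert c K) ?U b
      * prodl g (Suc b) c * fac (insert c K) ?U c * prodl g (Suc c) d * fac (insert c K) ?U d * prodl (fac (insert c K) ?U) (Suc d) m"
      by (intro inner good uq') (use bc in auto)
    ultimately have "prodl (fac (insert c K) ?U) 1 m
        = prodl g 1 a * (prodl g (Suc a) b * (kap K b \<cdot> (u * (prodl g (Suc b) c * (prodl g (Suc c) d * prodl f3 (Suc d) m)))))"
      by (simp add: mult.assoc)
    then show ?thesis unfolding Vu by (simp add: mult.assoc mult.commute)
  qed
  have Vy: "kap K c \<cdot> (y * (prodl g (Suc c) d * V)) = (q_pow 1 * kap K d) \<cdot> (prodl g (Suc c) d * (y * V))" for V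
    unfolding y_def using bc by (intro move_c_left seg_lin) auto
  have D4: "prodl (fac (insert a K) (insert (b, c) U)) 1 m = (q_pow 1 * kap K d) \<cdot> (?G * (y * prodl O.fP (Suc d) m))"
  proof -
    let ?U = "insert (b, c) U"
    have uq': "unique_right ?U" by (rule uq) simp
    have "fac (insert a K) ?U a = 1" "fac (insert a K) ?U b = 1" "fac (insert a K) ?U d = 1"
      using bc no by (auto intro!: fac_none)
    moreover have "fac (insert a K) ?U c = kap K c \<cdot> y"
      using fac_insert[OF uq', of b c a K] aK bc by (simp add: y_def)
    moreover have "prodl (fac (insert a K) ?U) 1 m = prodl g 1 a * fac (insert a K) ?U a * prodl g (Suc a) b * fac (insert a K) ?U b
      * prodl g (Suc b) c * fac (insert a K) ?U c * prodl g (Suc c) d * fac (insert a K) ?U d * prodl (fac (insert a K) ?U) (Suc d) m"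
      by (intro inner good uq') auto
    ultimately have "prodl (fac (insert a K) ?U) 1 m = prodl g 1 a * (prodl g (Suc a) b * (prodl g (Suc b) c
        * (kap K c \<cdot> (y * (prodl g (Suc c) d * prodl O.fP (Suc d) m)))))"
      by (simp add: mult.assoc P)
    then show ?thesis unfolding Vy by (simp add: mult.assoc)
  qed
  \<comment> \<open>Two short arcs contribute a factor here, whence the second
    \<open>kap K d\<close>; its counterpart is the \<open>kap K d\<close> in
    \<open>enc_coefficient\<close>.\<close>
  have Xi: "prodl (fac (insert (lf i) K) (insert (a, b) (insert (c, d) (U - {(lf i, i)})))) 1 m
      = (kap K d * kap K d) \<cdot> (?G * (q_pow 2 \<cdot> (u * z) * prodl (O.fX i) (Suc d) m))" if i: "i \<in> enc" for i
  proof -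
    note ei = enc_lf[OF i]
    let ?U = "insert (a, b) (insert (c, d) (U - {(lf i, i)}))"
    let ?f = "fac (insert (lf i) K) ?U"
    have uq': "unique_right ?U"
      by (intro unique_right_insert unique_right_Diff unique) (use bc in \<open>auto simp: no\<close>)
    have "?f a = 1" "?f c = 1"
      using bc no by (auto intro!: fac_none)
    moreover have "?f b = kap K b \<cdot> u"
      using fac_insert[OF uq', of a b "lf i" K] ei bc by (auto simp: u_def)
    moreover have "?f d = kap K d \<cdot> z"
      using fac_insert[OF uq', of c d "lf i" K] ei bc by (auto simp: z_def)
    moreover have "prodl ?f (Suc d) m = prodl (O.fX i) (Suc d) m"
    proof (rule prodl_cong)
      fix p assume "Suc d \<le> p" "p < m"
      then have "d < p" by simp
      then show "?f p = O.fX i p"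
      proof (cases rule: right_end_cases)
        case 1
        note e = enc_lf[OF 1(1)]
        consider "p < i" | "p = i" | "i < p" by linarith
        then show ?thesis
        proof cases
          case 1
          have l: "lf i < lf p" by (rule enc_nested) (fact | use \<open>p \<in> enc\<close> in simp)+
          have "?f p = kap K p \<cdot> seg K (lf p) p"
            using l e ei order \<open>p \<in> enc\<close> 1 uq' by (subst fac_enc) auto
          then show ?thesis using 1 \<open>p \<in> enc\<close>
            by (simp add: O.fX_def seg_a seg_b seg_c seg_d R_def \<rho>_def L_def q_pow_mult algebra_simps)
        next
          case 2
          have "(l, p) \<notin> ?U" for l
          proof
            assume "(l, p) \<in> ?U"
            then have "(l, i) \<in> U" "l \<noteq> lf i" using 2 ei(3) order by auto
            then show False using disjoint(3)[OF _ ei(1)] by blast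
          qed
          then have "?f p = 1" by (rule fac_none)
          then show ?thesis using 2 i by (simp add: O.fX_def)
        next
          case 3
          have l: "lf p < lf i" by (rule enc_nested) (fact | use \<open>p \<in> enc\<close> in simp)+
          have "?f p = kap K p \<cdot> (q_pow 2 \<cdot> seg K (lf p) (lf i) + seg K (lf i) p)"
            using l e ei order \<open>p \<in> enc\<close> 3 uq' by (subst fac_enc) auto
          moreover have "seg K (lf p) a = seg K (lf p) (lf i) + seg K (lf i) a"
            using l ei bc by (intro seg_add) auto
          moreover have "seg K (lf i) p = seg K (lf i) a + seg K a p" using ei e bc aK by (intro seg_add) auto
          ultimately show ?thesis using 3 \<open>p \<in> enc\<close>
            by (simp add: O.fX_def R_def \<rho>_def L_def seg_b seg_c seg_d q_pow_mult scale_distribs left_diff_distrib algebra_simps)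
        qed
      next
        case 2
        then show ?thesis using dis_lf[OF 2(1)] ei order uq'
          by (subst fac_dis) (auto simp: O.fX_def O.rest_def)
      next
        case 3
        have "?f p = 1" using 3 \<open>d < p\<close> order by (intro fac_none) auto
        then show ?thesis using 3 by (simp add: O.fX_def O.rest_def)
      qed
    qed
    moreover have "prodl ?f 1 m = prodl g 1 a * ?f a * prodl g (Suc a) b * ?f b
      * prodl g (Suc b) c * ?f c * prodl g (Suc c) d * ?f d * prodl ?f (Suc d) m"
      using ei order by (intro inner good_lf[OF i] uq') auto
    ultimately have "prodl ?f 1 m = kap K d \<cdot> (prodl g 1 a * (prodl g (Suc a) b * (kap K b \<cdot> (u * (prodl g (Suc b) c
        * (prodl g (Suc c) d * (z * prodl (O.fX i) (Suc d) m)))))))"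
      by (simp add: mult.assoc mult.commute)
    then show ?thesis unfolding Vu by (simp add: mult.assoc mult.left_commute mult.commute)
  qed
  have "(q_pow 2 \<cdot> u + y + z) * prodl f1 (Suc d) m - z * prodl O.fP (Suc d) m - q_pow 2 \<cdot> u * prodl f3 (Suc d) m - y * prodl O.fP (Suc d) m
    = (\<Sum>i\<in>enc \<inter> {Suc d..<m}. ((q_pow 2 - 1) * kap K i * q_pow 2 ^ O.num (Suc d) i) \<cdot> (q_pow 2 \<cdot> (u * z) * prodl (O.fX i) (Suc d) m))"
  proof (rule O.typeI_difference[where \<rho> = \<rho>])
    show "z * u = q_pow 2 \<cdot> (u * z)" "z * y = q_pow 2 \<cdot> (y * z)" "y * u = q_pow 2 \<cdot> (u * y)"
      unfolding u_def y_def z_def using bc by (auto intro!: seg_commute)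
  next
    fix p assume p: "p \<in> enc"
    note e = enc_lf[OF p]
    show "\<rho> p * u = q_pow 2 \<cdot> (u * \<rho> p)" "\<rho> p * y = q_pow 2 \<cdot> (y * \<rho> p)"
      using p e bc by (auto simp: \<rho>_def y_def u_def intro!: seg_commute)
    have "u * seg K (lf p) a = q_pow 2 \<cdot> (seg K (lf p) a * u)"
      unfolding u_def using e bc by (intro seg_commute) auto
    then show "L p * u = q_pow (-2) \<cdot> (u * L p)" by (simp add: L_def q_pow_mult)
    have "y * seg K (lf p) a = q_pow 2 \<cdot> (seg K (lf p) a * y)"
      unfolding y_def using e bc by (intro seg_commute) auto
    then show "L p * y = q_pow (-2) \<cdot> (y * L p)" by (simp add: L_def q_pow_mult)
  next
    fix p assume p: "p \<in> dis"
    have "seg K (lf p) p * y = q_pow 2 \<cdot> (y * seg K (lf p) p)"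
      unfolding y_def using dis_lf[OF p] bc by (intro seg_commute) auto
    then show "Zf p * y = q_pow 2 \<cdot> (y * Zf p)" by (simp add: Zf_def mult.commute)
    have "seg K (lf p) p * u = q_pow 2 \<cdot> (u * seg K (lf p) p)"
      unfolding u_def using dis_lf[OF p] bc by (intro seg_commute) auto
    then show "Zf p * u = q_pow 2 \<cdot> (u * Zf p)" by (simp add: Zf_def mult.commute)
  qed (use order in \<open>auto simp: R_def f1_def f3_def\<close>)
  also have "enc \<inter> {Suc d..<m} = enc \<inter> {..<m}" using enc_lf(3) by (auto simp: Suc_le_eq)
  finally have *: "(q_pow 2 \<cdot> u + y + z) * prodl f1 (Suc d) m = z * prodl O.fP (Suc d) m + q_pow 2 \<cdot> u * prodl f3 (Suc d) m + y * prodl O.fP (Suc d) m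
    + (\<Sum>i\<in>enc \<inter> {..<m}. ((q_pow 2 - 1) * kap K i * q_pow 2 ^ O.num (Suc d) i) \<cdot> (q_pow 2 \<cdot> (u * z) * prodl (O.fX i) (Suc d) m))"
    by (simp only: diff_eq_eq add_ac)
  have sum: "kap K d \<cdot> (?G * (\<Sum>i\<in>enc \<inter> {..<m}. ((q_pow 2 - 1) * kap K i * q_pow 2 ^ O.num (Suc d) i) \<cdot> (q_pow 2 \<cdot> (u * z) * prodl (O.fX i) (Suc d) m)))
    = (\<Sum>i\<in>enc \<inter> {..<m}. ((1 - q_pow (-2)) * q_pow (enc_exp i + 1))
        \<cdot> prodl (fac (insert (lf i) K) (insert (a, b) (insert (c, d) (U - {(lf i, i)})))) 1 m)"
    unfolding sum_distrib_left scale_sum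
  proof (rule sum.cong)
    fix i assume i: "i \<in> enc \<inter> {..<m}"
    then have "i \<in> enc" by simp
    note coef = enc_coefficient[OF this]
    show "kap K d \<cdot> (?G * (((q_pow 2 - 1) * kap K i * q_pow 2 ^ O.num (Suc d) i) \<cdot> (q_pow 2 \<cdot> (u * z) * prodl (O.fX i) (Suc d) m)))
      = ((1 - q_pow (-2)) * q_pow (enc_exp i + 1)) \<cdot> prodl (fac (insert (lf i) K) (insert (a, b) (insert (c, d) (U - {(lf i, i)})))) 1 m"
      unfolding Xi[OF \<open>i \<in> enc\<close>] O.num_def coef by (simp add: mult.assoc mult.commute mult.left_commute)
  qed simp
  have q: "q_pow (-1) * (q_pow 1 * kap K d) = kap K d" by (simp add: q_pow_mult)
  show ?thesis unfolding D1 D2 D3 D4 * sum[symmetric] scale_scale q by (simp add: scale_distribs distrib_left)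
qed

end

section \<open>Invariance under the Russell relations\<close>

text \<open>In a strictly sorted list a position is one more than the number of smaller entries, so
  an index that refers to the list can be replaced by a count.\<close>

lemma sum_over_sorted_list:
  fixes f :: "'a \<Rightarrow> nat" and h :: "'a \<Rightarrow> nat \<Rightarrow> 'b::comm_monoid_add"
  assumes xs: "sorted_wrt (<) (map f xs)"
  shows "(\<Sum>i = 1..length xs. h (xs ! (i - 1)) i) = (\<Sum>x\<in>set xs. h x (Suc (card {x'\<in>set xs. f x' < f x})))"
proof -
  have less: "f (xs ! i) < f (xs ! j) \<longleftrightarrow> i < j" if "i < length xs" "j < length xs" for i j
    using that xs sorted_wrt_nth_less[OF xs, of i j] sorted_wrt_nth_less[OF xs, of j i]
    by (cases i j rule: linorder_cases) auto
  have inj: "inj_on ((!) xs) {..<length xs}"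
  proof (rule inj_onI)
    fix i j assume "i \<in> {..<length xs}" "j \<in> {..<length xs}" "xs ! i = xs ! j"
    then show "i = j" using less[of i j] less[of j i] by (metis lessThan_iff less_irrefl linorder_neqE_nat)
  qed
  have set: "set xs = (!) xs ` {..<length xs}" by (auto simp: set_conv_nth)
  have card: "card {x'\<in>set xs. f x' < f (xs ! j)} = j" if "j < length xs" for j
  proof -
    have "{x'\<in>set xs. f x' < f (xs ! j)} = (!) xs ` {..<j}"
    proof (intro equalityI subsetI)
      fix x assume "x \<in> {x'\<in>set xs. f x' < f (xs ! j)}"
      then obtain i where "i < length xs" "x = xs ! i" "f x < f (xs ! j)" by (auto simp: in_set_conv_nth)
      then show "x \<in> (!) xs ` {..<j}" using less[of i j] that by simp
    next
      fix x assume "x \<in> (!) xs ` {..<j}"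
      then obtain i where "i < j" "x = xs ! i" by auto
      then show "x \<in> {x'\<in>set xs. f x' < f (xs ! j)}" using less[of i j] that by simp
    qed
    moreover have "inj_on ((!) xs) {..<j}" using inj that by (auto intro: inj_on_subset)
    ultimately show ?thesis by (simp add: card_image)
  qed
  have "(\<Sum>x\<in>set xs. h x (Suc (card {x'\<in>set xs. f x' < f x})))
      = (\<Sum>j<length xs. h (xs ! j) (Suc (card {x'\<in>set xs. f x' < f (xs ! j)})))"
    unfolding set by (rule sum.reindex[OF inj, unfolded comp_def])
  also have "\<dots> = (\<Sum>j<length xs. h (xs ! j) (Suc j))" by (rule sum.cong) (simp_all add: card)
  also have "\<dots> = (\<Sum>i = 1..length xs. h (xs ! (i - 1)) i)"
    by (rule sum.reindex_bij_witness[of _ "\<lambda>i. i - 1" Suc]) auto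
  finally show ?thesis by simp
qed

context linorder begin

lemma strict_sorted_key_list_of_inj:
  assumes "finite A" "inj_on f A"
  shows "set (sorted_key_list_of_set f A) = A" "sorted_wrt (<) (map f (sorted_key_list_of_set f A))"
proof -
  interpret S: folding_insort_key "(\<le>)" "(<)" A f by unfold_locales (rule assms(2))
  show "set (sorted_key_list_of_set f A) = A" "sorted_wrt (<) (map f (sorted_key_list_of_set f A))"
    using S.set_sorted_key_list_of_set[OF subset_refl assms(1)] S.strict_sorted_key_list_of_set[OF subset_refl] by auto
qed

end

section \<open>Endpoints in crossingless matchings\<close>

lemma crossingless_arc:
  assumes "crossingless_matching n A" "(i, j) \<in> A"
  shows "1 \<le> i" "i < j" "j \<le> 2 * n"
  using assms unfolding crossingless_matching_def by auto

lemma crossingless_finite: "crossingless_matching n A \<Longrightarrow> finite A"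
proof -
  assume "crossingless_matching n A"
  then have "A \<subseteq> {1..2*n} \<times> {1..2*n}" using crossingless_arc by fastforce
  then show ?thesis by (rule finite_subset) simp
qed

lemma crossingless_covered:
  assumes "crossingless_matching n A" "1 \<le> p" "p \<le> 2 * n"
  shows "p \<in> fst ` A \<union> snd ` A"
proof -
  have "p \<in> {1..2 * n}" using assms by simp
  moreover have "\<forall>p\<in>{1..2 * n}. \<exists>!x. x \<in> A \<and> (p = fst x \<or> p = snd x)"
    using assms(1) unfolding crossingless_matching_def by (elim conjE)
  ultimately obtain x where "x \<in> A" "p = fst x \<or> p = snd x" by blast
  then show ?thesis by blast
qed

lemma crossingless_unique:
  assumes "crossingless_matching n A" "(i, j) \<in> A" "(i', j') \<in> A" "{i, j} \<inter> {i', j'} \<noteq> {}"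
  shows "i = i'" "j = j'"
proof -
  from assms(4) obtain p where p: "p \<in> {i, j}" "p \<in> {i', j'}" by blast
  then have "p \<in> {1..2 * n}" using crossingless_arc[OF assms(1,2)] by (elim insertE emptyE) simp_all
  moreover have "\<forall>p\<in>{1..2 * n}. \<exists>!x. x \<in> A \<and> (p = fst x \<or> p = snd x)"
    using assms(1) unfolding crossingless_matching_def by (elim conjE)
  ultimately have "\<exists>!x. x \<in> A \<and> (p = fst x \<or> p = snd x)" by (rule bspec[rotated])
  moreover have "(i, j) \<in> A \<and> (p = fst (i, j) \<or> p = snd (i, j))"
    using assms(2) p(1) by simp
  moreover have "(i', j') \<in> A \<and> (p = fst (i', j') \<or> p = snd (i', j'))"
    using assms(3) p(2) by simp
  ultimately have "(i, j) = (i', j')" by metis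
  then show "i = i'" "j = j'" by simp_all
qed

lemma crossingless_no_crossing:
  "crossingless_matching n A \<Longrightarrow> (i, j) \<in> A \<Longrightarrow> (i', j') \<in> A \<Longrightarrow> i < i' \<Longrightarrow> i' < j \<Longrightarrow> j' \<le> j"
  unfolding crossingless_matching_def by (meson not_le)

lemma crossingless_left_right:
  assumes "crossingless_matching n A" "(i, j) \<in> A" "(i', j') \<in> A"
  shows "i \<noteq> j'"
  using crossingless_unique[OF assms] crossingless_arc[OF assms(1,2)] crossingless_arc[OF assms(1,3)] by auto

text \<open>Arcs with both ends in \<open>I\<close> contribute equally on both sides, and no arc
  starts in \<open>I\<close> and leaves it.\<close>

lemma card_endpoints_diff:
  assumes "finite V" "inj_on fst V" "inj_on snd V" "\<And>x. x \<in> V \<Longrightarrow> fst x \<in> I \<Longrightarrow> snd x \<in> I"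
  shows "card (snd ` V \<inter> I) = card (fst ` V \<inter> I) + card {x\<in>V. snd x \<in> I \<and> fst x \<notin> I}"
proof -
  have "snd ` V \<inter> I = snd ` {x\<in>V. snd x \<in> I}" "fst ` V \<inter> I = fst ` {x\<in>V. fst x \<in> I}" by auto
  moreover have "inj_on snd {x\<in>V. snd x \<in> I}" "inj_on fst {x\<in>V. fst x \<in> I}"
    using assms(2,3) by (auto intro: inj_on_subset)
  ultimately have "card (snd ` V \<inter> I) = card {x\<in>V. snd x \<in> I}" "card (fst ` V \<inter> I) = card {x\<in>V. fst x \<in> I}"
    by (simp_all add: card_image)
  moreover have "{x\<in>V. snd x \<in> I} = {x\<in>V. fst x \<in> I} \<union> {x\<in>V. snd x \<in> I \<and> fst x \<notin> I}"
    using assms(4) by auto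
  moreover have "card ({x\<in>V. fst x \<in> I} \<union> {x\<in>V. snd x \<in> I \<and> fst x \<notin> I})
      = card {x\<in>V. fst x \<in> I} + card {x\<in>V. snd x \<in> I \<and> fst x \<notin> I}"
    using assms(1) by (intro card_Un_disjoint) auto
  ultimately show ?thesis by simp
qed

lemma potential_diff:
  assumes "r \<le> s"
  shows "potential K s - potential K r = int (s - r) - 2 * int (card (K \<inter> {r<..s}))"
proof -
  have "K \<inter> {..s} = K \<inter> {..r} \<union> K \<inter> {r<..s}" using assms by auto
  moreover have "card (K \<inter> {..r} \<union> K \<inter> {r<..s}) = card (K \<inter> {..r}) + card (K \<inter> {r<..s})"
    by (rule card_Un_disjoint) auto
  ultimately show ?thesis using assms by (simp add: potential_def)
qed

text \<open>The situation common to the two relations: \<open>E\<close> and \<open>F\<close> are the arcs and the dotted arcs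
  away from \<open>a, b, c, d\<close>, and both ways of joining these four points are crossingless.\<close>
locale russell_context =
  fixes n :: nat and E F :: "arc set" and a b c d :: nat
  assumes order: "a < b" "b < c" "c < d" and FE: "F \<subseteq> E"
    and nested: "crossingless_matching n (E \<union> {(a, d), (b, c)})"
    and unnested: "crossingless_matching n (E \<union> {(a, b), (c, d)})"
begin

lemma E_arc: "(l, p) \<in> E \<Longrightarrow> 1 \<le> l \<and> l < p \<and> p \<le> 2 * n"
  using crossingless_arc[OF nested, of l p] by auto

lemma E_finite: "finite E" using crossingless_finite[OF nested] by simp
lemma F_finite: "finite F" using E_finite FE by (rule finite_subset[rotated])

lemma bounds: "1 \<le> a" "d \<le> 2 * n"
  using crossingless_arc[OF nested, of a d] by auto

text \<open>An arc of \<open>E\<close> through one of the four points would have to be an arc of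
  both pairings, and these have no arc in common.\<close>

lemma E_points: assumes "(l, p) \<in> E" shows "l \<notin> {a, b, c, d}" "p \<notin> {a, b, c, d}"
proof -
  have "{l, p} \<inter> {a, b, c, d} = {}"
  proof (rule ccontr)
    assume ne: "{l, p} \<inter> {a, b, c, d} \<noteq> {}"
    have mem: "(l, p) \<in> E \<union> {(a, d), (b, c)}" "(l, p) \<in> E \<union> {(a, b), (c, d)}" using assms by auto
    from ne have "{l, p} \<inter> {a, d} \<noteq> {} \<or> {l, p} \<inter> {b, c} \<noteq> {}" by blast
    then have "(l = a \<and> p = d) \<or> (l = b \<and> p = c)"
      using crossingless_unique[OF nested mem(1), of a d] crossingless_unique[OF nested mem(1), of b c] by blast
    moreover from ne have "{l, p} \<inter> {a, b} \<noteq> {} \<or> {l, p} \<inter> {c, d} \<noteq> {}" by blast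
    then have "(l = a \<and> p = b) \<or> (l = c \<and> p = d)"
      using crossingless_unique[OF unnested mem(2), of a b] crossingless_unique[OF unnested mem(2), of c d] by blast
    ultimately show False using order by linarith
  qed
  then show "l \<notin> {a, b, c, d}" "p \<notin> {a, b, c, d}" by blast+
qed

lemma E_unique: "(l, p) \<in> E \<Longrightarrow> (l', p') \<in> E \<Longrightarrow> {l, p} \<inter> {l', p'} \<noteq> {} \<Longrightarrow> l = l' \<and> p = p'"
  using crossingless_unique[OF nested, of l p l' p'] by blast

lemma E_disjoint: "(l, p) \<in> E \<Longrightarrow> (l', p') \<in> E \<Longrightarrow> l \<noteq> p'"
  using crossingless_left_right[OF nested, of l p l' p'] by blast

lemma E_noncrossing:
  assumes "(l, p) \<in> E" "(l', p') \<in> E" "l < l'" "l' < p" shows "p' < p"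
proof -
  have "p' \<le> p" using crossingless_no_crossing[OF nested, of l p l' p'] assms by auto
  moreover have "p' \<noteq> p" using E_unique[OF assms(1,2)] assms(3) by auto
  ultimately show ?thesis by simp
qed

text \<open>One matching forbids crossing ad and bc, the other forbids crossing ab and cd; together
  they leave only these positions.\<close>

lemma E_regions:
  assumes E: "(l, p) \<in> E"
  shows "p < a \<or> a < l \<and> p < b \<or> b < l \<and> p < c \<or> c < l \<and> p < d \<or> d < l \<or> l < a \<and> d < p"
proof -
  have ad: "(a, d) \<in> E \<union> {(a, d), (b, c)}" and bc: "(b, c) \<in> E \<union> {(a, d), (b, c)}"
    and ab: "(a, b) \<in> E \<union> {(a, b), (c, d)}" and cd: "(c, d) \<in> E \<union> {(a, b), (c, d)}"
    and E1: "(l, p) \<in> E \<union> {(a, d), (b, c)}" and E2: "(l, p) \<in> E \<union> {(a, b), (c, d)}" using E by auto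
  note N = crossingless_no_crossing[OF nested] crossingless_no_crossing[OF unnested]
  have ne: "l \<noteq> a" "l \<noteq> b" "l \<noteq> c" "l \<noteq> d" "p \<noteq> a" "p \<noteq> b" "p \<noteq> c" "p \<noteq> d" using E_points[OF E] by auto
  consider "l < a" "p < a" | "l < a" "a < p" | "a < l" "l < b" | "b < l" "l < c" | "c < l" "l < d" | "d < l"
    using ne(1-5) by linarith
  then show ?thesis
  proof cases
    case 2
    then have "d < p" using N(1)[OF E1 ad] ne by simp
    then show ?thesis using 2 by simp
  next
    case 3
    then have "p < b" using N(2)[OF ab E2] ne by simp
    then show ?thesis using 3 by simp
  next
    case 4
    then have "p < c" using N(1)[OF bc E1] ne by simp
    then show ?thesis using 4 by simp
  next
    case 5
    then have "p < d" using N(2)[OF cd E2] ne by simp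
    then show ?thesis using 5 by simp
  qed simp_all
qed

lemma inj_fst: "V \<subseteq> E \<Longrightarrow> inj_on fst V"
proof (rule inj_onI)
  fix x y assume "V \<subseteq> E" "x \<in> V" "y \<in> V" and eq: "fst x = fst y"
  then have "x \<in> E" "y \<in> E" by blast+
  then have "(fst x, snd x) \<in> E" "(fst y, snd y) \<in> E" unfolding prod.collapse .
  from E_unique[OF this] eq show "x = y" by (simp add: prod_eq_iff)
qed

lemma inj_snd: "V \<subseteq> E \<Longrightarrow> inj_on snd V"
proof (rule inj_onI)
  fix x y assume "V \<subseteq> E" "x \<in> V" "y \<in> V" and eq: "snd x = snd y"
  then have "x \<in> E" "y \<in> E" by blast+
  then have "(fst x, snd x) \<in> E" "(fst y, snd y) \<in> E" unfolding prod.collapse .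
  from E_unique[OF this] eq show "x = y" by (simp add: prod_eq_iff)
qed

lemma interval_endpoints:
  assumes "I \<subseteq> {1..2 * n}" "I \<inter> {a, b, c, d} = {}"
  shows "card I = card (fst ` (E - F) \<inter> I) + card (snd ` (E - F) \<inter> I) + card (fst ` F \<inter> I) + card (snd ` F \<inter> I)"
proof -
  have finI: "finite I" using assms(1) by (rule finite_subset) simp
  have "I = (fst ` E \<inter> I) \<union> (snd ` E \<inter> I)"
  proof
    show "I \<subseteq> (fst ` E \<inter> I) \<union> (snd ` E \<inter> I)"
    proof
      fix p assume "p \<in> I"
      then have "p \<in> fst ` (E \<union> {(a, d), (b, c)}) \<union> snd ` (E \<union> {(a, d), (b, c)})"
        using crossingless_covered[OF nested, of p] assms(1) by auto
      then show "p \<in> (fst ` E \<inter> I) \<union> (snd ` E \<inter> I)" using \<open>p \<in> I\<close> assms(2) by auto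
    qed
  qed auto
  moreover have "(fst ` E \<inter> I) \<inter> (snd ` E \<inter> I) = {}" using E_disjoint by auto
  ultimately have 1: "card I = card (fst ` E \<inter> I) + card (snd ` E \<inter> I)"
    using finI by (metis card_Un_disjoint finite_Int)
  have 2: "card (f ` E \<inter> I) = card (f ` (E - F) \<inter> I) + card (f ` F \<inter> I)" if "inj_on f E" for f :: "arc \<Rightarrow> nat"
  proof -
    have "f ` E \<inter> I = (f ` (E - F) \<inter> I) \<union> (f ` F \<inter> I)" using FE by auto
    moreover have "(f ` (E - F) \<inter> I) \<inter> (f ` F \<inter> I) = {}" using that FE by (auto dest: inj_onD)
    ultimately show ?thesis using finI by (metis card_Un_disjoint finite_Int inf_commute)
  qed
  show ?thesis unfolding 1 using 2[OF inj_fst] 2[OF inj_snd] by simp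
qed

text \<open>No arc leaves the gap, so left and right ends of each kind are equally many in it, and
  the dotted ones cancel in the height.\<close>

lemma closed_interval_count:
  assumes "(r, s) = (b, c) \<or> (r, s) = (c, d)" "K \<inter> {r<..s} = fst ` F \<inter> {r<..<s}"
  shows "potential K s - potential K r = 2 * int (card (snd ` (E - F) \<inter> {r<..<s})) + 1"
proof -
  let ?I = "{r<..<s}"
  have "r < s" using assms(1) order by auto
  have closed: "fst x \<in> ?I \<longleftrightarrow> snd x \<in> ?I" if "x \<in> E" for x
  proof -
    have "fst x < snd x" using E_arc[of "fst x" "snd x"] that by simp
    with E_regions[of "fst x" "snd x"] assms(1) that order show ?thesis
      unfolding prod.inject prod.collapse by (elim disjE conjE) (simp_all, linarith+)
  qed
  have "card (snd ` V \<inter> ?I) = card (fst ` V \<inter> ?I)" if "V \<subseteq> E" for V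
  proof -
    have empty: "{x\<in>V. snd x \<in> ?I \<and> fst x \<notin> ?I} = {}" using closed that by blast
    have "snd x \<in> ?I" if "x \<in> V" "fst x \<in> ?I" for x using closed \<open>V \<subseteq> E\<close> that by blast
    from card_endpoints_diff[OF finite_subset[OF that E_finite] inj_fst[OF that] inj_snd[OF that] this]
    show ?thesis unfolding empty by simp
  qed
  from this[of "E - F"] this[OF FE]
  have "card (snd ` (E - F) \<inter> ?I) = card (fst ` (E - F) \<inter> ?I)" "card (snd ` F \<inter> ?I) = card (fst ` F \<inter> ?I)" by blast+
  then have "card ?I = 2 * card (snd ` (E - F) \<inter> ?I) + 2 * card (fst ` F \<inter> ?I)"
  proof -
    have "?I \<subseteq> {1..2 * n}" "?I \<inter> {a, b, c, d} = {}"
      using bounds order assms(1) by (auto simp: subset_iff)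
    from interval_endpoints[OF this] show ?thesis
      using \<open>card (snd ` (E - F) \<inter> ?I) = _\<close> \<open>card (snd ` F \<inter> ?I) = _\<close> by simp
  qed
  then show ?thesis using potential_diff[of r s K] \<open>r < s\<close> assms(2) by simp
qed

text \<open>The first choice of \<open>K\<close> is for Type I, the second for Type II, in all of
  whose diagrams the arc starting at \<open>a\<close> is dotted.\<close>

lemma arc_system:
  assumes "K = fst ` F \<or> K = insert a (fst ` F)"
  shows "arc_system K (E - F) a b c d (Suc (2 * n))"
proof
  have F: "K \<inter> {b, c, d} = {}"
    using assms order E_points FE by force
  then show "b \<notin> K" "c \<notin> K" "d \<notin> K" by auto
  show "1 \<le> a" "a < b" "b < c" "c < d" "d < Suc (2 * n)" using bounds order by auto
  have ivl: "K \<inter> {r<..s} = fst ` F \<inter> {r<..<s}" if "(r, s) = (b, c) \<or> (r, s) = (c, d)" for r s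
  proof -
    have "a < r" "s \<notin> K" using that F order by auto
    then have "K \<inter> {r<..s} = fst ` F \<inter> {r<..s}" "s \<notin> fst ` F" using assms by auto
    moreover have "{r<..s} = insert s {r<..<s}" using that order by auto
    ultimately show ?thesis by simp
  qed
  show "potential K c - potential K b = 2 * int (card (snd ` (E - F) \<inter> {b<..<c})) + 1"
    by (intro closed_interval_count ivl) auto
  show "potential K d - potential K c = 2 * int (card (snd ` (E - F) \<inter> {c<..<d})) + 1"
    by (intro closed_interval_count ivl) auto
next
  fix l p assume "(l, p) \<in> E - F"
  then have lp: "(l, p) \<in> E" "(l, p) \<notin> F" by auto
  show "l < p" using E_arc[OF lp(1)] by simp
  show pt: "l \<notin> {a, b, c, d}" "p \<notin> {a, b, c, d}" by (rule E_points[OF lp(1)])+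
  show "p < a \<or> a < l \<and> p < b \<or> b < l \<and> p < c \<or> c < l \<and> p < d \<or> d < l \<or> l < a \<and> d < p"
    by (rule E_regions[OF lp(1)])
  show "l \<notin> K"
  proof
    assume "l \<in> K"
    then have "l \<in> fst ` F" using assms pt(1) by auto
    then obtain p' where "(l, p') \<in> F" by auto
    moreover from this have "p = p'" using E_unique[OF lp(1), of l p'] FE by blast
    ultimately show False using lp(2) by simp
  qed
  show "p \<notin> K"
  proof
    assume "p \<in> K"
    then have "p \<in> fst ` F" using assms pt(2) by auto
    then obtain p' where "(p, p') \<in> F" by auto
    then show False using E_disjoint[of p p', OF _ lp(1)] FE by blast
  qed
next
  fix l p l' p' assume "(l, p) \<in> E - F" "(l', p') \<in> E - F"
  then have e: "(l, p) \<in> E" "(l', p') \<in> E" by auto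
  show "l \<noteq> p'" by (rule E_disjoint[OF e])
  show "l < l' \<Longrightarrow> l' < p \<Longrightarrow> p' < p" by (rule E_noncrossing[OF e])
next
  fix l p p' assume "(l, p) \<in> E - F" "(l, p') \<in> E - F"
  then show "p = p'" using E_unique[of l p l p'] by auto
next
  fix l l' p assume "(l, p) \<in> E - F" "(l', p) \<in> E - F"
  then show "l = l'" using E_unique[of l p l' p] by auto
qed

definition "encl = {(e, e') \<in> E - F. e < a \<and> d < e'}"

lemma encl_inj: "inj_on snd encl"
  by (rule inj_snd) (auto simp: encl_def)

lemma encl_list:
  "set (undotted_enclosing E F a d) = encl" "sorted_wrt (<) (map snd (undotted_enclosing E F a d))"
proof -
  have "encl \<subseteq> E" by (auto simp: encl_def)
  then have fin: "finite encl" using E_finite by (rule finite_subset)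
  show "set (undotted_enclosing E F a d) = encl" "sorted_wrt (<) (map snd (undotted_enclosing E F a d))"
    using strict_sorted_key_list_of_inj[OF fin encl_inj] unfolding undotted_enclosing_def encl_def[symmetric] .
qed

text \<open>Between \<open>d\<close> and \<open>i\<close>, right ends exceed left ends by the arcs
  that started before \<open>a\<close>: among undotted arcs these are the enclosing ones inside
  \<open>(s, i)\<close>, among dotted ones those counted by n_i. Substituting both counts into the
  height leaves exactly this difference.\<close>

lemma encl_exponent:
  assumes x: "(s, i) \<in> encl" and KF: "K = fst ` F \<or> K = insert a (fst ` F)"
  shows "arc_system.enc_exp K (E - F) a d i
    = int (card {x'\<in>encl. snd x' < i}) - int (dotted_between F a d (s, i))"
proof -
  interpret arc_system K "E - F" a b c d "Suc (2 * n)" by (rule arc_system[OF KF])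
  let ?I = "{d<..<i}"
  have si: "(s, i) \<in> E" "(s, i) \<notin> F" "s < a" "d < i" using x by (auto simp: encl_def)
  have arc: "(fst x', snd x') \<in> E" "fst x' < snd x'" if "x' \<in> E" for x'
    using E_arc[of "fst x'" "snd x'"] that by simp_all
  have closed: "snd x' \<in> ?I" if "x' \<in> E" "fst x' \<in> ?I" for x'
  proof -
    have "s < fst x'" "fst x' < i" "d < fst x'" using that(2) si order by simp_all
    then show ?thesis using E_noncrossing[OF si(1) arc(1)[OF that(1)]] arc(2)[OF that(1)] by simp
  qed
  have outer: "(snd x' \<in> ?I \<and> fst x' \<notin> ?I) = (fst x' < a \<and> d < snd x' \<and> snd x' < i)" if "x' \<in> E" for x'
    using E_regions[OF arc(1)[OF that]] arc(2)[OF that] order by (elim disjE conjE) simp_all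
  have inside: "s < fst x'" if "x' \<in> E" "fst x' < a" "d < snd x'" "snd x' < i" for x'
  proof (rule ccontr)
    assume "\<not> s < fst x'"
    then have "fst x' < s \<or> fst x' = s" by auto
    then show False
    proof
      assume "fst x' < s"
      then show False using E_noncrossing[OF arc(1)[OF that(1)] si(1)] that si order by simp
    next
      assume "fst x' = s"
      then have "snd x' = i" using E_unique[OF arc(1)[OF that(1)] si(1)] by blast
      then show False using that(4) by simp
    qed
  qed
  have U: "card (snd ` (E - F) \<inter> ?I) = card (fst ` (E - F) \<inter> ?I) + card {x'\<in>encl. snd x' < i}"
  proof -
    have "{x'\<in>E - F. snd x' \<in> ?I \<and> fst x' \<notin> ?I} = {x'\<in>E - F. fst x' < a \<and> d < snd x' \<and> snd x' < i}"
      using outer by blast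
    also have "\<dots> = {x'\<in>encl. snd x' < i}" by (auto simp: encl_def)
    finally have eq: "{x'\<in>E - F. snd x' \<in> ?I \<and> fst x' \<notin> ?I} = {x'\<in>encl. snd x' < i}" .
    have "card (snd ` (E - F) \<inter> ?I) = card (fst ` (E - F) \<inter> ?I) + card {x'\<in>E - F. snd x' \<in> ?I \<and> fst x' \<notin> ?I}"
      by (rule card_endpoints_diff) (use E_finite inj_fst[of "E - F"] inj_snd[of "E - F"] closed in blast)+
    then show ?thesis unfolding eq .
  qed
  have F: "card (snd ` F \<inter> ?I) = card (fst ` F \<inter> ?I) + dotted_between F a d (s, i)"
  proof -
    have "{x'\<in>F. snd x' \<in> ?I \<and> fst x' \<notin> ?I} = {x'\<in>F. fst x' < a \<and> d < snd x' \<and> snd x' < i}"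
      using outer FE by blast
    also have "\<dots> = {x'\<in>F. s < fst x' \<and> fst x' < a \<and> d < snd x' \<and> snd x' < i}"
      using inside FE by blast
    also have "card \<dots> = dotted_between F a d (s, i)"
      unfolding dotted_between_def by (rule arg_cong[of _ _ card]) auto
    finally have eq: "card {x'\<in>F. snd x' \<in> ?I \<and> fst x' \<notin> ?I} = dotted_between F a d (s, i)" .
    have "card (snd ` F \<inter> ?I) = card (fst ` F \<inter> ?I) + card {x'\<in>F. snd x' \<in> ?I \<and> fst x' \<notin> ?I}"
      by (rule card_endpoints_diff) (use F_finite inj_fst[OF FE] inj_snd[OF FE] closed FE in blast)+
    then show ?thesis unfolding eq .
  qed
  have "{r \<in> enc \<union> dis. r < i} = snd ` (E - F) \<inter> ?I"
  proof
    show "{r \<in> enc \<union> dis. r < i} \<subseteq> snd ` (E - F) \<inter> ?I"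
    proof
      fix r assume "r \<in> {r \<in> enc \<union> dis. r < i}"
      then have r: "r \<in> enc \<union> dis" "r < i" by auto
      then have "(lf r, r) \<in> E - F \<and> d < r"
        using enc_lf(1,3)[of r] dis_lf[of r] by (elim UnE) simp_all
      then show "r \<in> snd ` (E - F) \<inter> ?I" using r image_eqI[of r snd "(lf r, r)"] by simp
    qed
    show "snd ` (E - F) \<inter> ?I \<subseteq> {r \<in> enc \<union> dis. r < i}"
    proof
      fix r assume "r \<in> snd ` (E - F) \<inter> ?I"
      then obtain l where "(l, r) \<in> E - F" and r: "d < r" "r < i" by auto
      from r(1) show "r \<in> {r \<in> enc \<union> dis. r < i}"
        by (cases rule: right_end_cases) (use r \<open>(l, r) \<in> E - F\<close> in blast)+
    qed
  qed
  then have num: "card {r \<in> enc \<union> dis. r < i} = card (snd ` (E - F) \<inter> ?I)" by simp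
  have "K \<inter> {d<..i} = fst ` F \<inter> ?I"
  proof -
    have "i \<notin> K" using arcs(3) si by blast
    moreover have "a < d" using order by simp
    ultimately have "K \<inter> {d<..i} = fst ` F \<inter> {d<..i}" "i \<notin> fst ` F" using KF by auto
    moreover have "{d<..i} = insert i ?I" using si by auto
    ultimately show ?thesis by simp
  qed
  then have "potential K i - potential K d = int (i - d) - 2 * int (card (fst ` F \<inter> ?I))"
    using potential_diff[of d i K] si by simp
  moreover have "int (i - d) - 1 = int (card ?I)" using si by simp
  moreover have "card ?I = card (fst ` (E - F) \<inter> ?I) + card (snd ` (E - F) \<inter> ?I) + card (fst ` F \<inter> ?I) + card (snd ` F \<inter> ?I)"
    using bounds E_arc[OF si(1)] order by (intro interval_endpoints) auto
  ultimately show ?thesis unfolding enc_exp_def num using U F by linarith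
qed

text \<open>The function \<open>h\<close> leaves the use of the exponent open, so that the statement
  covers both types, whose exponents differ by 1.\<close>

lemma encl_sum:
  fixes h :: "arc \<Rightarrow> int \<Rightarrow> 'b::comm_monoid_add"
  assumes KF: "K = fst ` F \<or> K = insert a (fst ` F)"
  defines "xs \<equiv> undotted_enclosing E F a d"
  shows "(\<Sum>i = 1..length xs. h (xs ! (i - 1)) (int i - int (dotted_between F a d (xs ! (i - 1)))))
    = (\<Sum>i\<in>arc_system.enc (E - F) a d \<inter> {..<Suc (2 * n)}. h (arc_system.lf (E - F) i, i) (arc_system.enc_exp K (E - F) a d i + 1))"
proof -
  interpret arc_system K "E - F" a b c d "Suc (2 * n)" by (rule arc_system[OF KF])
  have "(\<Sum>i = 1..length xs. h (xs ! (i - 1)) (int i - int (dotted_between F a d (xs ! (i - 1)))))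
      = (\<Sum>x\<in>encl. h x (int (Suc (card {x'\<in>encl. snd x' < snd x})) - int (dotted_between F a d x)))"
    using sum_over_sorted_list[OF encl_list(2), of "\<lambda>x i. h x (int i - int (dotted_between F a d x))"]
    unfolding xs_def encl_list(1) .
  also have "\<dots> = (\<Sum>x\<in>encl. h x (enc_exp (snd x) + 1))"
  proof (rule sum.cong)
    fix x assume "x \<in> encl"
    then have "(fst x, snd x) \<in> encl" by simp
    from encl_exponent[OF this KF]
    have "int (Suc (card {x'\<in>encl. snd x' < snd x})) - int (dotted_between F a d x) = enc_exp (snd x) + 1" by simp
    then show "h x (int (Suc (card {x'\<in>encl. snd x' < snd x})) - int (dotted_between F a d x)) = h x (enc_exp (snd x) + 1)"
      by (rule arg_cong)
  qed simp
  also have "\<dots> = (\<Sum>i\<in>enc \<inter> {..<Suc (2 * n)}. h (lf i, i) (enc_exp i + 1))"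
  proof (rule sum.reindex_bij_witness[of _ "\<lambda>i. (lf i, i)" snd])
    fix x assume x: "x \<in> encl"
    then obtain l p where lp: "x = (l, p)" "(l, p) \<in> E - F" "l < a" "d < p" by (auto simp: encl_def)
    show "(lf (snd x), snd x) = x" using lf[OF lp(2)] lp by simp
    show "snd x \<in> enc \<inter> {..<Suc (2 * n)}" using lp E_arc[of l p] by (auto simp: enc_def)
    show "h (lf (snd x), snd x) (enc_exp (snd x) + 1) = h x (enc_exp (snd x) + 1)" using lf[OF lp(2)] lp by simp
  next
    fix i assume "i \<in> enc \<inter> {..<Suc (2 * n)}"
    then show "(lf i, i) \<in> encl" using enc_lf by (auto simp: encl_def)
  qed simp
  finally show ?thesis .
qed

end

section \<open>The map on diagrams and its vanishing on relators\<close>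

definition vac_value :: "laurent qop \<Rightarrow> nat set \<Rightarrow> laurent" where
  "vac_value U = apply_op U (\<lambda>S. if S = {} then 1 else 0)"

lemma vac_value_simps:
  "vac_value 0 S = 0" "vac_value (U + V) S = vac_value U S + vac_value V S" "vac_value (c \<cdot> U) S = c * vac_value U S"
  by (simp_all add: vac_value_def zero_qop.rep_eq plus_qop.rep_eq scale.rep_eq)

lemma vac_value_sum: "vac_value (\<Sum>i\<in>I. U i) S = (\<Sum>i\<in>I. vac_value (U i) S)"
  by (induction I rule: infinite_finite_induct) (simp_all add: vac_value_simps)

text \<open>Applying the product to the indicator of the empty set turns an operator into a family
  of scalars, as the rank criterion requires.\<close>

definition phi :: "nat \<Rightarrow> diagram \<Rightarrow> nat set \<Rightarrow> laurent" where
  "phi n = (\<lambda>(A, D). vac_value (prodl (fac (fst ` D) (A - D)) 1 (Suc (2 * n))))"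

lemma phi_dgm:
  assumes "V \<inter> F = {}" "V \<inter> D = {}"
  shows "phi n (dgm E F V D) = vac_value (prodl (fac (fst ` (F \<union> D)) (E - F - D \<union> V)) 1 (Suc (2 * n)))"
proof -
  have "E \<union> V \<union> D - (F \<union> D) = E - F - D \<union> V" using assms by auto
  then show ?thesis by (simp add: phi_def dgm_def)
qed

context russell_context begin

lemma not_in_E: "(a, b) \<notin> E" "(a, d) \<notin> E" "(b, c) \<notin> E" "(c, d) \<notin> E"
  using E_points(1) by blast+

lemma not_in_F: "(a, b) \<notin> F" "(a, d) \<notin> F" "(b, c) \<notin> F" "(c, d) \<notin> F"
  using not_in_E FE by blast+

lemma encl_nth:
  assumes "i \<in> {1..length (undotted_enclosing E F a d)}"
  shows "undotted_enclosing E F a d ! (i - 1) \<in> encl"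
proof -
  have "i - 1 < length (undotted_enclosing E F a d)" using assms unfolding atLeastAtMost_iff by linarith
  from nth_mem[OF this] show ?thesis by (simp only: encl_list(1))
qed

definition typeI_relator where
  "typeI_relator = Poly_Mapping.single (dgm E F {(c, d)} {(a, b)}) 1
    + Poly_Mapping.single (dgm E F {(a, b)} {(c, d)}) 1
    + Poly_Mapping.single (dgm E F {(b, c)} {(a, d)}) (q_pow (-1))
    + (\<Sum>i = 1..length (undotted_enclosing E F a d).
        Poly_Mapping.single (dgm E F {(a, b), (c, d)} {undotted_enclosing E F a d ! (i - 1)})
          ((1 - q_pow (-2)) * q_pow (int i - int (dotted_between F a d (undotted_enclosing E F a d ! (i - 1))))))"

text \<open>Only the sum gets a name, because the reduction reads Type II backwards, from the nested
  to the unnested diagram.\<close>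

definition typeII_tail where
  "typeII_tail = (\<Sum>i = 1..length (undotted_enclosing E F a d).
      Poly_Mapping.single (dgm E F {(b, c)} {(a, d), undotted_enclosing E F a d ! (i - 1)})
        ((1 - q_pow (-2)) * q_pow (int i - 1 - int (dotted_between F a d (undotted_enclosing E F a d ! (i - 1))))))"

lemma phi_typeI:
  "linear_ext (phi n) (Poly_Mapping.single (dgm E F {(a, d)} {(b, c)}) 1 - typeI_relator) S = 0"
proof -
  let ?K = "fst ` F" and ?U = "E - F" and ?m = "Suc (2 * n)"
  interpret arc_system ?K ?U a b c d ?m by (rule arc_system) simp
  have aK: "a \<notin> ?K" using E_points(1) FE by force
  have 1: "phi n (dgm E F {(a, d)} {(b, c)}) = vac_value (prodl (fac (insert b ?K) (insert (a, d) ?U)) 1 ?m)"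
    using order not_in_E not_in_F by (subst phi_dgm) auto
  have 2: "phi n (dgm E F {(c, d)} {(a, b)}) = vac_value (prodl (fac (insert a ?K) (insert (c, d) ?U)) 1 ?m)"
    using order not_in_E not_in_F by (subst phi_dgm) auto
  have 3: "phi n (dgm E F {(a, b)} {(c, d)}) = vac_value (prodl (fac (insert c ?K) (insert (a, b) ?U)) 1 ?m)"
    using order not_in_E not_in_F by (subst phi_dgm) auto
  have 4: "phi n (dgm E F {(b, c)} {(a, d)}) = vac_value (prodl (fac (insert a ?K) (insert (b, c) ?U)) 1 ?m)"
    using order not_in_E not_in_F by (subst phi_dgm) auto
  have 5: "phi n (dgm E F {(a, b), (c, d)} {x})
      = vac_value (prodl (fac (insert (fst x) ?K) (insert (a, b) (insert (c, d) (?U - {x})))) 1 ?m)" if "x \<in> E" for x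
    using order not_in_E not_in_F that by (subst phi_dgm) auto
  have "(\<Sum>i = 1..length (undotted_enclosing E F a d). (1 - q_pow (-2)) * q_pow (int i - int (dotted_between F a d (undotted_enclosing E F a d ! (i - 1))))
        * phi n (dgm E F {(a, b), (c, d)} {undotted_enclosing E F a d ! (i - 1)}) S)
      = (\<Sum>i\<in>enc \<inter> {..<?m}. (1 - q_pow (-2)) * q_pow (enc_exp i + 1) * phi n (dgm E F {(a, b), (c, d)} {(lf i, i)}) S)"
    using encl_sum[of ?K "\<lambda>x e. (1 - q_pow (-2)) * q_pow e * phi n (dgm E F {(a, b), (c, d)} {x}) S"]
    by simp
  also have "\<dots> = (\<Sum>i\<in>enc \<inter> {..<?m}. vac_value (((1 - q_pow (-2)) * q_pow (enc_exp i + 1))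
        \<cdot> prodl (fac (insert (lf i) ?K) (insert (a, b) (insert (c, d) (?U - {(lf i, i)})))) 1 ?m) S)"
    using enc_lf(1) by (intro sum.cong) (auto simp: 5 vac_value_simps)
  finally show ?thesis
    unfolding typeI_relator_def linear_ext_diff linear_ext_add linear_ext_sum linear_ext_single 1 2 3 4 typeI_relation[OF aK]
    by (simp only: vac_value_simps vac_value_sum) simp
qed

lemma phi_typeII:
  "linear_ext (phi n) (Poly_Mapping.single (dgm E F {} {(a, b), (c, d)}) 1
    - (Poly_Mapping.single (dgm E F {} {(a, d), (b, c)}) 1 + typeII_tail)) S = 0"
proof -
  let ?K = "insert a (fst ` F)" and ?U = "E - F" and ?m = "Suc (2 * n)"
  interpret arc_system ?K ?U a b c d ?m by (rule arc_system) simp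
  have 1: "phi n (dgm E F {} {(a, b), (c, d)}) = vac_value (prodl (fac (insert c ?K) ?U) 1 ?m)"
    using order not_in_E not_in_F by (subst phi_dgm) (auto simp: insert_commute)
  have 2: "phi n (dgm E F {} {(a, d), (b, c)}) = vac_value (prodl (fac (insert b ?K) ?U) 1 ?m)"
    using order not_in_E not_in_F by (subst phi_dgm) (auto simp: insert_commute)
  have 5: "phi n (dgm E F {(b, c)} {(a, d), x})
      = vac_value (prodl (fac (insert (fst x) ?K) (insert (b, c) (?U - {x}))) 1 ?m)" if "x \<in> E" for x
  proof -
    have "E - F - {(a, d), x} \<union> {(b, c)} = insert (b, c) (?U - {x})" "x \<noteq> (b, c)" using not_in_E that by auto
    moreover have "fst ` (F \<union> {(a, d), x}) = insert (fst x) ?K" by auto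
    ultimately show ?thesis using order not_in_F by (subst phi_dgm) auto
  qed
  \<comment> \<open>The shift by 1 in the function passed to \<open>encl_sum\<close> turns
    \<open>enc_exp i + 1\<close> into the exponent of Type II.\<close>
  have "(\<Sum>i = 1..length (undotted_enclosing E F a d). (1 - q_pow (-2)) * q_pow (int i - 1 - int (dotted_between F a d (undotted_enclosing E F a d ! (i - 1))))
        * phi n (dgm E F {(b, c)} {(a, d), undotted_enclosing E F a d ! (i - 1)}) S)
      = (\<Sum>i\<in>enc \<inter> {..<?m}. (1 - q_pow (-2)) * q_pow (enc_exp i) * phi n (dgm E F {(b, c)} {(a, d), (lf i, i)}) S)"
    using encl_sum[of ?K "\<lambda>x e. (1 - q_pow (-2)) * q_pow (e - 1) * phi n (dgm E F {(b, c)} {(a, d), x}) S"]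
    by (simp add: algebra_simps)
  also have "\<dots> = (\<Sum>i\<in>enc \<inter> {..<?m}. vac_value (((1 - q_pow (-2)) * q_pow (enc_exp i))
        \<cdot> prodl (fac (insert (lf i) ?K) (insert (b, c) (?U - {(lf i, i)}))) 1 ?m) S)"
    using enc_lf(1) by (intro sum.cong) (auto simp: 5 vac_value_simps)
  finally show ?thesis
    unfolding typeII_tail_def linear_ext_diff linear_ext_add linear_ext_sum linear_ext_single 1 2 typeII_relation
    by (simp only: vac_value_simps vac_value_sum) simp
qed

end

lemma russell_context_I:
  assumes "a < b" "b < c" "c < d" "F \<subseteq> E" "dgm E F {(a, d)} {(b, c)} \<in> diagrams n k" "dgm E F {(c, d)} {(a, b)} \<in> diagrams n k"
  shows "russell_context n E F a b c d" "Suc (card F) = k"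
proof -
  have eq: "E \<union> {(a, d)} \<union> {(b, c)} = E \<union> {(a, d), (b, c)}" "E \<union> {(c, d)} \<union> {(a, b)} = E \<union> {(a, b), (c, d)}" by auto
  have "crossingless_matching n (E \<union> {(a, d), (b, c)})" "crossingless_matching n (E \<union> {(a, b), (c, d)})"
    and card: "card (F \<union> {(b, c)}) = k"
    using assms(5,6) unfolding diagrams_def dgm_def eq by simp_all
  then show ctx: "russell_context n E F a b c d" using assms by unfold_locales
  show "Suc (card F) = k"
    using card russell_context.not_in_F[OF ctx] russell_context.F_finite[OF ctx] by simp
qed

lemma russell_context_II:
  assumes "a < b" "b < c" "c < d" "F \<subseteq> E" "dgm E F {} {(a, b), (c, d)} \<in> diagrams n k" "dgm E F {} {(a, d), (b, c)} \<in> diagrams n k"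
  shows "russell_context n E F a b c d" "card F + 2 = k"
proof -
  have "crossingless_matching n (E \<union> {(a, d), (b, c)})" "crossingless_matching n (E \<union> {(a, b), (c, d)})"
    and card: "card (F \<union> {(a, b), (c, d)}) = k"
    using assms(5,6) unfolding diagrams_def dgm_def by simp_all
  then show ctx: "russell_context n E F a b c d" using assms by unfold_locales
  have "(a, b) \<noteq> (c, d)" using assms(1-3) by simp
  then show "card F + 2 = k"
    using card russell_context.not_in_F[OF ctx] russell_context.F_finite[OF ctx] by simp
qed

lemma type_I_E:
  assumes "f \<in> type_I n k"
  obtains E F a b c d where "russell_context n E F a b c d" "Suc (card F) = k"
    "f = Poly_Mapping.single (dgm E F {(a, d)} {(b, c)}) 1 - russell_context.typeI_relator E F a b c d"
proof -
  obtain E F a b c d where *: "a < b" "b < c" "c < d" "F \<subseteq> E" "dgm E F {(a, d)} {(b, c)} \<in> diagrams n k"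
      "dgm E F {(c, d)} {(a, b)} \<in> diagrams n k"
    and f: "f = Poly_Mapping.single (dgm E F {(a, d)} {(b, c)}) 1
        - (Poly_Mapping.single (dgm E F {(c, d)} {(a, b)}) 1
           + Poly_Mapping.single (dgm E F {(a, b)} {(c, d)}) 1
           + Poly_Mapping.single (dgm E F {(b, c)} {(a, d)}) (q_pow (-1))
           + (\<Sum>i = 1..length (undotted_enclosing E F a d).
                Poly_Mapping.single (dgm E F {(a, b), (c, d)} {undotted_enclosing E F a d ! (i - 1)})
                  ((1 - q_pow (-2)) * q_pow (int i - int (dotted_between F a d (undotted_enclosing E F a d ! (i - 1)))))))"
    using assms unfolding type_I_def by blast
  note ctx = russell_context_I[OF *]
  show ?thesis
    by (rule that[OF ctx]) (simp only: f russell_context.typeI_relator_def[OF ctx(1)])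
qed

lemma type_II_E:
  assumes "f \<in> type_II n k"
  obtains E F a b c d where "russell_context n E F a b c d" "card F + 2 = k"
    "f = Poly_Mapping.single (dgm E F {} {(a, b), (c, d)}) 1
      - (Poly_Mapping.single (dgm E F {} {(a, d), (b, c)}) 1 + russell_context.typeII_tail E F a b c d)"
proof -
  obtain E F a b c d where *: "a < b" "b < c" "c < d" "F \<subseteq> E" "dgm E F {} {(a, b), (c, d)} \<in> diagrams n k"
      "dgm E F {} {(a, d), (b, c)} \<in> diagrams n k"
    and f: "f = Poly_Mapping.single (dgm E F {} {(a, b), (c, d)}) 1
        - (Poly_Mapping.single (dgm E F {} {(a, d), (b, c)}) 1
           + (\<Sum>i = 1..length (undotted_enclosing E F a d).
                Poly_Mapping.single (dgm E F {(b, c)} {(a, d), undotted_enclosing E F a d ! (i - 1)})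
                  ((1 - q_pow (-2)) * q_pow (int i - 1 - int (dotted_between F a d (undotted_enclosing E F a d ! (i - 1)))))))"
    using assms unfolding type_II_def by blast
  note ctx = russell_context_II[OF *]
  show ?thesis
    by (rule that[OF ctx]) (simp only: f russell_context.typeII_tail_def[OF ctx(1)])
qed

lemma phi_kills:
  assumes "f \<in> type_I n k \<union> type_II n k"
  shows "linear_ext (phi n) f S = 0"
  using assms
proof
  assume "f \<in> type_I n k"
  then show ?thesis by (rule type_I_E) (simp only: russell_context.phi_typeI)
next
  assume "f \<in> type_II n k"
  then show ?thesis by (rule type_II_E) (simp only: russell_context.phi_typeII)
qed

section \<open>Leading terms, ballot sets and cup diagrams\<close>

lemma apply_op_lin_support:
  assumes "V \<in> lin t I" "apply_op V v S \<noteq> 0"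
  shows "\<exists>i\<in>I. i \<in> S \<and> v (S - {i}) \<noteq> 0"
  using assms
proof (induction arbitrary: S rule: lin.induct)
  case (lin_gen i)
  then show ?case by (auto simp: gen.rep_eq split: if_splits)
next
  case (lin_add U V)
  then have "apply_op U v S \<noteq> 0 \<or> apply_op V v S \<noteq> 0" by (auto simp: plus_qop.rep_eq)
  then show ?case using lin_add.IH by blast
next
  case (lin_scale U c)
  then have "apply_op U v S \<noteq> 0" by (auto simp: scale.rep_eq)
  then show ?case using lin_scale.IH by blast
qed (simp add: zero_qop.rep_eq)

text \<open>Sets are compared by the sum of their elements, which drops strictly when an index is
  replaced by a smaller one. Finiteness is demanded because sums over infinite sets are 0 by
  convention.\<close>

definition leads :: "(nat set \<Rightarrow> 'a::zero) \<Rightarrow> nat set \<Rightarrow> bool" where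
  "leads v S\<^sub>0 \<longleftrightarrow> v S\<^sub>0 \<noteq> 0 \<and> finite S\<^sub>0 \<and> (\<forall>S. v S \<noteq> 0 \<longrightarrow> S \<noteq> S\<^sub>0 \<longrightarrow> finite S \<and> \<Sum>S < \<Sum>S\<^sub>0)"

text \<open>A generator from \<open>V\<close> adds less than \<open>d\<close> to the sum, so no
  contribution of \<open>V\<close> reaches \<open>insert d S\<^sub>0\<close>, and nothing can cancel
  the new leading coefficient.\<close>

lemma leads_step:
  fixes c t :: "'r::idom"
  assumes v: "leads v S\<^sub>0" and d: "d \<notin> S\<^sub>0" and c: "c \<noteq> 0" and t: "t \<noteq> 0" and V: "V \<in> lin t {..<d}"
  shows "leads (apply_op (c \<cdot> gen t d + V) v) (insert d S\<^sub>0)"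
proof -
  let ?w = "apply_op (c \<cdot> gen t d + V) v"
  have w: "?w S = c * apply_op (gen t d) v S + apply_op V v S" for S
    by (simp add: plus_qop.rep_eq scale.rep_eq)
  have fin: "finite S\<^sub>0" using v by (simp add: leads_def)
  have less: "finite S \<and> \<Sum>S < \<Sum>(insert d S\<^sub>0)" if "apply_op V v S \<noteq> 0" for S
  proof -
    from apply_op_lin_support[OF V that] obtain i where i: "i < d" "i \<in> S" "v (S - {i}) \<noteq> 0" by auto
    then have "finite (S - {i}) \<and> \<Sum>(S - {i}) \<le> \<Sum>S\<^sub>0"
      using v unfolding leads_def by (metis less_imp_le order_refl)
    moreover from this have "\<Sum>S = i + \<Sum>(S - {i})" using i(2) by (simp add: sum.remove)
    ultimately show ?thesis using i(1) fin d by simp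
  qed
  have gen: "apply_op (gen t d) v S = (if d \<in> S then t ^ card {s\<in>S. s < d} * v (S - {d}) else 0)" for S
    by (simp add: gen.rep_eq)
  have "apply_op V v (insert d S\<^sub>0) = 0" using less by blast
  then have "?w (insert d S\<^sub>0) \<noteq> 0"
    using v d c t by (simp add: w gen leads_def)
  moreover have "finite S \<and> \<Sum>S < \<Sum>(insert d S\<^sub>0)" if "?w S \<noteq> 0" "S \<noteq> insert d S\<^sub>0" for S
  proof (cases "apply_op V v S = 0")
    case True
    then have S: "d \<in> S" "v (S - {d}) \<noteq> 0" using that(1) by (auto simp: w gen split: if_splits)
    moreover have "S - {d} \<noteq> S\<^sub>0" using that(2) S(1) by auto
    ultimately have "finite (S - {d})" "\<Sum>(S - {d}) < \<Sum>S\<^sub>0" using v by (auto simp: leads_def)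
    moreover from this have "\<Sum>S = d + \<Sum>(S - {d})" using S(1) by (simp add: sum.remove)
    ultimately show ?thesis using fin d by simp
  qed (use less in blast)
  ultimately show ?thesis using fin by (simp add: leads_def)
qed

lemma prodl_left: "d < m \<Longrightarrow> prodl f d m = f d * prodl f (Suc d) m"
  by (simp add: prodl_def upt_conv_Cons)

text \<open>The rightmost factor acts first, so the induction runs downwards from \<open>m\<close>,
  adding smaller and smaller indices to the leading set.\<close>

lemma leads_prodl:
  fixes t :: "'r::idom"
  assumes "d \<le> m" "t \<noteq> 0"
    and f: "\<And>p. d \<le> p \<Longrightarrow> p < m \<Longrightarrow> p \<in> A \<Longrightarrow> \<exists>c V. c \<noteq> 0 \<and> V \<in> lin t {..<p} \<and> f p = c \<cdot> gen t p + V"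
      "\<And>p. d \<le> p \<Longrightarrow> p < m \<Longrightarrow> p \<notin> A \<Longrightarrow> f p = 1"
  shows "leads (apply_op (prodl f d m) (\<lambda>S. if S = {} then 1 else 0)) (A \<inter> {d..<m})"
  using assms(1) f
proof (induction d rule: inc_induct)
  case base
  then show ?case by (simp add: leads_def one_qop.rep_eq)
next
  case (step d)
  let ?v = "apply_op (prodl f (Suc d) m) (\<lambda>S. if S = {} then 1 else 0)"
  have IH: "leads ?v (A \<inter> {Suc d..<m})" using step.IH step.prems by simp
  have prod: "apply_op (prodl f d m) (\<lambda>S. if S = {} then 1 else 0) = apply_op (f d) ?v"
    using step.hyps by (simp add: prodl_left times_qop.rep_eq)
  show ?case
  proof (cases "d \<in> A")
    case True
    from step.prems(1)[OF order_refl step.hyps(2) True] obtain c V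
      where cV: "c \<noteq> 0" "V \<in> lin t {..<d}" "f d = c \<cdot> gen t d + V" by blast
    have "A \<inter> {d..<m} = insert d (A \<inter> {Suc d..<m})" using True step.hyps by auto
    then show ?thesis unfolding prod cV(3)
      using leads_step[OF IH _ cV(1) assms(2) cV(2)] by simp
  next
    case False
    then have "A \<inter> {d..<m} = A \<inter> {Suc d..<m}" using step.hyps by (auto simp: Suc_le_eq order.order_iff_strict)
    then show ?thesis using IH step.prems(2)[OF order_refl step.hyps(2) False]
      unfolding prod by (simp add: one_qop.rep_eq)
  qed
qed

lemma q_pow_nonzero: "q_pow k \<noteq> 0"
proof
  assume "q_pow k = 0"
  then have "q_pow k * q_pow (- k) = 0" by simp
  then show False by (simp add: q_pow_mult)
qed

text \<open>Apart from \<open>p\<close>, only the left end and the dots under the arc occur in the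
  form, and these indices are all below \<open>p\<close>.\<close>

lemma fac_leading:
  assumes "unique_right U" "(l, p) \<in> U" "l < p"
  shows "\<exists>c V. c \<noteq> 0 \<and> V \<in> lin (q_pow 2) {..<p} \<and> fac K U p = c \<cdot> gen (q_pow 2) p + V"
proof -
  let ?V = "kap K p \<cdot> ((q_pow 1 - q_pow (-1)) \<cdot> (\<Sum>y\<in>K \<inter> {l<..<p}. xi K y) - q_pow (-1) \<cdot> xi K l)"
  have "fac K U p = (kap K p * q_pow (-1) * q_pow (potential K p)) \<cdot> gen (q_pow 2) p + ?V"
    by (simp add: fac_arc[OF assms(1,2)] seg_def xi_def scale_distribs mult.assoc)
  moreover have "?V \<in> lin (q_pow 2) {..<p}"
    using assms(3) unfolding xi_def by (intro lin_scale lin_diff lin_sum lin_gen) auto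
  moreover have "kap K p * q_pow (-1) * q_pow (potential K p) \<noteq> 0"
    by (simp add: kap_def q_pow_nonzero)
  ultimately show ?thesis by blast
qed

text \<open>Among the elements with nonzero coefficient take one whose leading set has the largest
  sum: no other image is nonzero at that set.\<close>

lemma leading_independent:
  fixes \<phi> :: "'b \<Rightarrow> nat set \<Rightarrow> 'r::idom"
  assumes G: "finite G" "inj_on lead G" "\<And>b. b \<in> G \<Longrightarrow> leads (\<phi> b) (lead b)"
    and zero: "\<And>S. (\<Sum>b\<in>G. c b * \<phi> b S) = 0"
  shows "\<forall>b\<in>G. c b = 0"
proof (rule ccontr)
  assume "\<not> (\<forall>b\<in>G. c b = 0)"
  then have ne: "{b\<in>G. c b \<noteq> 0} \<noteq> {}" by auto
  have "finite {b\<in>G. c b \<noteq> 0}" using G(1) by simp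
  from obtains_MAX[OF this ne, of "\<lambda>b. \<Sum>(lead b)"]
  obtain b where b: "b \<in> G" "c b \<noteq> 0" and max: "\<And>b'. b' \<in> G \<Longrightarrow> c b' \<noteq> 0 \<Longrightarrow> \<Sum>(lead b') \<le> \<Sum>(lead b)"
    using Max_ge[of "(\<lambda>b. \<Sum>(lead b)) ` {b\<in>G. c b \<noteq> 0}"] \<open>finite {b\<in>G. c b \<noteq> 0}\<close>
    by (metis (mono_tags, lifting) finite_imageI imageI mem_Collect_eq)
  have "c b' * \<phi> b' (lead b) = 0" if "b' \<in> G" "b' \<noteq> b" for b'
  proof (rule ccontr)
    assume *: "c b' * \<phi> b' (lead b) \<noteq> 0"
    moreover have "lead b \<noteq> lead b'" using G(2) that b(1) by (auto dest: inj_onD)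
    ultimately have "\<Sum>(lead b) < \<Sum>(lead b')" using G(3)[OF that(1)] by (auto simp: leads_def)
    then show False using max[OF that(1)] * by simp
  qed
  then have "(\<Sum>b'\<in>G - {b}. c b' * \<phi> b' (lead b)) = 0" by (intro sum.neutral) blast
  then have "(\<Sum>b'\<in>G. c b' * \<phi> b' (lead b)) = c b * \<phi> b (lead b)"
    using sum.remove[OF G(1) b(1), of "\<lambda>b'. c b' * \<phi> b' (lead b)"] by simp
  then show False using zero[of "lead b"] b G(3)[OF b(1)] by (simp add: leads_def)
qed

section \<open>Counting ballot sets\<close>

definition ballot_sets :: "nat \<Rightarrow> nat \<Rightarrow> nat set set" where
  "ballot_sets m s = {S. S \<subseteq> {1..m} \<and> card S = s \<and> (\<forall>i\<le>m. 2 * card (S \<inter> {1..i}) \<le> i)}"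

lemma ballot_sets_finite: "finite (ballot_sets m s)"
  by (rule finite_subset[of _ "Pow {1..m}"]) (auto simp: ballot_sets_def)

lemma ballot_sets_empty:
  assumes "m < 2 * s" shows "ballot_sets m s = {}"
proof -
  have False if "S \<in> ballot_sets m s" for S
  proof -
    have "S \<inter> {1..m} = S" using that by (auto simp: ballot_sets_def)
    then show False using that assms by (auto simp: ballot_sets_def)
  qed
  then show ?thesis by blast
qed

text \<open>The sets are divided according to the last point; the assumption is the ballot
  inequality for the longest prefix.\<close>

lemma ballot_sets_Suc:
  assumes "2 * s \<le> Suc m"
  shows "ballot_sets (Suc m) s = ballot_sets m s \<union> (if s = 0 then {} else insert (Suc m) ` ballot_sets m (s - 1))"
proof (intro equalityI subsetI)
  fix S assume "S \<in> ballot_sets (Suc m) s"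
  then have S: "S \<subseteq> {1..Suc m}" "card S = s" "\<And>i. i \<le> Suc m \<Longrightarrow> 2 * card (S \<inter> {1..i}) \<le> i"
    by (auto simp: ballot_sets_def)
  have fin: "finite S" using S(1) by (rule finite_subset) simp
  show "S \<in> ballot_sets m s \<union> (if s = 0 then {} else insert (Suc m) ` ballot_sets m (s - 1))"
  proof (cases "Suc m \<in> S")
    case False
    then have "S \<subseteq> {1..m}" using S(1) by (auto simp: le_Suc_eq)
    then show ?thesis using S by (auto simp: ballot_sets_def)
  next
    case True
    have "S - {Suc m} \<subseteq> {1..m}" using S(1) by (auto simp: le_Suc_eq)
    moreover have "card (S - {Suc m}) = s - 1" using True S(2) fin by simp
    moreover have "(S - {Suc m}) \<inter> {1..i} = S \<inter> {1..i}" if "i \<le> m" for i using that by auto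
    ultimately have "S - {Suc m} \<in> ballot_sets m (s - 1)" using S(3) by (auto simp: ballot_sets_def)
    moreover have "s \<noteq> 0" using True S(2) fin by (metis card_0_eq empty_iff)
    moreover have "S = insert (Suc m) (S - {Suc m})" using True by auto
    ultimately have "S \<in> insert (Suc m) ` ballot_sets m (s - 1)" "s \<noteq> 0" by blast+
    then show ?thesis by simp
  qed
next
  fix S assume "S \<in> ballot_sets m s \<union> (if s = 0 then {} else insert (Suc m) ` ballot_sets m (s - 1))"
  then consider "S \<in> ballot_sets m s" | T where "s \<noteq> 0" "T \<in> ballot_sets m (s - 1)" "S = insert (Suc m) T"
    by (auto split: if_splits)
  then show "S \<in> ballot_sets (Suc m) s"
  proof cases
    case 1
    then have "S \<inter> {1..Suc m} = S" by (auto simp: ballot_sets_def)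
    then show ?thesis using 1 assms by (auto simp: ballot_sets_def le_Suc_eq)
  next
    case 2
    then have T: "T \<subseteq> {1..m}" "card T = s - 1" "\<And>i. i \<le> m \<Longrightarrow> 2 * card (T \<inter> {1..i}) \<le> i"
      by (auto simp: ballot_sets_def)
    have "finite T" using T(1) by (rule finite_subset) simp
    moreover have "Suc m \<notin> T" using T(1) by auto
    ultimately have card: "card S = s" using T(2) 2 by simp
    moreover have "S \<subseteq> {1..Suc m}" using T(1) 2 by auto
    moreover have "2 * card (S \<inter> {1..i}) \<le> i" if "i \<le> Suc m" for i
    proof (cases "i = Suc m")
      case True
      then show ?thesis using \<open>S \<subseteq> {1..Suc m}\<close> card assms by (simp add: Int_absorb2)
    next
      case False
      then have "S \<inter> {1..i} = T \<inter> {1..i}" using that 2 by auto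
      then show ?thesis using T(3)[of i] False that by simp
    qed
    ultimately show ?thesis by (simp add: ballot_sets_def)
  qed
qed

lemma card_ballot_sets:
  "2 * s \<le> Suc m \<Longrightarrow> card (ballot_sets m s) + (if s = 0 then 0 else m choose (s - 1)) = m choose s"
proof (induction m arbitrary: s)
  case 0
  then have "s = 0" by simp
  moreover have "ballot_sets 0 0 = {{}}" by (auto simp: ballot_sets_def)
  ultimately show ?case by simp
next
  case (Suc m)
  show ?case
  proof (cases "2 * s = Suc (Suc m)")
    case True
    then have "ballot_sets (Suc m) s = {}" by (intro ballot_sets_empty) simp
    moreover have "Suc m choose (s - 1) = Suc m choose s"
    proof -
      have "Suc m - s = s - 1" using True by simp
      moreover have "s \<le> Suc m" using True by simp
      ultimately show ?thesis using binomial_symmetric[of s "Suc m"] by simp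
    qed
    ultimately show ?thesis using True by simp
  next
    case False
    then have s: "2 * s \<le> Suc m" using Suc.prems by simp
    show ?thesis
    proof (cases s)
      case 0
      then have "ballot_sets (Suc m) s = ballot_sets m s" using ballot_sets_Suc[OF s] by simp
      then show ?thesis using Suc.IH[OF s] 0 by simp
    next
      case (Suc s')
      have inj: "inj_on (insert (Suc m)) (ballot_sets m s')"
      proof (rule inj_onI)
        fix S T assume "S \<in> ballot_sets m s'" "T \<in> ballot_sets m s'" "insert (Suc m) S = insert (Suc m) T"
        moreover from this have "Suc m \<notin> S" "Suc m \<notin> T" by (auto simp: ballot_sets_def)
        ultimately show "S = T" by (simp add: insert_ident)
      qed
      have "ballot_sets m s \<inter> insert (Suc m) ` ballot_sets m s' = {}" by (auto simp: ballot_sets_def)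
      then have "card (ballot_sets (Suc m) s) = card (ballot_sets m s) + card (ballot_sets m s')"
        using ballot_sets_Suc[OF s] Suc ballot_sets_finite
        by (simp add: card_Un_disjoint card_image[OF inj])
      moreover have "2 * s' \<le> Suc m" using s Suc by simp
      note Suc.IH[OF s] Suc.IH[OF this]
      ultimately show ?thesis using Suc by (cases s') auto
    qed
  qed
qed

section \<open>Cup diagrams from ballot sets\<close>

definition encloses :: "arc \<Rightarrow> arc \<Rightarrow> bool" where
  "encloses x y \<longleftrightarrow> fst x < fst y \<and> snd y < snd x"

definition outer_diagrams :: "nat \<Rightarrow> nat \<Rightarrow> diagram set" where
  "outer_diagrams n k = {(A, D) \<in> diagrams n k. \<forall>x\<in>A. \<forall>y\<in>D. \<not> encloses x y}"

text \<open>Consecutive points are joined, beginning with the two largest; the resulting arcs are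
  neither nested nor crossing.\<close>

lemma pairing_exists:
  fixes R :: "nat set"
  assumes "finite R" "card R = 2 * k"
  shows "\<exists>D. finite D \<and> card D = k \<and> fst ` D \<union> snd ` D = R \<and> (\<forall>x\<in>D. fst x < snd x)
    \<and> (\<forall>x\<in>D. \<forall>y\<in>D. x \<noteq> y \<longrightarrow> snd x < fst y \<or> snd y < fst x)"
  using assms
proof (induction k arbitrary: R)
  case 0
  then show ?case by (intro exI[of _ "{}"]) simp
next
  case (Suc k)
  define M where "M = Max R"
  define r where "r = Max (R - {M})"
  have M: "M \<in> R" "\<And>x. x \<in> R \<Longrightarrow> x \<le> M"
    unfolding M_def using Suc.prems by (auto intro!: Max_in)
  have "card (R - {M}) = Suc (2 * k)" using Suc.prems M by simp
  then have ne: "R - {M} \<noteq> {}" "finite (R - {M})" using Suc.prems(1) by (metis card.empty nat.distinct(1), simp)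
  have r: "r \<in> R - {M}" "\<And>x. x \<in> R - {M} \<Longrightarrow> x \<le> r"
    unfolding r_def using Max_in[OF ne(2,1)] Max_ge[OF ne(2)] by blast+
  have "card (R - {M} - {r}) = 2 * k" using \<open>card (R - {M}) = Suc (2 * k)\<close> r(1) ne(2) by simp
  from Suc.IH[OF _ this] ne(2) obtain D where D: "finite D" "card D = k" "fst ` D \<union> snd ` D = R - {M} - {r}"
    "\<forall>x\<in>D. fst x < snd x" "\<forall>x\<in>D. \<forall>y\<in>D. x \<noteq> y \<longrightarrow> snd x < fst y \<or> snd y < fst x" by blast
  have "r < M" using r(1) M by (metis DiffE insertCI le_neq_implies_less)
  have less: "snd x < r" if "x \<in> D" for x
  proof -
    have "snd x \<in> R - {M} - {r}" using that D(3) by blast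
    then show ?thesis using r(2)[of "snd x"] by simp
  qed
  have "(r, M) \<notin> D" using D(3) by force
  show ?case
  proof (intro exI[of _ "insert (r, M) D"] conjI)
    show "fst ` insert (r, M) D \<union> snd ` insert (r, M) D = R" using D(3) M(1) r(1) by auto
    show "\<forall>x\<in>insert (r, M) D. \<forall>y\<in>insert (r, M) D. x \<noteq> y \<longrightarrow> snd x < fst y \<or> snd y < fst x"
      using D(5) less by auto
  qed (use D \<open>(r, M) \<notin> D\<close> \<open>r < M\<close> in auto)
qed

text \<open>A matching in progress. The free points \<open>R\<close> will become the ends of dotted
  arcs, and \<open>outer\<close> guarantees that no undotted arc ever covers them.\<close>

locale cup_diagram =
  fixes m :: nat and C :: "arc set" and R :: "nat set"
  assumes arc: "(l, p) \<in> C \<Longrightarrow> 1 \<le> l \<and> l < p \<and> p \<le> m"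
    and free: "R \<subseteq> {1..m}"
    and cover: "1 \<le> p \<Longrightarrow> p \<le> m \<Longrightarrow> p \<in> fst ` C \<union> snd ` C \<union> R"
    and unique: "(l, p) \<in> C \<Longrightarrow> (l', p') \<in> C \<Longrightarrow> {l, p} \<inter> {l', p'} \<noteq> {} \<Longrightarrow> l = l' \<and> p = p'"
    and not_free: "(l, p) \<in> C \<Longrightarrow> l \<notin> R \<and> p \<notin> R"
    and noncrossing: "(l, p) \<in> C \<Longrightarrow> (l', p') \<in> C \<Longrightarrow> l < l' \<Longrightarrow> l' < p \<Longrightarrow> p' \<le> p"
    and outer: "(l, p) \<in> C \<Longrightarrow> r \<in> R \<Longrightarrow> \<not> (l < r \<and> r < p)"

lemma cup_diagram_add_free:
  assumes "cup_diagram m C R"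
  shows "cup_diagram (Suc m) C (insert (Suc m) R)"
proof -
  interpret cup_diagram m C R by fact
  show ?thesis
  proof
    show "insert (Suc m) R \<subseteq> {1..Suc m}" using free by auto
    show "\<And>p. 1 \<le> p \<Longrightarrow> p \<le> Suc m \<Longrightarrow> p \<in> fst ` C \<union> snd ` C \<union> insert (Suc m) R"
      using cover by (auto simp: le_Suc_eq)
    show "1 \<le> l \<and> l < p \<and> p \<le> Suc m" if "(l, p) \<in> C" for l p using arc[OF that] by simp
    show "l \<notin> insert (Suc m) R \<and> p \<notin> insert (Suc m) R" if "(l, p) \<in> C" for l p
      using arc[OF that] not_free[OF that] by simp
    show "\<not> (l < r \<and> r < p)" if "(l, p) \<in> C" "r \<in> insert (Suc m) R" for l p r
      using arc[OF that(1)] outer[OF that(1), of r] that(2) by auto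
  qed (fact unique noncrossing)+
qed

text \<open>Closing the largest free point traps no other free point, and as that point lies under
  no arc, the new arc crosses none.\<close>

lemma cup_diagram_add_arc:
  assumes "cup_diagram m C R" "R \<noteq> {}"
  shows "cup_diagram (Suc m) (insert (Max R, Suc m) C) (R - {Max R})"
proof -
  interpret cup_diagram m C R by fact
  have "finite R" using free by (rule finite_subset) simp
  then have t: "Max R \<in> R" "\<And>r. r \<in> R \<Longrightarrow> r \<le> Max R" using assms(2) by auto
  then have tm: "1 \<le> Max R" "Max R \<le> m" using free by auto
  have nt: "l \<noteq> Max R \<and> p \<noteq> Max R \<and> l \<noteq> Suc m \<and> p \<noteq> Suc m" if "(l, p) \<in> C" for l p
    using not_free[OF that] arc[OF that] t(1) by auto
  show ?thesis
  proof
    show "R - {Max R} \<subseteq> {1..Suc m}" using free by auto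
    show "p \<in> fst ` insert (Max R, Suc m) C \<union> snd ` insert (Max R, Suc m) C \<union> (R - {Max R})"
      if "1 \<le> p" "p \<le> Suc m" for p
      using cover[of p] that by (cases "p = Suc m") auto
    show "1 \<le> l \<and> l < p \<and> p \<le> Suc m" if "(l, p) \<in> insert (Max R, Suc m) C" for l p
      using that arc[of l p] tm by auto
    show "l \<notin> R - {Max R} \<and> p \<notin> R - {Max R}" if "(l, p) \<in> insert (Max R, Suc m) C" for l p
      using that not_free[of l p] free by auto
    show "\<not> (l < r \<and> r < p)" if "(l, p) \<in> insert (Max R, Suc m) C" "r \<in> R - {Max R}" for l p r
      using that outer[of l p r] t(2)[of r] by auto
    show "l = l' \<and> p = p'" if "(l, p) \<in> insert (Max R, Suc m) C" "(l', p') \<in> insert (Max R, Suc m) C"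
      "{l, p} \<inter> {l', p'} \<noteq> {}" for l p l' p'
      using that nt[of l p] nt[of l' p'] unique[of l p l' p'] by auto
    show "p' \<le> p" if "(l, p) \<in> insert (Max R, Suc m) C" "(l', p') \<in> insert (Max R, Suc m) C" "l < l'" "l' < p" for l p l' p'
    proof (cases "(l, p) \<in> C")
      case True
      show ?thesis
      proof (cases "(l', p') \<in> C")
        case False
        then have "l' = Max R" using that(2) by simp
        then show ?thesis using outer[OF True t(1)] that by simp
      qed (use noncrossing[OF True _ that(3,4)] in blast)
    next
      case False
      then have "p = Suc m" using that(1) by simp
      then show ?thesis using that(2) arc[of l' p'] by auto
    qed
  qed
qed

text \<open>Bracket matching: a point of \<open>S\<close> closes the most recent free point, and the
  prefix inequality ensures that there is one.\<close>

lemma cup_diagram_exists: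
  assumes "S \<subseteq> {1..m}" "\<And>i. i \<le> m \<Longrightarrow> 2 * card (S \<inter> {1..i}) \<le> i"
  shows "\<exists>C R. cup_diagram m C R \<and> snd ` C = S \<and> card R + 2 * card S = m"
  using assms
proof (induction m arbitrary: S)
  case 0
  then have "cup_diagram 0 {} {}" "S = {}" by (auto intro: cup_diagram.intro)
  then show ?case by (intro exI[of _ "{}"]) simp
next
  case (Suc m)
  have "S - {Suc m} \<subseteq> {1..m}" using Suc.prems(1) by (auto simp: le_Suc_eq)
  moreover have "(S - {Suc m}) \<inter> {1..i} = S \<inter> {1..i}" if "i \<le> m" for i using that by auto
  ultimately obtain C R where CR: "cup_diagram m C R" "snd ` C = S - {Suc m}" "card R + 2 * card (S - {Suc m}) = m"
    using Suc.IH[of "S - {Suc m}"] Suc.prems(2) by auto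
  interpret cup_diagram m C R by fact
  have finS: "finite S" using Suc.prems(1) by (rule finite_subset) simp
  have finR: "finite R" using free by (rule finite_subset) simp
  show ?case
  proof (cases "Suc m \<in> S")
    case False
    have "Suc m \<notin> R" using free by auto
    then show ?thesis using cup_diagram_add_free[OF CR(1)] CR(2,3) False finR
      by (intro exI[of _ C] exI[of _ "insert (Suc m) R"]) simp
  next
    case True
    have "S \<inter> {1..Suc m} = S" using Suc.prems(1) by auto
    then have "2 * card S \<le> Suc m" using Suc.prems(2)[of "Suc m"] by simp
    moreover have card: "card S = Suc (card (S - {Suc m}))" by (rule card_Suc_Diff1[OF finS True, symmetric])
    ultimately have "card R \<noteq> 0" using CR(3) by simp
    then have "R \<noteq> {}" by auto
    then have "cup_diagram (Suc m) (insert (Max R, Suc m) C) (R - {Max R})"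
      by (rule cup_diagram_add_arc[OF CR(1)])
    moreover have "snd ` insert (Max R, Suc m) C = S" using CR(2) True by auto
    moreover have "card (R - {Max R}) + 2 * card S = Suc m"
      using CR(3) card card_Suc_Diff1[OF finR Max_in[OF finR \<open>R \<noteq> {}\<close>]] by simp
    ultimately show ?thesis by blast
  qed
qed

section \<open>Diagrams with outermost dotted arcs\<close>

lemma crossingless_matchingI:
  assumes arc: "\<And>i j. (i, j) \<in> A \<Longrightarrow> 1 \<le> i \<and> i < j \<and> j \<le> 2 * n"
    and cover: "\<And>p. 1 \<le> p \<Longrightarrow> p \<le> 2 * n \<Longrightarrow> p \<in> fst ` A \<union> snd ` A"
    and unique: "\<And>i j i' j'. (i, j) \<in> A \<Longrightarrow> (i', j') \<in> A \<Longrightarrow> {i, j} \<inter> {i', j'} \<noteq> {} \<Longrightarrow> i = i' \<and> j = j'"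
    and noncrossing: "\<And>i j i' j'. (i, j) \<in> A \<Longrightarrow> (i', j') \<in> A \<Longrightarrow> i < i' \<Longrightarrow> i' < j \<Longrightarrow> j' \<le> j"
  shows "crossingless_matching n A"
  unfolding crossingless_matching_def
proof (intro conjI ballI)
  show "A \<subseteq> {(i, j). 1 \<le> i \<and> i < j \<and> j \<le> 2 * n}" using arc by auto
  show "\<nexists>a b c d. a < b \<and> b < c \<and> c < d \<and> (a, c) \<in> A \<and> (b, d) \<in> A"
  proof
    assume "\<exists>a b c d. a < b \<and> b < c \<and> c < d \<and> (a, c) \<in> A \<and> (b, d) \<in> A"
    then obtain a b c d where "a < b" "b < c" "c < d" "(a, c) \<in> A" "(b, d) \<in> A" by blast
    then show False using noncrossing[of a c b d] by simp
  qed
  fix p assume "p \<in> {1..2 * n}"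
  then have "p \<in> fst ` A \<union> snd ` A" using cover[of p] by simp
  then obtain x where x: "x \<in> A" "p = fst x \<or> p = snd x" unfolding Un_iff image_iff by metis
  show "\<exists>!x. x \<in> A \<and> (p = fst x \<or> p = snd x)"
  proof (rule ex1I[of _ x])
    show "x \<in> A \<and> (p = fst x \<or> p = snd x)" using x by blast
    fix y assume y: "y \<in> A \<and> (p = fst y \<or> p = snd y)"
    then have "p \<in> {fst y, snd y}" "p \<in> {fst x, snd x}" using x(2) by simp_all
    then have "{fst y, snd y} \<inter> {fst x, snd x} \<noteq> {}" by blast
    moreover have "(fst y, snd y) \<in> A" "(fst x, snd x) \<in> A" using x(1) y by simp_all
    ultimately show "y = x" using unique[of "fst y" "snd y" "fst x" "snd x"] by (metis prod.collapse)
  qed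
qed

lemma diagramsD:
  assumes "(A, D) \<in> diagrams n k"
  shows "crossingless_matching n A" "D \<subseteq> A" "card D = k"
  using assms by (auto simp: diagrams_def)

lemma outer_diagramsD:
  assumes "(A, D) \<in> outer_diagrams n k"
  shows "crossingless_matching n A" "D \<subseteq> A" "card D = k"
    "(l, p) \<in> A \<Longrightarrow> (l', p') \<in> D \<Longrightarrow> l < l' \<Longrightarrow> p' < p \<Longrightarrow> False"
proof -
  have d: "(A, D) \<in> diagrams n k" and o: "\<forall>x\<in>A. \<forall>y\<in>D. \<not> encloses x y"
    using assms by (simp_all add: outer_diagrams_def)
  show "crossingless_matching n A" "D \<subseteq> A" "card D = k" by (rule diagramsD[OF d])+
  show "(l, p) \<in> A \<Longrightarrow> (l', p') \<in> D \<Longrightarrow> l < l' \<Longrightarrow> p' < p \<Longrightarrow> False"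
    using bspec[OF bspec[OF o, of "(l, p)"], of "(l', p')"] by (simp add: encloses_def)
qed

section \<open>Outer diagrams are determined by the right ends of undotted arcs\<close>

lemma endpoint_cases:
  assumes "crossingless_matching n A" "(l, p) \<in> A" "l \<le> r" "r \<le> p"
  obtains s where "(r, s) \<in> A" | s where "(s, r) \<in> A"
proof -
  have "r \<in> fst ` A \<union> snd ` A"
    using crossingless_covered[OF assms(1), of r] crossingless_arc[OF assms(1,2)] assms(3,4) by simp
  then show ?thesis using that by auto
qed

text \<open>If \<open>l < l'\<close>, then \<open>l'\<close> lies inside the arc
  \<open>(l, p)\<close> of \<open>A\<close>, and so does its partner in \<open>A\<close>; being
  enclosed, their arc is undotted. If \<open>l'\<close> is its left end, the induction hypothesis
  moves the arc to \<open>A'\<close>; if it is its right end, \<open>l'\<close> is a right end in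
  \<open>A'\<close> as well. Both contradict \<open>(l', p)\<close>.\<close>

lemma undotted_arcs_unique_step:
  assumes O: "(A, D) \<in> outer_diagrams n k" "(A', D') \<in> outer_diagrams n k'"
    and S: "snd ` (A - D) \<subseteq> snd ` (A' - D')"
    and IH: "\<And>r l. r < p \<Longrightarrow> (l, r) \<in> A - D \<Longrightarrow> (l, r) \<in> A' - D'"
    and arcs: "(l, p) \<in> A - D" "(l', p) \<in> A' - D'"
  shows "l' \<le> l"
proof (rule ccontr)
  assume "\<not> l' \<le> l"
  then have less: "l < l'" by simp
  note c = outer_diagramsD[OF O(1)] and c' = outer_diagramsD[OF O(2)]
  have lp: "(l, p) \<in> A" "(l', p) \<in> A'" using arcs by auto
  have l'p: "l' < p" using crossingless_arc(2)[OF c'(1) lp(2)] .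
  from c(1) lp(1) less_imp_le[OF less] less_imp_le[OF l'p] show False
  proof (cases rule: endpoint_cases)
    case (1 s)
    have "s \<le> p" using crossingless_no_crossing[OF c(1) lp(1) 1 less l'p] .
    moreover have "s \<noteq> p" using crossingless_unique(1)[OF c(1) lp(1) 1] less by auto
    ultimately have "s < p" by simp
    then have "(l', s) \<in> A - D" using c(4)[OF lp(1) _ less, of s] 1 by blast
    from IH[OF \<open>s < p\<close> this] have "(l', s) \<in> A'" by blast
    then have "s = p" using crossingless_unique(2)[OF c'(1) _ lp(2), of l' s] by blast
    then show False using \<open>s < p\<close> by simp
  next
    case (2 s)
    have "s < l'" using crossingless_arc(2)[OF c(1) 2] .
    have "l < s"
    proof (rule ccontr)
      assume "\<not> l < s"
      then consider "s < l" | "s = l" by linarith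
      then show False
      proof cases
        case a: 1
        then show False using crossingless_no_crossing[OF c(1) 2 lp(1) a less] l'p by simp
      next
        case 2
        then show False using crossingless_unique(2)[OF c(1) \<open>(s, l') \<in> A\<close> lp(1)] l'p by blast
      qed
    qed
    then have "(s, l') \<in> A - D" using c(4)[OF lp(1), of s l'] 2 l'p by blast
    then have "l' \<in> snd ` (A' - D')" using S by force
    then obtain s' where "(s', l') \<in> A'" by auto
    then show False using crossingless_left_right[OF c'(1) lp(2)] by blast
  qed
qed

lemma undotted_arcs_unique:
  assumes "(A, D) \<in> outer_diagrams n k" "(A', D') \<in> outer_diagrams n k'" "snd ` (A - D) = snd ` (A' - D')"
  shows "A - D = A' - D'"
proof -
  have "(l, p) \<in> A - D \<longleftrightarrow> (l, p) \<in> A' - D'" for l p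
  proof (induction p arbitrary: l rule: less_induct)
    case (less p)
    have le: "l' \<le> l" "l \<le> l'" if "(l, p) \<in> A - D" "(l', p) \<in> A' - D'" for l l'
      using undotted_arcs_unique_step[OF assms(1,2) _ _ that] undotted_arcs_unique_step[OF assms(2,1) _ _ that(2,1)]
        less.IH assms(3) by auto
    show ?case
    proof
      assume l: "(l, p) \<in> A - D"
      then have "p \<in> snd ` (A' - D')" using assms(3) by force
      then obtain l' where "(l', p) \<in> A' - D'" by auto
      with le[OF l this] show "(l, p) \<in> A' - D'" by simp
    next
      assume l: "(l, p) \<in> A' - D'"
      then have "p \<in> snd ` (A - D)" using assms(3) by force
      then obtain l' where "(l', p) \<in> A - D" by auto
      with le[OF this l] show "(l, p) \<in> A - D" by simp
    qed
  qed
  then show ?thesis unfolding set_eq_iff split_paired_All by blast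
qed

text \<open>All points are covered and the undotted arcs agree, so the dotted arcs of the two
  diagrams have the same endpoints.\<close>

lemma dotted_endpoint_transfer:
  assumes O: "(A, D) \<in> outer_diagrams n k" "(A', D') \<in> outer_diagrams n k'" and U: "A - D = A' - D'"
    and arc: "(l, p) \<in> D" and r: "r = l \<or> r = p"
  obtains s where "(r, s) \<in> D'" | s where "(s, r) \<in> D'"
proof -
  note c = outer_diagramsD[OF O(1)] and c' = outer_diagramsD[OF O(2)]
  have lp: "(l, p) \<in> A" using arc c(2) by blast
  have "r \<in> fst ` A' \<union> snd ` A'"
    using crossingless_covered[OF c'(1), of r] crossingless_arc[OF c(1) lp] r by auto
  then obtain x y where xy: "(x, y) \<in> A'" "r = x \<or> r = y" by auto
  have "(x, y) \<in> D'"
  proof (rule ccontr)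
    assume "(x, y) \<notin> D'"
    then have "(x, y) \<in> A - D" using xy(1) U by blast
    moreover from this have "x = l" "y = p" using crossingless_unique[OF c(1) _ lp, of x y] xy(2) r by blast+
    ultimately show False using arc by blast
  qed
  then show ?thesis using that xy(2) by blast
qed

text \<open>Otherwise \<open>p\<close> would lie under \<open>(l, p')\<close> in the second diagram,
  where the dotted arc at \<open>p\<close> would have to be enclosed by it or cross it.\<close>

lemma dotted_arcs_unique_step:
  assumes O: "(A, D) \<in> outer_diagrams n k" "(A', D') \<in> outer_diagrams n k'" and U: "A - D = A' - D'"
    and arcs: "(l, p) \<in> D" "(l, p') \<in> D'"
  shows "p' \<le> p"
proof (rule ccontr)
  assume "\<not> p' \<le> p"
  then have less: "p < p'" by simp
  note c = outer_diagramsD[OF O(1)] and c' = outer_diagramsD[OF O(2)]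
  have lp: "(l, p) \<in> A" "(l, p') \<in> A'" using arcs c(2) c'(2) by blast+
  have "l < p" using crossingless_arc(2)[OF c(1) lp(1)] .
  from O U arcs(1) disjI2[OF refl] show False
  proof (cases rule: dotted_endpoint_transfer)
    case (1 s)
    then have s: "(p, s) \<in> A'" using c'(2) by blast
    have "s \<le> p'" using crossingless_no_crossing[OF c'(1) lp(2) s \<open>l < p\<close> less] .
    moreover have "s \<noteq> p'" using crossingless_unique(1)[OF c'(1) lp(2) s] \<open>l < p\<close> by auto
    ultimately show False using c'(4)[OF lp(2) 1 \<open>l < p\<close>] by simp
  next
    case (2 s)
    then have s: "(s, p) \<in> A'" using c'(2) by blast
    consider "s < l" | "s = l" | "l < s" by linarith
    then show False
    proof cases
      case 1
      then show False using crossingless_no_crossing[OF c'(1) s lp(2) 1 \<open>l < p\<close>] less by simp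
    next
      case e: 2
      then show False using crossingless_unique(2)[OF c'(1) s lp(2)] less by blast
    next
      case 3
      show False by (rule c'(4)[OF lp(2) 2 3 less])
    qed
  qed
qed

text \<open>Dotted arcs that are not enclosed join their endpoints consecutively.
  \<open>step\<close> is stated for arbitrary pairs of diagrams so that it can be used in both
  directions.\<close>

lemma dotted_arcs_unique:
  assumes O: "(A, D) \<in> outer_diagrams n k" "(A', D') \<in> outer_diagrams n k'" and U: "A - D = A' - D'"
  shows "D = D'"
proof -
  note c = outer_diagramsD[OF O(1)] and c' = outer_diagramsD[OF O(2)]
  have step: "(l, p) \<in> D2"
    if O2: "(A1, D1) \<in> outer_diagrams n k1" "(A2, D2) \<in> outer_diagrams n k2" and U2: "A1 - D1 = A2 - D2"
      and IH: "\<And>r p. r < l \<Longrightarrow> (r, p) \<in> D1 \<longleftrightarrow> (r, p) \<in> D2" and lp: "(l, p) \<in> D1"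
    for A1 D1 A2 D2 k1 k2 l p
  proof -
    note c1 = outer_diagramsD[OF O2(1)] and c2 = outer_diagramsD[OF O2(2)]
    from O2 U2 lp disjI1[OF refl] show ?thesis
    proof (cases rule: dotted_endpoint_transfer)
      case (1 s)
      have "s \<le> p" by (rule dotted_arcs_unique_step[OF O2 U2 lp 1])
      moreover have "p \<le> s" by (rule dotted_arcs_unique_step[OF O2(2,1) U2[symmetric] 1 lp])
      ultimately show ?thesis using 1 by simp
    next
      \<comment> \<open>Here \<open>l\<close> would be a right end in the second diagram. The first
        diagram has a dotted arc at \<open>u\<close> too, and the induction hypothesis carries it
        over to a contradiction.\<close>
      case (2 u)
      have "u < l" using crossingless_arc(2)[OF c2(1), of u l] 2 c2(2) by blast
      from O2(2,1) U2[symmetric] 2 disjI1[OF refl] show ?thesis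
      proof (cases rule: dotted_endpoint_transfer)
        case (1 w)
        then have "(u, w) \<in> D2" using IH[OF \<open>u < l\<close>] by blast
        then have "w = l" using crossingless_unique(2)[OF c2(1), of u w u l] 2 c2(2) by blast
        then show ?thesis using crossingless_left_right[OF c1(1), of l p u w] 1 lp c1(2) by blast
      next
        case w: (2 w)
        have "w < u" using crossingless_arc(2)[OF c1(1), of w u] w c1(2) by blast
        then have "w < l" using \<open>u < l\<close> by simp
        then have "(w, u) \<in> D2" using IH w by blast
        then show ?thesis using crossingless_left_right[OF c2(1), of u l w u] 2 c2(2) by blast
      qed
    qed
  qed
  have "(l, p) \<in> D \<longleftrightarrow> (l, p) \<in> D'" for l p
  proof (induction l arbitrary: p rule: less_induct)
    case (less l)
    show ?case
    proof
      show "(l, p) \<in> D \<Longrightarrow> (l, p) \<in> D'" by (rule step[OF O U less.IH])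
      show "(l, p) \<in> D' \<Longrightarrow> (l, p) \<in> D" by (rule step[OF O(2,1) U[symmetric] less.IH[symmetric]])
    qed
  qed
  then show ?thesis unfolding set_eq_iff split_paired_All by blast
qed

section \<open>The bijection with ballot sets\<close>

lemma crossingless_inj:
  assumes "crossingless_matching n A" "V \<subseteq> A"
  shows "inj_on fst V" "inj_on snd V"
proof -
  have "x = y" if "x \<in> V" "y \<in> V" "{fst x, snd x} \<inter> {fst y, snd y} \<noteq> {}" for x y
  proof -
    have "(fst x, snd x) \<in> A" "(fst y, snd y) \<in> A" using that assms(2) by auto
    from crossingless_unique[OF assms(1) this that(3)] show ?thesis by (simp add: prod_eq_iff)
  qed
  then show "inj_on fst V" "inj_on snd V" by (auto intro!: inj_onI)
qed

lemma crossingless_card: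
  assumes "crossingless_matching n A" shows "card A = n"
proof -
  have "{1..2 * n} = fst ` A \<union> snd ` A"
  proof
    show "{1..2 * n} \<subseteq> fst ` A \<union> snd ` A"
      by (rule subsetI) (use crossingless_covered[OF assms] in simp)
    show "fst ` A \<union> snd ` A \<subseteq> {1..2 * n}" using crossingless_arc[OF assms] by fastforce
  qed
  moreover have "fst ` A \<inter> snd ` A = {}" using crossingless_left_right[OF assms] by auto
  ultimately have "card {1..2 * n} = card (fst ` A) + card (snd ` A)"
    using crossingless_finite[OF assms] by (metis card_Un_disjoint finite_imageI)
  then show ?thesis using crossingless_inj[OF assms order_refl] by (simp add: card_image)
qed

text \<open>An undotted arc that ends in a prefix also starts in it, so at most half of the prefix
  consists of such right ends.\<close>

lemma outer_right_ends_ballot: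
  assumes "(A, D) \<in> outer_diagrams n k"
  shows "snd ` (A - D) \<in> ballot_sets (2 * n) (n - k)"
proof -
  note c = outer_diagramsD[OF assms]
  have fin: "finite A" by (rule crossingless_finite[OF c(1)])
  note inj = crossingless_inj[OF c(1) Diff_subset, of D]
  have "snd ` (A - D) \<subseteq> {1..2 * n}" using crossingless_arc[OF c(1)] by fastforce
  moreover have "card (snd ` (A - D)) = n - k"
    using card_Diff_subset[OF finite_subset[OF c(2) fin] c(2)] crossingless_card[OF c(1)] c(3)
    by (simp add: card_image[OF inj(2)])
  moreover have "2 * card (snd ` (A - D) \<inter> {1..i}) \<le> i" for i
  proof -
    define V where "V = {x \<in> A - D. snd x \<le> i}"
    have "snd ` (A - D) \<inter> {1..i} \<subseteq> snd ` V" by (auto simp: V_def)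
    moreover have finV: "finite V" using fin by (simp add: V_def)
    ultimately have "card (snd ` (A - D) \<inter> {1..i}) \<le> card (snd ` V)" by (intro card_mono) auto
    moreover have "inj_on fst V" "inj_on snd V" using crossingless_inj[OF c(1), of V] by (auto simp: V_def)
    then have "card (fst ` V) = card V" "card (snd ` V) = card V" by (auto simp: card_image)
    moreover have "fst ` V \<inter> snd ` V = {}" using crossingless_left_right[OF c(1)] by (auto simp: V_def)
    then have "card (fst ` V) + card (snd ` V) = card (fst ` V \<union> snd ` V)"
      using finV by (simp add: card_Un_disjoint)
    moreover have "fst ` V \<union> snd ` V \<subseteq> {1..i}" using crossingless_arc[OF c(1)] by (fastforce simp: V_def)
    then have "card (fst ` V \<union> snd ` V) \<le> i" using card_mono[of "{1..i}"] by fastforce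
    ultimately show ?thesis by linarith
  qed
  ultimately show ?thesis by (simp add: ballot_sets_def)
qed

text \<open>The \<open>2 * k\<close> free points of the cup diagram, paired consecutively, provide
  the dotted arcs.\<close>

lemma outer_diagram_exists:
  assumes "k \<le> n" "S \<in> ballot_sets (2 * n) (n - k)"
  shows "\<exists>A D. (A, D) \<in> outer_diagrams n k \<and> snd ` (A - D) = S"
proof -
  obtain C R where CR: "cup_diagram (2 * n) C R" "snd ` C = S" "card R + 2 * card S = 2 * n"
    using cup_diagram_exists[of S "2 * n"] assms(2) by (auto simp: ballot_sets_def)
  interpret cup_diagram "2 * n" C R by fact
  have "card S = n - k" using assms(2) by (simp add: ballot_sets_def)
  then have cardR: "card R = 2 * k" using CR(3) assms(1) by simp
  have finR: "finite R" using free by (rule finite_subset) simp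
  obtain D where D: "finite D" "card D = k" "fst ` D \<union> snd ` D = R" "\<forall>x\<in>D. fst x < snd x"
    "\<forall>x\<in>D. \<forall>y\<in>D. x \<noteq> y \<longrightarrow> snd x < fst y \<or> snd y < fst x"
    using pairing_exists[OF finR cardR] by (elim exE conjE) (rule that)
  have D_R: "l \<in> R" "p \<in> R" if "(l, p) \<in> D" for l p using that D(3) by force+
  have D_less: "l < p" if "(l, p) \<in> D" for l p using that D(4) by force
  have D_sep: "(l, p) = (l', p') \<or> p < l' \<or> p' < l" if "(l, p) \<in> D" "(l', p') \<in> D" for l p l' p'
    using that D(5) by fastforce
  have disj: "C \<inter> D = {}" using not_free D_R by auto
  have "crossingless_matching n (C \<union> D)"
  proof (rule crossingless_matchingI)
    show "1 \<le> i \<and> i < j \<and> j \<le> 2 * n" if "(i, j) \<in> C \<union> D" for i j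
      using that arc[of i j] D_less[of i j] D_R[of i j] free by auto
    show "p \<in> fst ` (C \<union> D) \<union> snd ` (C \<union> D)" if "1 \<le> p" "p \<le> 2 * n" for p
      using cover[OF that] D(3) by auto
    show "i = i' \<and> j = j'" if "(i, j) \<in> C \<union> D" "(i', j') \<in> C \<union> D" "{i, j} \<inter> {i', j'} \<noteq> {}" for i j i' j'
      using that(1)
    proof
      assume C: "(i, j) \<in> C"
      then have "(i', j') \<notin> D" using not_free[of i j] D_R[of i' j'] that(3) by auto
      then show ?thesis using unique[OF C _ that(3)] that(2) by blast
    next
      assume D: "(i, j) \<in> D"
      then have "(i', j') \<notin> C" using not_free[of i' j'] D_R[of i j] that(3) by auto
      then have D': "(i', j') \<in> D" using that(2) by blast
      show ?thesis using D_sep[OF D D'] D_less[OF D] D_less[OF D'] that(3) by auto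
    qed
    show "j' \<le> j" if "(i, j) \<in> C \<union> D" "(i', j') \<in> C \<union> D" "i < i'" "i' < j" for i j i' j'
      using that(1)
    proof
      assume C: "(i, j) \<in> C"
      then have "(i', j') \<notin> D" using outer[OF C, of i'] D_R[of i' j'] that(3,4) by blast
      then show ?thesis using noncrossing[OF C _ that(3,4)] that(2) by blast
    next
      assume D: "(i, j) \<in> D"
      show ?thesis
      proof (rule ccontr)
        assume less: "\<not> j' \<le> j"
        then have "(i', j') \<notin> C" using outer[of i' j' j] D_R[OF D] that(4) by auto
        then have D': "(i', j') \<in> D" using that(2) by blast
        show False using D_sep[OF D D'] D_less[OF D'] that(3,4) less by auto
      qed
    qed
  qed
  moreover have "\<not> encloses x y" if "x \<in> C \<union> D" "y \<in> D" for x y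
  proof
    assume e: "encloses x y"
    obtain l p l' p' where xy: "x = (l, p)" "y = (l', p')" by (metis prod.collapse)
    then have "l < l'" "p' < p" "l' < p'" using e D_less[of l' p'] that(2) by (auto simp: encloses_def)
    then show False
      using outer[of l p l'] D_R[of l' p'] D_sep[of l p l' p'] that xy by auto
  qed
  ultimately have "(C \<union> D, D) \<in> outer_diagrams n k"
    using D(2) by (simp add: outer_diagrams_def diagrams_def)
  moreover have "C \<union> D - D = C" using disj by blast
  ultimately show ?thesis using CR(2) by (intro exI[of _ "C \<union> D"] exI[of _ D]) simp
qed

lemma bij_betw_outer_ballot:
  assumes "k \<le> n"
  shows "bij_betw (\<lambda>(A, D). snd ` (A - D)) (outer_diagrams n k) (ballot_sets (2 * n) (n - k))"
proof (rule bij_betw_imageI)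
  show "inj_on (\<lambda>(A, D). snd ` (A - D)) (outer_diagrams n k)"
  proof (rule inj_onI, clarify)
    fix A D A' D' assume O: "(A, D) \<in> outer_diagrams n k" "(A', D') \<in> outer_diagrams n k"
      and eq: "snd ` (A - D) = snd ` (A' - D')"
    have U: "A - D = A' - D'" by (rule undotted_arcs_unique[OF O eq])
    moreover have "D = D'" by (rule dotted_arcs_unique[OF O U])
    ultimately show "A = A' \<and> D = D'" using outer_diagramsD(2)[OF O(1)] outer_diagramsD(2)[OF O(2)] by blast
  qed
  show "(\<lambda>(A, D). snd ` (A - D)) ` outer_diagrams n k = ballot_sets (2 * n) (n - k)"
  proof (intro equalityI subsetI)
    fix S assume "S \<in> ballot_sets (2 * n) (n - k)"
    from outer_diagram_exists[OF assms this] show "S \<in> (\<lambda>(A, D). snd ` (A - D)) ` outer_diagrams n k"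
      by force
  qed (auto simp: outer_right_ends_ballot)
qed

lemma card_outer_diagrams:
  assumes "k \<le> n"
  shows "finite (outer_diagrams n k)"
    "card (outer_diagrams n k) + (2 * n choose (n + k + 1)) = 2 * n choose (n + k)"
proof -
  note b = bij_betw_outer_ballot[OF assms]
  show "finite (outer_diagrams n k)" using bij_betw_finite[OF b] ballot_sets_finite by simp
  have "card (outer_diagrams n k) = card (ballot_sets (2 * n) (n - k))" by (rule bij_betw_same_card[OF b])
  moreover have "2 * n choose (n - k) = 2 * n choose (n + k)"
    using binomial_symmetric[of "n - k" "2 * n"] assms by (simp add: algebra_simps)
  \<comment> \<open>For \<open>n = k\<close> the binomial on the right has lower index
    \<open>2 * n + 1\<close> and vanishes, in accordance with the convention for the empty ballot
    set.\<close>
  moreover have "(if n - k = 0 then 0 else 2 * n choose (n - k - 1)) = 2 * n choose (n + k + 1)"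
  proof (cases "n = k")
    case False
    then have "2 * n - (n - k - 1) = n + k + 1" using assms by simp
    then show ?thesis using False assms binomial_symmetric[of "n - k - 1" "2 * n"] by simp
  qed simp
  ultimately show "card (outer_diagrams n k) + (2 * n choose (n + k + 1)) = 2 * n choose (n + k)"
    using card_ballot_sets[of "n - k" "2 * n"] by simp
qed

section \<open>Reduction to outermost dotted arcs\<close>

text \<open>The termination measure of the reduction: each rewriting step lowers it
  strictly.\<close>

definition nesting :: "diagram \<Rightarrow> nat" where
  "nesting = (\<lambda>(A, D). \<Sum>y\<in>D. \<Sum>x\<in>A. of_bool (encloses x y))"

context russell_context begin

definition depth :: "arc \<Rightarrow> nat" where
  "depth y = (\<Sum>x\<in>E. of_bool (encloses x y))"

text \<open>The share of the common arcs \<open>E\<close>, measured by \<open>depth\<close>, is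
  separated from that of the two local arcs \<open>x\<close> and \<open>x'\<close>.\<close>

lemma nesting_dgm:
  assumes "E \<union> V \<union> D = E \<union> {x, x'}" "x \<notin> E" "x' \<notin> E" "x \<noteq> x'" "D \<inter> F = {}" "finite D"
  shows "nesting (dgm E F V D)
    = (\<Sum>y\<in>F. depth y + of_bool (encloses x y) + of_bool (encloses x' y))
      + (\<Sum>y\<in>D. depth y + of_bool (encloses x y) + of_bool (encloses x' y))"
proof -
  have "(\<Sum>z\<in>E \<union> {x, x'}. of_bool (encloses z y)) = depth y + of_bool (encloses x y) + of_bool (encloses x' y)" for y
    using assms(2-4) E_finite by (simp add: depth_def)
  moreover have "F \<inter> D = {}" using assms(5) by auto
  ultimately show ?thesis
    unfolding nesting_def dgm_def assms(1) using assms(6) F_finite by (simp add: sum.union_disjoint)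
qed

lemma depth_mono:
  assumes "\<And>x. x \<in> E \<Longrightarrow> encloses x y \<Longrightarrow> encloses x y'"
  shows "depth y \<le> depth y'"
  unfolding depth_def by (rule sum_mono) (use assms in auto)

text \<open>By \<open>E_regions\<close>, an arc of \<open>E\<close> that encloses
  \<open>(a, b)\<close> or \<open>(c, d)\<close> encloses all four points. So \<open>(b, c)\<close>
  is at least as deep as the other places where a dot can go.\<close>

lemma depth_le:
  "depth (a, b) \<le> depth (b, c)" "depth (c, d) \<le> depth (b, c)" "depth (a, d) \<le> depth (b, c)"
  "depth (a, b) \<le> depth (a, d)" "x \<in> encl \<Longrightarrow> depth x \<le> depth (b, c)"
proof -
  have ab: "l < a \<and> d < p" if "(l, p) \<in> E" "encloses (l, p) (a, b)" for l p
    using E_regions[OF that(1)] that(2) order by (auto simp: encloses_def)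
  have cd: "l < a \<and> d < p" if "(l, p) \<in> E" "encloses (l, p) (c, d)" for l p
    using E_regions[OF that(1)] that(2) order by (auto simp: encloses_def)
  show "depth (a, b) \<le> depth (b, c)"
    by (rule depth_mono) (use ab order in \<open>force simp: encloses_def\<close>)
  show "depth (c, d) \<le> depth (b, c)"
    by (rule depth_mono) (use cd order in \<open>force simp: encloses_def\<close>)
  show "depth (a, d) \<le> depth (b, c)"
    by (rule depth_mono) (use order in \<open>force simp: encloses_def\<close>)
  show "depth (a, b) \<le> depth (a, d)"
    by (rule depth_mono) (use ab order in \<open>force simp: encloses_def\<close>)
  show "depth x \<le> depth (b, c)" if "x \<in> encl"
    by (rule depth_mono) (use that order in \<open>force simp: encloses_def encl_def\<close>)
qed

text \<open>An arc under ab or under cd is also under ad, and it cannot be under both.\<close>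

lemma encloses_local:
  assumes "y \<in> E"
  shows "of_bool (encloses (a, b) y) + of_bool (encloses (c, d) y) \<le> (of_bool (encloses (a, d) y) + of_bool (encloses (b, c) y) :: nat)"
  using E_arc[of "fst y" "snd y"] assms order by (auto simp: encloses_def)

lemma sum_F_le:
  "(\<Sum>y\<in>F. depth y + of_bool (encloses (a, b) y) + of_bool (encloses (c, d) y))
    \<le> (\<Sum>y\<in>F. depth y + of_bool (encloses (a, d) y) + of_bool (encloses (b, c) y))"
proof (rule sum_mono)
  fix y assume "y \<in> F"
  then have "y \<in> E" using FE by blast
  from encloses_local[OF this]
  show "depth y + of_bool (encloses (a, b) y) + of_bool (encloses (c, d) y)
    \<le> depth y + of_bool (encloses (a, d) y) + of_bool (encloses (b, c) y)" by linarith
qed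

lemma encl_facts:
  assumes "x \<in> encl"
  shows "x \<in> E" "x \<notin> F" "\<not> encloses (a, b) x" "\<not> encloses (c, d) x" "\<not> encloses (a, d) x" "\<not> encloses (b, c) x" "\<not> encloses x x"
  using assms order by (auto simp: encl_def encloses_def)

lemma nesting_nested:
  "nesting (dgm E F {(a, d)} {(b, c)})
    = (\<Sum>y\<in>F. depth y + of_bool (encloses (a, d) y) + of_bool (encloses (b, c) y)) + depth (b, c) + 1"
  using order not_in_E not_in_F by (subst nesting_dgm[of _ _ "(a, d)" "(b, c)"]) (auto simp: encloses_def)

lemma nesting_nested':
  "nesting (dgm E F {} {(a, d), (b, c)})
    = (\<Sum>y\<in>F. depth y + of_bool (encloses (a, d) y) + of_bool (encloses (b, c) y)) + depth (a, d) + depth (b, c) + 1"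
  using order not_in_E not_in_F by (subst nesting_dgm[of _ _ "(a, d)" "(b, c)"]) (auto simp: encloses_def)

lemma dgm_in_diagrams:
  assumes "E \<union> V \<union> D = E \<union> {(a, d), (b, c)} \<or> E \<union> V \<union> D = E \<union> {(a, b), (c, d)}" "card (F \<union> D) = k"
  shows "dgm E F V D \<in> diagrams n k"
proof -
  have "crossingless_matching n (E \<union> V \<union> D)" using assms(1) nested unnested by metis
  then show ?thesis using assms(2) FE by (auto simp: diagrams_def dgm_def)
qed

text \<open>The dotted bc under ad counts 1 on the left and has no counterpart on the right, while
  no other contribution grows.\<close>

lemma typeI_relator_keys:
  assumes v: "v \<in> Poly_Mapping.keys typeI_relator"
  shows "nesting v < nesting (dgm E F {(a, d)} {(b, c)})" "Suc (card F) = k \<Longrightarrow> v \<in> diagrams n k"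
proof -
  let ?xs = "undotted_enclosing E F a d"
  have "Poly_Mapping.keys typeI_relator \<subseteq> {dgm E F {(c, d)} {(a, b)}, dgm E F {(a, b)} {(c, d)}, dgm E F {(b, c)} {(a, d)}}
      \<union> (\<Union>i\<in>{1..length ?xs}. {dgm E F {(a, b), (c, d)} {?xs ! (i - 1)}})"
    unfolding typeI_relator_def
    by (intro order_trans[OF keys_add] order_trans[OF keys_sum] Un_least UN_least) auto
  with v consider "v = dgm E F {(c, d)} {(a, b)}" | "v = dgm E F {(a, b)} {(c, d)}" | "v = dgm E F {(b, c)} {(a, d)}"
    | i where "i \<in> {1..length ?xs}" "v = dgm E F {(a, b), (c, d)} {?xs ! (i - 1)}" by blast
  then have "nesting v < nesting (dgm E F {(a, d)} {(b, c)}) \<and> (Suc (card F) = k \<longrightarrow> v \<in> diagrams n k)"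
  proof cases
    case 1
    have "nesting v = (\<Sum>y\<in>F. depth y + of_bool (encloses (a, b) y) + of_bool (encloses (c, d) y)) + depth (a, b)"
      unfolding 1 using order not_in_E not_in_F
      by (subst nesting_dgm[of _ _ "(a, b)" "(c, d)"]) (auto simp: encloses_def)
    moreover have "Suc (card F) = k \<Longrightarrow> v \<in> diagrams n k"
      unfolding 1 using not_in_F F_finite by (intro dgm_in_diagrams) auto
    ultimately show ?thesis using sum_F_le depth_le(1) nesting_nested by simp
  next
    case 2
    have "nesting v = (\<Sum>y\<in>F. depth y + of_bool (encloses (a, b) y) + of_bool (encloses (c, d) y)) + depth (c, d)"
      unfolding 2 using order not_in_E not_in_F
      by (subst nesting_dgm[of _ _ "(a, b)" "(c, d)"]) (auto simp: encloses_def)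
    moreover have "Suc (card F) = k \<Longrightarrow> v \<in> diagrams n k"
      unfolding 2 using not_in_F F_finite by (intro dgm_in_diagrams) auto
    ultimately show ?thesis using sum_F_le depth_le(2) nesting_nested by simp
  next
    case 3
    have "nesting v = (\<Sum>y\<in>F. depth y + of_bool (encloses (a, d) y) + of_bool (encloses (b, c) y)) + depth (a, d)"
      unfolding 3 using order not_in_E not_in_F
      by (subst nesting_dgm[of _ _ "(a, d)" "(b, c)"]) (auto simp: encloses_def)
    moreover have "Suc (card F) = k \<Longrightarrow> v \<in> diagrams n k"
      unfolding 3 using not_in_F F_finite by (intro dgm_in_diagrams) auto
    ultimately show ?thesis using depth_le(3) nesting_nested by simp
  next
    case (4 i)
    define x where "x = ?xs ! (i - 1)"
    have x: "x \<in> encl" unfolding x_def by (rule encl_nth[OF 4(1)])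
    note xf = encl_facts[OF x]
    have v: "v = dgm E F {(a, b), (c, d)} {x}" using 4(2) by (simp add: x_def)
    have "nesting v = (\<Sum>y\<in>F. depth y + of_bool (encloses (a, b) y) + of_bool (encloses (c, d) y)) + depth x"
      unfolding v using order not_in_E xf
      by (subst nesting_dgm[of _ _ "(a, b)" "(c, d)"]) auto
    moreover have "Suc (card F) = k \<Longrightarrow> v \<in> diagrams n k"
      unfolding v using xf F_finite by (intro dgm_in_diagrams) auto
    ultimately show ?thesis using sum_F_le depth_le(5)[OF x] nesting_nested by simp
  qed
  then show "nesting v < nesting (dgm E F {(a, d)} {(b, c)})" "Suc (card F) = k \<Longrightarrow> v \<in> diagrams n k" by blast+
qed

lemma typeII_tail_keys:
  assumes v: "v \<in> Poly_Mapping.keys typeII_tail"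
  shows "nesting v < nesting (dgm E F {} {(a, d), (b, c)})" "card F + 2 = k \<Longrightarrow> v \<in> diagrams n k"
proof -
  let ?xs = "undotted_enclosing E F a d"
  have "Poly_Mapping.keys typeII_tail \<subseteq> (\<Union>i\<in>{1..length ?xs}. {dgm E F {(b, c)} {(a, d), ?xs ! (i - 1)}})"
    unfolding typeII_tail_def
    by (intro order_trans[OF keys_sum] UN_mono) auto
  with v obtain i where i: "i \<in> {1..length ?xs}" "v = dgm E F {(b, c)} {(a, d), ?xs ! (i - 1)}" by blast
  define x where "x = ?xs ! (i - 1)"
  have x: "x \<in> encl" unfolding x_def by (rule encl_nth[OF i(1)])
  note xf = encl_facts[OF x]
  have v: "v = dgm E F {(b, c)} {(a, d), x}" using i(2) by (simp add: x_def)
  have ne: "x \<noteq> (a, d)" using xf(1) not_in_E by blast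
  have "nesting v = (\<Sum>y\<in>F. depth y + of_bool (encloses (a, d) y) + of_bool (encloses (b, c) y)) + (depth (a, d) + depth x)"
    unfolding v using order not_in_E not_in_F xf ne
    by (subst nesting_dgm[of _ _ "(a, d)" "(b, c)"]) (auto simp: encloses_def)
  then show "nesting v < nesting (dgm E F {} {(a, d), (b, c)})"
    using depth_le(5)[OF x] nesting_nested' by simp
  show "v \<in> diagrams n k" if "card F + 2 = k"
    unfolding v using that xf ne not_in_F F_finite by (intro dgm_in_diagrams) auto
qed

lemma nesting_unnested:
  "nesting (dgm E F {} {(a, b), (c, d)}) < nesting (dgm E F {} {(a, d), (b, c)})"
proof -
  have "nesting (dgm E F {} {(a, b), (c, d)})
      = (\<Sum>y\<in>F. depth y + of_bool (encloses (a, b) y) + of_bool (encloses (c, d) y)) + (depth (a, b) + depth (c, d))"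
    using order not_in_E not_in_F by (subst nesting_dgm[of _ _ "(a, b)" "(c, d)"]) (auto simp: encloses_def)
  then show ?thesis using sum_F_le depth_le(2,4) nesting_nested' by simp
qed

end

lemma relation_keys:
  assumes "f \<in> type_I n k \<union> type_II n k"
  shows "Poly_Mapping.keys f \<subseteq> diagrams n k"
  using assms
proof
  assume "f \<in> type_I n k"
  then show ?thesis
  proof (rule type_I_E)
    fix E F a b c d assume ctx: "russell_context n E F a b c d" and k: "Suc (card F) = k"
      and f: "f = Poly_Mapping.single (dgm E F {(a, d)} {(b, c)}) 1 - russell_context.typeI_relator E F a b c d"
    interpret russell_context n E F a b c d by fact
    have "dgm E F {(a, d)} {(b, c)} \<in> diagrams n k"
      using k not_in_F F_finite by (intro dgm_in_diagrams) auto
    moreover have "Poly_Mapping.keys typeI_relator \<subseteq> diagrams n k" using typeI_relator_keys(2) k by blast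
    ultimately show ?thesis unfolding f
      by (intro order_trans[OF keys_diff_subset] Un_least) auto
  qed
next
  assume "f \<in> type_II n k"
  then show ?thesis
  proof (rule type_II_E)
    fix E F a b c d assume ctx: "russell_context n E F a b c d" and k: "card F + 2 = k"
      and f: "f = Poly_Mapping.single (dgm E F {} {(a, b), (c, d)}) 1
        - (Poly_Mapping.single (dgm E F {} {(a, d), (b, c)}) 1 + russell_context.typeII_tail E F a b c d)"
    interpret russell_context n E F a b c d by fact
    have "dgm E F {} {(a, b), (c, d)} \<in> diagrams n k" "dgm E F {} {(a, d), (b, c)} \<in> diagrams n k"
      using k order not_in_F F_finite by (auto intro!: dgm_in_diagrams)
    moreover have "Poly_Mapping.keys typeII_tail \<subseteq> diagrams n k" using typeII_tail_keys(2) k by blast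
    ultimately show ?thesis unfolding f
      by (intro order_trans[OF keys_diff_subset] Un_least order_trans[OF keys_add]) auto
  qed
qed

text \<open>The danger is an arc from between a and b to beyond c, which would cross the new arcs.
  \<open>parent\<close> excludes it: ad must be the immediate parent of bc.\<close>

lemma crossingless_unnest:
  assumes A: "crossingless_matching n A" and ad: "(a, d) \<in> A" and bc: "(b, c) \<in> A" and less: "a < b" "c < d"
    and parent: "\<And>l p. (l, p) \<in> A \<Longrightarrow> a < l \<Longrightarrow> l < b \<Longrightarrow> \<not> c < p"
  shows "crossingless_matching n ((A - {(a, d), (b, c)}) \<union> {(a, b), (c, d)})"
proof -
  have "b < c" using crossingless_arc(2)[OF A bc] .
  define E where "E = A - {(a, d), (b, c)}"
  have E: "(l, p) \<in> A" "l \<noteq> a" "l \<noteq> b" "l \<noteq> c" "l \<noteq> d" "p \<noteq> a" "p \<noteq> b" "p \<noteq> c" "p \<noteq> d" if "(l, p) \<in> E" for l p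
  proof -
    show lp: "(l, p) \<in> A" using that by (simp add: E_def)
    have "{l, p} \<inter> {a, d} = {}" "{l, p} \<inter> {b, c} = {}"
      using crossingless_unique[OF A lp ad] crossingless_unique[OF A lp bc] that by (auto simp: E_def)
    then show "l \<noteq> a" "l \<noteq> b" "l \<noteq> c" "l \<noteq> d" "p \<noteq> a" "p \<noteq> b" "p \<noteq> c" "p \<noteq> d" by auto
  qed
  note bounds = crossingless_arc[OF A ad] crossingless_arc[OF A bc]
  have "crossingless_matching n (E \<union> {(a, b), (c, d)})"
  proof (rule crossingless_matchingI)
    show "1 \<le> i \<and> i < j \<and> j \<le> 2 * n" if "(i, j) \<in> E \<union> {(a, b), (c, d)}" for i j
      using that
    proof
      assume "(i, j) \<in> E"
      then show ?thesis using crossingless_arc[OF A E(1)] by blast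
    qed (use bounds less in auto)
    show "p \<in> fst ` (E \<union> {(a, b), (c, d)}) \<union> snd ` (E \<union> {(a, b), (c, d)})" if "1 \<le> p" "p \<le> 2 * n" for p
    proof (cases "p \<in> {a, b, c, d}")
      case False
      have "p \<in> fst ` A \<union> snd ` A" by (rule crossingless_covered[OF A that])
      then obtain x where x: "x \<in> A" "p = fst x \<or> p = snd x" unfolding Un_iff image_iff by metis
      then have "x \<in> E" using False by (auto simp: E_def)
      then show ?thesis using x(2) by blast
    qed auto
    show "i = i' \<and> j = j'" if "(i, j) \<in> E \<union> {(a, b), (c, d)}" "(i', j') \<in> E \<union> {(a, b), (c, d)}" "{i, j} \<inter> {i', j'} \<noteq> {}" for i j i' j'
    proof (cases "(i, j) \<in> E")
      case True
      note e = E[OF this]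
      have "(i', j') \<in> E" using that(2,3) e by auto
      from crossingless_unique[OF A e(1) E(1)[OF this] that(3)] show ?thesis by blast
    next
      case False
      then have ij: "(i, j) = (a, b) \<or> (i, j) = (c, d)" using that(1) by blast
      have "(i', j') \<notin> E" using E[of i' j'] ij that(3) by auto
      then have "(i', j') = (a, b) \<or> (i', j') = (c, d)" using that(2) by blast
      then show ?thesis using ij that(3) less \<open>b < c\<close> by auto
    qed
    note N = crossingless_no_crossing[OF A]
    show "j' \<le> j" if "(i, j) \<in> E \<union> {(a, b), (c, d)}" "(i', j') \<in> E \<union> {(a, b), (c, d)}" "i < i'" "i' < j" for i j i' j'
    proof (cases "(i, j) \<in> E")
      case True
      note e = E[OF this]
      show ?thesis
      proof (cases "(i', j') \<in> E")
        case True
        from N[OF e(1) E(1)[OF this] that(3,4)] show ?thesis .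
      next
        case False
        then have "(i', j') = (a, b) \<or> (i', j') = (c, d)" using that(2) by blast
        then consider "i' = a" "j' = b" | "i' = c" "j' = d" by blast
        then show ?thesis
        proof cases
          case 1
          then have "d \<le> j" using N[OF e(1) ad] that by simp
          then show ?thesis using 1 less \<open>b < c\<close> by simp
        next
          case 2
          consider "i < a" | "a < i" "i < b" | "b < i" using e by linarith
          then show ?thesis
          proof cases
            case a: 1
            then have "d \<le> j" using N[OF e(1) ad] that 2 less \<open>b < c\<close> by simp
            then show ?thesis using 2 by simp
          next
            case a: 2
            then show ?thesis using parent[OF e(1)] that 2 by simp
          next
            case a: 3
            then show ?thesis using N[OF bc e(1)] that 2 by simp
          qed
        qed
      qed
    next
      case False
      then have "(i, j) = (a, b) \<or> (i, j) = (c, d)" using that(1) by blast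
      then consider "i = a" "j = b" | "i = c" "j = d" by blast
      then show ?thesis
      proof cases
        case 1
        then have "(i', j') \<in> E" using that less \<open>b < c\<close> by auto
        note e' = E[OF this]
        have "\<not> c < j'" using parent[OF e'(1)] 1 that by simp
        moreover have "b < j' \<Longrightarrow> c \<le> j'" using N[OF e'(1) bc] 1 that by simp
        ultimately show ?thesis using 1 e' by linarith
      next
        case 2
        then have "(i', j') \<in> E" using that less \<open>b < c\<close> by auto
        note e' = E[OF this]
        show ?thesis using N[OF ad e'(1)] 2 that less \<open>b < c\<close> by simp
      qed
    qed
  qed
  then show ?thesis by (simp add: E_def)
qed

text \<open>Among the arcs over bc, the one with the largest left end is innermost.\<close>

lemma immediate_parent:
  assumes A: "crossingless_matching n A" and x: "x \<in> A" "encloses x (b, c)" and bc: "(b, c) \<in> A"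
  obtains a d where "(a, d) \<in> A" "a < b" "c < d" "\<And>l p. (l, p) \<in> A \<Longrightarrow> a < l \<Longrightarrow> l < b \<Longrightarrow> \<not> c < p"
proof -
  define P where "P = {l. \<exists>p. (l, p) \<in> A \<and> l < b \<and> c < p}"
  have fin: "finite P" by (rule finite_subset[of _ "{..<b}"]) (auto simp: P_def)
  have "fst x \<in> P" using x by (auto simp: P_def encloses_def intro!: exI[of _ "snd x"])
  then have "Max P \<in> P" using fin by (auto intro: Max_in)
  then obtain d where d: "(Max P, d) \<in> A" "Max P < b" "c < d" by (auto simp: P_def)
  have "\<not> c < p" if "(l, p) \<in> A" "Max P < l" "l < b" for l p
  proof
    assume "c < p"
    then have "l \<in> P" using that by (auto simp: P_def)
    then show False using Max_ge[OF fin, of l] that by simp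
  qed
  with d that show ?thesis by blast
qed

section \<open>Spanning by outer diagrams and the rank\<close>

lemma russell_free_quotient: "free_quotient (diagrams n k) (type_I n k \<union> type_II n k)"
  by unfold_locales (rule relation_keys)

text \<open>A dotted arc with an arc over it has an immediate parent. If the parent is undotted,
  Type I rewrites the diagram; if it is dotted, Type II does so from right to left.\<close>

lemma outer_diagrams_span:
  assumes "v \<in> diagrams n k"
  shows "\<exists>g. Poly_Mapping.keys g \<subseteq> outer_diagrams n k
    \<and> Poly_Mapping.single v 1 - g \<in> free_quotient.N (diagrams n k) (type_I n k \<union> type_II n k)"
  using assms
proof (induction v rule: measure_induct_rule[of nesting])
  case (less v)
  interpret free_quotient "diagrams n k" "type_I n k \<union> type_II n k" by (rule russell_free_quotient)
  obtain A D where v: "v = (A, D)" by (cases v)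
  note c = diagramsD[OF less.prems[unfolded v]]
  show ?case
  proof (cases "v \<in> outer_diagrams n k")
    case True
    then show ?thesis using N_zero by (intro exI[of _ "Poly_Mapping.single v 1"]) simp
  next
    case False
    then obtain x b0 c0 where x: "x \<in> A" "(b0, c0) \<in> D" "encloses x (b0, c0)"
      using less.prems by (auto simp: v outer_diagrams_def)
    define b where "b = b0"
    define c' where "c' = c0"
    have bcD: "(b, c') \<in> D" and bc: "(b, c') \<in> A" and enc: "encloses x (b, c')" using x c(2) by (auto simp: b_def c'_def)
    obtain a d where ad: "(a, d) \<in> A" "a < b" "c' < d" and parent: "\<And>l p. (l, p) \<in> A \<Longrightarrow> a < l \<Longrightarrow> l < b \<Longrightarrow> \<not> c' < p"
      using immediate_parent[OF c(1) x(1) enc bc] by blast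
    define E where "E = A - {(a, d), (b, c')}"
    define F where "F = D - {(a, d), (b, c')}"
    have "b < c'" using crossingless_arc(2)[OF c(1) bc] .
    have AE: "E \<union> {(a, d), (b, c')} = A" using ad bc by (auto simp: E_def)
    interpret russell_context n E F a b c' d
    proof
      show "a < b" "b < c'" "c' < d" by fact+
      show "F \<subseteq> E" using c(2) by (auto simp: E_def F_def)
      show "crossingless_matching n (E \<union> {(a, d), (b, c')})" using c(1) AE by simp
      show "crossingless_matching n (E \<union> {(a, b), (c', d)})"
        unfolding E_def by (rule crossingless_unnest[OF c(1) ad(1) bc ad(2,3) parent])
    qed
    show ?thesis
    proof (cases "(a, d) \<in> D")
      case False
      have vd: "v = dgm E F {(a, d)} {(b, c')}"
        using AE bcD False c(2) by (auto simp: v dgm_def F_def)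
      have "F \<union> {(b, c')} = D" using bcD False by (auto simp: F_def)
      then have card: "Suc (card F) = k" using c(3) not_in_F F_finite by (metis Un_insert_right card_insert_disjoint sup_bot_right)
      have "dgm E F {(c', d)} {(a, b)} \<in> diagrams n k"
        using card not_in_F F_finite by (intro dgm_in_diagrams) auto
      then have "Poly_Mapping.single v 1 - typeI_relator \<in> type_I n k"
        using less.prems order FE unfolding vd typeI_relator_def type_I_def by blast
      then have 1: "Poly_Mapping.single v 1 - typeI_relator \<in> N" by (intro N_base) blast
      have "\<exists>g. Poly_Mapping.keys g \<subseteq> outer_diagrams n k \<and> typeI_relator - g \<in> N"
        by (rule congruent_combination) (use less.IH typeI_relator_keys card vd in metis)
      then obtain g where "Poly_Mapping.keys g \<subseteq> outer_diagrams n k" "typeI_relator - g \<in> N" by blast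
      then show ?thesis using N_add[OF 1, of "typeI_relator - g"] by (intro exI[of _ g]) simp
    next
      case True
      have vd: "v = dgm E F {} {(a, d), (b, c')}"
        using AE bcD True c(2) by (auto simp: v dgm_def F_def)
      have "F \<union> {(a, d), (b, c')} = D" using bcD True by (auto simp: F_def)
      moreover have "card (F \<union> {(a, d), (b, c')}) = card F + 2"
        using not_in_F F_finite order by simp
      ultimately have card: "card F + 2 = k" using c(3) by simp
      let ?u = "dgm E F {} {(a, b), (c', d)}"
      have u: "?u \<in> diagrams n k" using card order not_in_F F_finite by (intro dgm_in_diagrams) auto
      then have "Poly_Mapping.single ?u 1 - (Poly_Mapping.single v 1 + typeII_tail) \<in> type_II n k"
        using less.prems order FE unfolding vd typeII_tail_def type_II_def by blast
      then have "Poly_Mapping.single ?u 1 - (Poly_Mapping.single v 1 + typeII_tail) \<in> N" by (intro N_base) blast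
      \<comment> \<open>The nested diagram has the invertible coefficient -1 in the relator, so Type
        II can be solved for it.\<close>
      from N_smul[OF this, of "-1"]
      have 1: "Poly_Mapping.single v 1 - (Poly_Mapping.single ?u 1 - typeII_tail) \<in> N" by (simp add: algebra_simps)
      have "\<exists>g. Poly_Mapping.keys g \<subseteq> outer_diagrams n k \<and> (Poly_Mapping.single ?u 1 - typeII_tail) - g \<in> N"
      proof (rule congruent_combination)
        fix w assume "w \<in> Poly_Mapping.keys (Poly_Mapping.single ?u (1::laurent) - typeII_tail)"
        then have "w = ?u \<or> w \<in> Poly_Mapping.keys typeII_tail"
          using keys_diff_subset[of "Poly_Mapping.single ?u (1::laurent)" typeII_tail] by auto
        then show "\<exists>g. Poly_Mapping.keys g \<subseteq> outer_diagrams n k \<and> Poly_Mapping.single w 1 - g \<in> N"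
          using less.IH[of w] u nesting_unnested typeII_tail_keys[of w] card vd by metis
      qed
      then obtain g where "Poly_Mapping.keys g \<subseteq> outer_diagrams n k"
        "(Poly_Mapping.single ?u 1 - typeII_tail) - g \<in> N" by blast
      then show ?thesis using N_add[OF 1, of "(Poly_Mapping.single ?u 1 - typeII_tail) - g"]
        by (intro exI[of _ g]) simp
    qed
  qed
qed

lemma phi_leads:
  assumes "(A, D) \<in> diagrams n k"
  shows "leads (phi n (A, D)) (snd ` (A - D))"
proof -
  note c = diagramsD[OF assms]
  have uq: "unique_right (A - D)"
    unfolding unique_right_def
  proof (intro allI impI)
    fix l l' p assume "(l, p) \<in> A - D" "(l', p) \<in> A - D"
    then have "(l, p) \<in> A" "(l', p) \<in> A" by auto
    then show "l = l'" using crossingless_unique(1)[OF c(1), of l p l' p] by blast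
  qed
  have "leads (apply_op (prodl (fac (fst ` D) (A - D)) 1 (Suc (2 * n))) (\<lambda>S. if S = {} then 1 else 0))
      (snd ` (A - D) \<inter> {1..<Suc (2 * n)})"
  proof (rule leads_prodl)
    fix p assume "p \<in> snd ` (A - D)"
    then obtain l where l: "(l, p) \<in> A - D" by auto
    then show "\<exists>c V. c \<noteq> 0 \<and> V \<in> lin (q_pow 2) {..<p} \<and> fac (fst ` D) (A - D) p = c \<cdot> gen (q_pow 2) p + V"
      using crossingless_arc(2)[OF c(1), of l p] by (intro fac_leading[OF uq l]) blast
  next
    fix p assume "p \<notin> snd ` (A - D)"
    then have "(l, p) \<notin> A - D" for l by force
    then show "fac (fst ` D) (A - D) p = 1" by (rule fac_none)
  qed (simp_all add: q_pow_nonzero)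
  moreover have "p \<in> {1..<Suc (2 * n)}" if "p \<in> snd ` (A - D)" for p
  proof -
    from that obtain l where "(l, p) \<in> A" by auto
    from crossingless_arc[OF c(1) this] show ?thesis by simp
  qed
  then have "snd ` (A - D) \<inter> {1..<Suc (2 * n)} = snd ` (A - D)" by blast
  ultimately show ?thesis by (simp add: phi_def vac_value_def)
qed

lemma module_rank_russell_space:
  assumes "k \<le> n"
  shows "module_rank laurent_ring (russell_space n k) = enat (card (outer_diagrams n k))"
proof -
  interpret free_quotient "diagrams n k" "type_I n k \<union> type_II n k" by (rule russell_free_quotient)
  have sub: "outer_diagrams n k \<subseteq> diagrams n k" by (auto simp: outer_diagrams_def)
  have "module_rank laurent_ring Q = enat (card (outer_diagrams n k))"
  proof (rule module_rank_quotient[where \<phi> = "phi n"])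
    show "finite (outer_diagrams n k)" by (rule card_outer_diagrams(1)[OF assms])
    show "outer_diagrams n k \<subseteq> diagrams n k" by (rule sub)
    show "\<exists>g. Poly_Mapping.keys g \<subseteq> outer_diagrams n k \<and> Poly_Mapping.single b 1 - g \<in> N"
      if "b \<in> diagrams n k" for b by (rule outer_diagrams_span[OF that])
    show "linear_ext (phi n) f s = 0" if "f \<in> type_I n k \<union> type_II n k" for f s by (rule phi_kills[OF that])
    fix c :: "diagram \<Rightarrow> laurent"
    assume zero: "\<And>s. (\<Sum>b\<in>outer_diagrams n k. c b * phi n b s) = 0"
    show "\<forall>b\<in>outer_diagrams n k. c b = 0"
    proof (rule leading_independent[OF card_outer_diagrams(1)[OF assms] _ _ zero])
      show "inj_on (\<lambda>(A, D). snd ` (A - D)) (outer_diagrams n k)"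
        by (rule bij_betw_imp_inj_on[OF bij_betw_outer_ballot[OF assms]])
      fix b assume "b \<in> outer_diagrams n k"
      then show "leads (phi n b) ((\<lambda>(A, D). snd ` (A - D)) b)" using sub phi_leads by (cases b) auto
    qed
  qed
  then show ?thesis by (simp only: Q_def N_def russell_space_def russell_free_def)
qed

text \<open>Absorption makes the second binomial (n - k)/(n + k + 1) times the first, and
  subtracting this fraction from 1 leaves (2k + 1)/(n + k + 1).\<close>

lemma ballot_number_ratio:
  assumes "k \<le> n"
  shows "real (2 * n choose (n + k)) - real (2 * n choose (n + k + 1))
    = real (2 * k + 1) / real (n + k + 1) * real (2 * n choose (n + k))"
proof -
  have "(2 * n choose Suc (n + k)) * Suc (n + k) = (2 * n choose (n + k)) * (2 * n - (n + k))"
    using binomial_absorb_comp[of "2 * n" "n + k"] binomial_absorption[of "n + k" "2 * n"]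
    by (simp only: mult.commute)
  then have "real (2 * n choose Suc (n + k)) * real (Suc (n + k)) = real (2 * n choose (n + k)) * real (n - k)"
    unfolding of_nat_mult[symmetric] by simp
  then show ?thesis using assms by (simp add: field_simps of_nat_diff)
qed

theorem proposition4p4p5:
  fixes n k :: nat
  assumes "k \<le> n"
  shows "ereal_of_enat (module_rank laurent_ring (russell_space n k))
           = ereal (real (2 * n choose (n + k)) - real (2 * n choose (n + k + 1)))
         \<and> real (2 * n choose (n + k)) - real (2 * n choose (n + k + 1))
           = real (2 * k + 1) / real (n + k + 1) * real (2 * n choose (n + k))"
proof
  have "real (2 * n choose (n + k)) - real (2 * n choose (n + k + 1)) = real (card (outer_diagrams n k))"
    using card_outer_diagrams(2)[OF assms] by (simp flip: of_nat_add add: diff_eq_eq)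
  then show "ereal_of_enat (module_rank laurent_ring (russell_space n k))
      = ereal (real (2 * n choose (n + k)) - real (2 * n choose (n + k + 1)))"
    unfolding module_rank_russell_space[OF assms] by simp
  show "real (2 * n choose (n + k)) - real (2 * n choose (n + k + 1))
      = real (2 * k + 1) / real (n + k + 1) * real (2 * n choose (n + k))"
    by (rule ballot_number_ratio[OF assms])
qed

end
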